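(* Let $0<\alpha<1$ and $T>0$. The equation $\partial_t^\alpha u-\mathrm{i}Au=f$ on $(0,T)$ satisfies the maximal $L^2$-regularity: for every $f\in L^2(0,T;H)$ the unique weak solution $u$ belongs to $H_\alpha(0,T;H)\cap L^2(0,T;D(A))$, and there exists a constant $C>0$, independent of $f$, such that \[ \|u\|_{H_{\alpha}(0,T;H)}+\|u\|_{L^2(0,T;D(A))}\le C\,\|f\|_{L^2(0,T;H)}. \]
   Context: $(H,\langle\cdot,\cdot\rangle)$ is a complex Hilbert space with norm $\|\cdot\|$ (inner product linear in the first argument). $A:D(A)\subset H\to H$ is self-adjoint, negative-definite ($\langle Au,u\rangle<0$ for all $u\in D(A)\setminus\{0\}$) and has compact resolvent. $\{\varphi_n\}_{n\in\mathbb N}\subset D(A)$ is an orthonormal basis of $H$ with $A\varphi_n=-\lambda_n\varphi_n$, $0<\lambda_1\le\lambda_2\le\cdots\to\infty$. $D(A)$ carries the norm $\|u\|_{D(A)}=\|Au\|$ (equivalent to the graph norm). Fractional derivative. For $1<p<\infty$ and $v\in L^p(0,T;H)$, $J^\alpha v(t)=\frac1{\Gamma(\alpha)}\int_0^t(t-s)^{\alpha-1}v(s)\,\mathrm ds$; $J^\alpha$ is injective on $L^p(0,T;H)$. $W_{\alpha,p}(0,T;H)=J^\alpha L^p(0,T;H)$ with norm $\|v\|_{W_{\alpha,p}(0,T;H)}=\|J^{-\alpha}v\|_{L^p(0,T;H)}$, $H_\alpha(0,T;H)=W_{\alpha,2}(0,T;H)$, and $\partial_t^\alpha:=J^{-\alpha}$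 with domain $W_{\alpha,p}(0,T;H)$. Weak solution. Let $q$ be the conjugate exponent of $p$, $(\tau_Tv)(t)=v(T-t)$, and $(\partial_t^\alpha)'u=\tau_T\partial_t^\alpha(\tau_Tu)$ for $u\in\tau_TW_{\alpha,q}(0,T;H)$. Let $\Psi=\{\psi\in C^\infty([0,T];D(A)):\psi(T)=0\}$ (which is contained in the domain of $(\partial_t^\alpha)'$). For $f\in L^p(0,T;H)$, a weak solution of $\partial_t^\alpha u-\mathrm{i}Au=f$ is $u\in L^p(0,T;H)$ such that $\int_0^T\langle u(t),(\partial_t^\alpha)'\psi(t)+\mathrm iA\psi(t)\rangle\,\mathrm dt=\int_0^T\langle f(t),\psi(t)\rangle\,\mathrm dt$ for all $\psi\in\Psi$. A unique weak solution exists for every $f\in L^p(0,T;H)$. This theorem concerns $p=2$. *)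

theory Defs
  imports "HOL-Analysis.Analysis"
begin

text \<open>
  Complex inner product spaces, built on top of the existing real normed structure.  The last axiom
  carries positivity, definiteness and the compatibility of norm and inner product at once.
\<close>

class complex_inner = real_normed_vector +
  fixes scaleC :: "complex \<Rightarrow> 'a \<Rightarrow> 'a" (infixr "*\<^sub>C" 75)
    and cinner :: "'a \<Rightarrow> 'a \<Rightarrow> complex"
  assumes scaleC_add_right: "a *\<^sub>C (x + y) = a *\<^sub>C x + a *\<^sub>C y"
    and scaleC_add_left: "(a + b) *\<^sub>C x = a *\<^sub>C x + b *\<^sub>C x"
    and scaleC_scaleC: "a *\<^sub>C (b *\<^sub>C x) = (a * b) *\<^sub>C x"
    and scaleC_of_real: "complex_of_real r *\<^sub>C x = scaleR r x"
    and cinner_commute: "cinner x y = cnj (cinner y x)"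
    and cinner_add_left: "cinner (x + y) z = cinner x z + cinner y z"
    and cinner_scaleC_left: "cinner (a *\<^sub>C x) y = a * cinner x y"
    and cinner_self: "cinner x x = complex_of_real ((norm x)\<^sup>2)"

class chilbert_space = complex_inner + banach


subsection \<open>Unbounded operators\<close>

text \<open>
  An unbounded operator is a pair of a domain \<open>D\<close> and a total function \<open>A\<close> whose values outside
  \<open>D\<close> are irrelevant.
\<close>

definition linear_op :: "'h::complex_inner set \<Rightarrow> ('h \<Rightarrow> 'h) \<Rightarrow> bool" where
  "linear_op D A \<longleftrightarrow> module.subspace scaleC D \<and>
     (\<forall>x\<in>D. \<forall>y\<in>D. A (x + y) = A x + A y) \<and> (\<forall>c. \<forall>x\<in>D. A (c *\<^sub>C x) = c *\<^sub>C A x)"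

definition op_graph :: "'h set \<Rightarrow> ('h \<Rightarrow> 'h) \<Rightarrow> ('h \<times> 'h) set" where
  "op_graph D A = {(u, A u) |u. u \<in> D}"

definition adjoint_graph :: "'h::complex_inner set \<Rightarrow> ('h \<Rightarrow> 'h) \<Rightarrow> ('h \<times> 'h) set" where
  "adjoint_graph D A = {(v, w). \<forall>u\<in>D. cinner (A u) v = cinner u w}"

definition self_adjoint :: "'h::complex_inner set \<Rightarrow> ('h \<Rightarrow> 'h) \<Rightarrow> bool" where
  "self_adjoint D A \<longleftrightarrow> linear_op D A \<and> closure D = UNIV \<and> op_graph D A = adjoint_graph D A"

definition negative_definite :: "'h::complex_inner set \<Rightarrow> ('h \<Rightarrow> 'h) \<Rightarrow> bool" where
  "negative_definite D A \<longleftrightarrow>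
     (\<forall>u\<in>D - {0}. cinner (A u) u \<in> \<real> \<and> Re (cinner (A u) u) < 0)"

definition resolvent :: "'h::complex_inner set \<Rightarrow> ('h \<Rightarrow> 'h) \<Rightarrow> complex \<Rightarrow> 'h \<Rightarrow> 'h" where
  "resolvent D A z = inv_into D (\<lambda>u. A u - z *\<^sub>C u)"

definition resolvent_set :: "'h::complex_inner set \<Rightarrow> ('h \<Rightarrow> 'h) \<Rightarrow> complex set" where
  "resolvent_set D A =
     {z. bij_betw (\<lambda>u. A u - z *\<^sub>C u) D UNIV \<and> bounded_linear (resolvent D A z)}"

definition compact_resolvent :: "'h::complex_inner set \<Rightarrow> ('h \<Rightarrow> 'h) \<Rightarrow> bool" where
  "compact_resolvent D A \<longleftrightarrow>
     (\<exists>z\<in>resolvent_set D A. compact (closure (resolvent D A z ` cball 0 1)))"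

definition orthonormal_basis :: "(nat \<Rightarrow> 'h::complex_inner) \<Rightarrow> bool" where
  "orthonormal_basis \<phi> \<longleftrightarrow>
     (\<forall>m n. cinner (\<phi> m) (\<phi> n) = (if m = n then 1 else 0)) \<and>
     closure (module.span scaleC (range \<phi>)) = UNIV"


subsection \<open>Bochner--Lebesgue spaces on \<open>(0,T)\<close>\<close>

text \<open>
  Elements of the spaces below are functions, not equivalence classes; every notion is invariant
  under modification on null sets of \<open>(0,T)\<close>, and equality in the spaces is equality almost
  everywhere.  For \<open>L\<^sup>p(0,T;H)\<close> the space \<open>H\<close> is separable, so strong measurability is Borel
  measurability.
\<close>

definition Lp :: "real \<Rightarrow> real \<Rightarrow> (real \<Rightarrow> 'h::{chilbert_space, second_countable_topology}) set" where
  "Lp p T = {v. v \<in> borel_measurable (lebesgue_on {0<..<T}) \<and>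
     integrable (lebesgue_on {0<..<T}) (\<lambda>t. norm (v t) powr p)}"

definition Lp_norm :: "real \<Rightarrow> real \<Rightarrow> (real \<Rightarrow> 'h::real_normed_vector) \<Rightarrow> real" where
  "Lp_norm p T v = (LINT t|lebesgue_on {0<..<T}. norm (v t) powr p) powr (1 / p)"

text \<open>
  \<open>L\<^sup>p(0,T;D(A))\<close>, where \<open>D(A)\<close> carries the norm \<open>\<parallel>A u\<parallel>\<close>: strong measurability means almost
  everywhere approximation, in that norm, by \<open>D(A)\<close>-valued simple functions.
\<close>

definition Lp_dom :: "'h::{chilbert_space, second_countable_topology} set \<Rightarrow> ('h \<Rightarrow> 'h) \<Rightarrow>
    real \<Rightarrow> real \<Rightarrow> (real \<Rightarrow> 'h) set" where
  "Lp_dom D A p T = {u.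
     (AE t in lebesgue_on {0<..<T}. u t \<in> D) \<and>
     (\<exists>s. (\<forall>i. simple_function (lebesgue_on {0<..<T}) (s i) \<and> s i ` {0<..<T} \<subseteq> D) \<and>
        (AE t in lebesgue_on {0<..<T}. (\<lambda>i. norm (A (s i t - u t))) \<longlonglongrightarrow> 0)) \<and>
     integrable (lebesgue_on {0<..<T}) (\<lambda>t. norm (A (u t)) powr p)}"

definition Lp_dom_norm :: "('h::real_normed_vector \<Rightarrow> 'h) \<Rightarrow> real \<Rightarrow> real \<Rightarrow> (real \<Rightarrow> 'h) \<Rightarrow> real" where
  "Lp_dom_norm A p T u = (LINT t|lebesgue_on {0<..<T}. norm (A (u t)) powr p) powr (1 / p)"


subsection \<open>Fractional derivative\<close>

definition frac_int :: "real \<Rightarrow> (real \<Rightarrow> 'h::{banach, second_countable_topology}) \<Rightarrow> real \<Rightarrow> 'h" where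
  "frac_int \<alpha> v t =
     (1 / Gamma \<alpha>) *\<^sub>R (LINT s:{0<..<t}|lebesgue. (t - s) powr (\<alpha> - 1) *\<^sub>R v s)"

definition frac_Sobolev ::
    "real \<Rightarrow> real \<Rightarrow> real \<Rightarrow> (real \<Rightarrow> 'h::{chilbert_space, second_countable_topology}) set" where
  "frac_Sobolev \<alpha> p T =
     {w. \<exists>v\<in>Lp p T. AE t in lebesgue_on {0<..<T}. w t = frac_int \<alpha> v t}"

text \<open>
  The inverse of \<open>J\<^sup>\<alpha>\<close>; by injectivity of \<open>J\<^sup>\<alpha>\<close> on \<open>L\<^sup>p\<close> the chosen function is determined almost
  everywhere whenever \<open>w \<in> frac_Sobolev \<alpha> p T\<close>.
\<close>

definition frac_deriv :: "real \<Rightarrow> real \<Rightarrow> real \<Rightarrow>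
    (real \<Rightarrow> 'h::{chilbert_space, second_countable_topology}) \<Rightarrow> real \<Rightarrow> 'h" where
  "frac_deriv \<alpha> p T w =
     (SOME v. v \<in> Lp p T \<and> (AE t in lebesgue_on {0<..<T}. w t = frac_int \<alpha> v t))"

definition frac_Sobolev_norm :: "real \<Rightarrow> real \<Rightarrow> real \<Rightarrow>
    (real \<Rightarrow> 'h::{chilbert_space, second_countable_topology}) \<Rightarrow> real" where
  "frac_Sobolev_norm \<alpha> p T w = Lp_norm p T (frac_deriv \<alpha> p T w)"

definition time_reflect :: "real \<Rightarrow> (real \<Rightarrow> 'h) \<Rightarrow> real \<Rightarrow> 'h" where
  "time_reflect T v t = v (T - t)"

definition frac_deriv_adj :: "real \<Rightarrow> real \<Rightarrow> real \<Rightarrow>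
    (real \<Rightarrow> 'h::{chilbert_space, second_countable_topology}) \<Rightarrow> real \<Rightarrow> 'h" where
  "frac_deriv_adj \<alpha> q T w = time_reflect T (frac_deriv \<alpha> q T (time_reflect T w))"


subsection \<open>Weak solutions\<close>

text \<open>
  \<open>C\<^sup>\<infinity>([0,T];D(A))\<close>: \<open>g k\<close> is the \<open>k\<close>-th derivative, one-sided at the end points, and the
  difference quotients converge in the norm \<open>\<parallel>A u\<parallel>\<close> of \<open>D(A)\<close>.
\<close>

definition smooth_dom :: "'h::complex_inner set \<Rightarrow> ('h \<Rightarrow> 'h) \<Rightarrow> real \<Rightarrow> (real \<Rightarrow> 'h) set" where
  "smooth_dom D A T = {\<psi>. \<exists>g :: nat \<Rightarrow> real \<Rightarrow> 'h.
     (\<forall>t\<in>{0..T}. g 0 t = \<psi> t) \<and>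
     (\<forall>k. \<forall>t\<in>{0..T}. g k t \<in> D) \<and>
     (\<forall>k. \<forall>t\<in>{0..T}.
        ((\<lambda>s. norm (A ((1 / (s - t)) *\<^sub>R (g k s - g k t) - g (Suc k) t))) \<longlongrightarrow> 0)
          (at t within {0..T}))}"

definition test_functions :: "'h::complex_inner set \<Rightarrow> ('h \<Rightarrow> 'h) \<Rightarrow> real \<Rightarrow> (real \<Rightarrow> 'h) set" where
  "test_functions D A T = {\<psi> \<in> smooth_dom D A T. \<psi> T = 0}"

definition weak_solution :: "'h::{chilbert_space, second_countable_topology} set \<Rightarrow> ('h \<Rightarrow> 'h) \<Rightarrow>
    real \<Rightarrow> real \<Rightarrow> real \<Rightarrow> (real \<Rightarrow> 'h) \<Rightarrow> (real \<Rightarrow> 'h) \<Rightarrow> bool" where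
  "weak_solution D A \<alpha> p T f u \<longleftrightarrow> u \<in> Lp p T \<and>
     (\<forall>\<psi>\<in>test_functions D A T.
        (LINT t|lebesgue_on {0<..<T}.
           cinner (u t) (frac_deriv_adj \<alpha> (p / (p - 1)) T \<psi> t + \<i> *\<^sub>C A (\<psi> t)))
        = (LINT t|lebesgue_on {0<..<T}. cinner (f t) (\<psi> t)))"

end

theory Submission
  imports Defs
begin

text \<open>
  Writing \<open>u = J\<^sup>\<alpha>v\<close>, the equation is \<open>v - \<i> A J\<^sup>\<alpha>v = f\<close>, and in the coordinate of the \<open>n\<close>-th eigenvector it
  is the scalar Volterra equation \<open>v\<^sub>n + \<i> \<lambda>\<^sub>n J\<^sup>\<alpha>v\<^sub>n = f\<^sub>n\<close>, which a Neumann series solves.  The bound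
  \<open>\<parallel>v\<^sub>n\<parallel> \<le> C \<parallel>f\<^sub>n\<parallel>\<close> is uniform in \<open>n\<close> because for \<open>\<alpha> < 1\<close> the numerical range of \<open>J\<^sup>\<alpha>\<close> lies in a sector
  \<open>\<bar>z\<bar> \<le> c Re z\<close>: testing with \<open>v\<^sub>n\<close> gives \<open>\<parallel>v\<^sub>n\<parallel>\<^sup>2 + \<i> \<lambda>\<^sub>n z = \<langle>f\<^sub>n, v\<^sub>n\<rangle>\<close> with \<open>z = \<langle>J\<^sup>\<alpha>v\<^sub>n, v\<^sub>n\<rangle>\<close>, and the two terms on
  the left cannot cancel.  Summing over \<open>n\<close> gives \<open>v \<in> L\<^sup>2(0,T;H)\<close>, and \<open>Au = \<i> (f - v)\<close> has the same regularity.
  For uniqueness, the test functions \<open>(T\<^bsup>k+1\<^esup> - t\<^bsup>k+1\<^esup>) \<phi>\<^sub>n\<close> show that all moments of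
  \<open>J\<^bsup>1-\<alpha>\<^esup>(d\<^sub>n + \<i> \<lambda>\<^sub>n J\<^sup>\<alpha>d\<^sub>n)\<close> vanish for the difference \<open>d\<close> of two weak solutions.
\<close>

subsection \<open>Integral operators with a Schur kernel\<close>

text \<open>The sector of J^\<alpha> comes from splitting it into two factors J^a with a =
  \<alpha>/2, so that z is bounded by the norms of J^a v and of its adjoint applied to v. Taken over
  the whole line, both Gram kernels are translation invariant and homogeneous; hence both are the
  same multiple of the symmetrised kernel of J^\<alpha>, whose quadratic form is 2 Re z. The
  multiple is finite because y^(a-1) (1+y)^(a-1) is integrable at infinity, which is the condition
  \<alpha> < 1, and it involves neither T nor an eigenvalue. A second obstacle is that J^\<alpha> v
  is an integral that converges only almost everywhere and has a default value elsewhere. Operator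
  identities are therefore a.e. statements, proved behind \<open>ennreal\<close> majorants that
  presuppose no integrability, and coordinates are treated together by uniting countably many null
  sets. The operator J^(1-\<alpha>) enters the uniqueness argument because, for smooth \<psi> with
  \<psi>(T) = 0, the derivative (\<partial>^\<alpha>)' \<psi> is the adjoint of J^(1-\<alpha>)
  applied to -\<psi>'.\<close>

definition kernel_op :: "'a measure \<Rightarrow> ('a \<Rightarrow> 'a \<Rightarrow> real) \<Rightarrow> ('a \<Rightarrow> 'b::{banach, second_countable_topology}) \<Rightarrow> 'a \<Rightarrow> 'b"
  where "kernel_op M k v y = (LINT x|M. k x y *\<^sub>R v x)"

definition sq_int :: "'a measure \<Rightarrow> ('a \<Rightarrow> 'b::{banach, second_countable_topology}) \<Rightarrow> bool" where
  "sq_int M v \<longleftrightarrow> v \<in> borel_measurable M \<and> integrable M (\<lambda>x. (norm (v x))\<^sup>2)"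

text \<open>The square of the L^2 norm, with values in \<open>ennreal\<close>: estimates can be
  stated for merely measurable functions, and their finiteness then proves square
  integrability.\<close>

definition sq_norm :: "'a measure \<Rightarrow> ('a \<Rightarrow> 'b::{banach, second_countable_topology}) \<Rightarrow> ennreal" where
  "sq_norm M v = (\<integral>\<^sup>+x. (ennreal (norm (v x)))\<^sup>2 \<partial>M)"

lemma sq_int_measurable: "sq_int M v \<Longrightarrow> v \<in> borel_measurable M"
  by (simp add: sq_int_def)

lemma sq_int_iff: "sq_int M v \<longleftrightarrow> v \<in> borel_measurable M \<and> sq_norm M v < \<infinity>"
  unfolding sq_int_def sq_norm_def by (auto simp: integrable_iff_bounded ennreal_power)

lemma sq_norm_eq: "sq_int M v \<Longrightarrow> sq_norm M v = ennreal (LINT x|M. (norm (v x))\<^sup>2)"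
  unfolding sq_int_def sq_norm_def by (simp add: nn_integral_eq_integral ennreal_power)

lemma ennreal_square_add_le:
  fixes a b :: ennreal shows "(a + b)\<^sup>2 \<le> 2 * a\<^sup>2 + 2 * b\<^sup>2"
proof (cases a; cases b)
  fix r s :: real assume [simp]: "a = ennreal r" "b = ennreal s" "0 \<le> r" "0 \<le> s"
  have "(r + s)\<^sup>2 \<le> 2 * r\<^sup>2 + 2 * s\<^sup>2"
    using sum_squares_ge_zero[of "r - s" 0] by (simp add: power2_eq_square algebra_simps)
  then have "ennreal ((r + s)\<^sup>2) \<le> ennreal (2 * r\<^sup>2 + 2 * s\<^sup>2)" by (rule ennreal_leI)
  moreover have "(a + b)\<^sup>2 = ennreal ((r + s)\<^sup>2)"
    by (simp add: ennreal_power flip: ennreal_plus)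
  ultimately show ?thesis by (simp add: ennreal_mult ennreal_power)
qed (auto simp: power2_eq_square ennreal_mult_top ennreal_top_mult)

lemma sq_int_add:
  assumes "sq_int M v" "sq_int M w"
  shows "sq_int M (\<lambda>x. v x + w x)"
proof -
  have [measurable]: "v \<in> borel_measurable M" "w \<in> borel_measurable M"
    using assms by (auto simp: sq_int_def)
  have "sq_norm M (\<lambda>x. v x + w x) \<le> (\<integral>\<^sup>+x. 2 * (ennreal (norm (v x)))\<^sup>2 + 2 * (ennreal (norm (w x)))\<^sup>2 \<partial>M)"
    unfolding sq_norm_def
  proof (intro nn_integral_mono)
    fix x
    have "ennreal (norm (v x + w x)) \<le> ennreal (norm (v x)) + ennreal (norm (w x))"
      by (simp add: norm_triangle_ineq flip: ennreal_plus)
    then show "(ennreal (norm (v x + w x)))\<^sup>2 \<le> 2 * (ennreal (norm (v x)))\<^sup>2 + 2 * (ennreal (norm (w x)))\<^sup>2"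
      using ennreal_square_add_le order_trans power_mono by (metis zero_le)
  qed
  also have "\<dots> = 2 * sq_norm M v + 2 * sq_norm M w"
    unfolding sq_norm_def by (simp add: nn_integral_add nn_integral_cmult)
  also have "\<dots> < \<infinity>"
    using assms by (auto simp: sq_int_iff ennreal_mult_less_top)
  finally show ?thesis by (simp add: sq_int_iff)
qed

lemma sq_int_bounded_linear:
  assumes "bounded_linear h" "sq_int M v"
  shows "sq_int M (\<lambda>x. h (v x))"
proof -
  have [measurable]: "v \<in> borel_measurable M" using assms by (simp add: sq_int_def)
  have [measurable]: "h \<in> borel_measurable borel"
    by (intro borel_measurable_continuous_onI linear_continuous_on assms)
  obtain K where K: "0 \<le> K" "\<And>x. norm (h x) \<le> norm x * K"
    using assms(1) by (metis bounded_linear.nonneg_bounded)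
  have "integrable M (\<lambda>x. K\<^sup>2 * (norm (v x))\<^sup>2)" using assms by (simp add: sq_int_def)
  then have "integrable M (\<lambda>x. (norm (h (v x)))\<^sup>2)"
  proof (rule Bochner_Integration.integrable_bound)
    show "AE x in M. norm ((norm (h (v x)))\<^sup>2) \<le> norm (K\<^sup>2 * (norm (v x))\<^sup>2)"
      using power_mono[OF K(2) norm_ge_zero, of _ 2] by (simp add: power_mult_distrib mult.commute)
  qed measurable
  then show ?thesis by (simp add: sq_int_def)
qed

lemma sq_int_integrable:
  assumes "finite_measure M" "sq_int M v" shows "integrable M v"
proof -
  interpret finite_measure M by fact
  have [measurable]: "v \<in> borel_measurable M" using assms by (simp add: sq_int_def)
  have "integrable M (\<lambda>x. 1 + (norm (v x))\<^sup>2)" using assms by (simp add: sq_int_def)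
  then show ?thesis
  proof (rule Bochner_Integration.integrable_bound)
    have "a \<le> 1 + a\<^sup>2" for a :: real
      using zero_le_power2[of "a - 1/2"] by (simp add: power2_eq_square algebra_simps)
    then show "AE x in M. norm (v x) \<le> norm (1 + (norm (v x))\<^sup>2)" by (intro always_eventually) (simp add: add_nonneg_nonneg)
  qed measurable
qed

text \<open>The product is any real-bilinear map because three pairings occur later:
  \<open>cinner\<close>, \<open>\<lambda>a b. a * cnj b\<close> and the scaling of vectors by real
  functions. The first two are only conjugate linear in the second argument.\<close>

lemma integrable_bilinear_sq_int:
  assumes B: "bounded_bilinear B" and v: "sq_int M v" and w: "sq_int M w"
  shows "integrable M (\<lambda>x. B (v x) (w x) :: 'c::{banach, second_countable_topology})"
proof -
  have [measurable]: "v \<in> borel_measurable M" "w \<in> borel_measurable M"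
    using assms by (auto simp: sq_int_def)
  have [measurable]: "(\<lambda>x. B (v x) (w x)) \<in> borel_measurable M"
    by (rule borel_measurable_continuous_Pair)
       (auto intro!: bounded_bilinear.continuous_on[OF B] continuous_intros)
  obtain K where K: "0 \<le> K" "\<And>a b. norm (B a b) \<le> norm a * norm b * K"
    using bounded_bilinear.nonneg_bounded[OF B] by blast
  have "integrable M (\<lambda>x. K * ((norm (v x))\<^sup>2 + (norm (w x))\<^sup>2))"
    using v w by (intro integrable_mult_right Bochner_Integration.integrable_add) (simp_all add: sq_int_def)
  then show ?thesis
  proof (rule Bochner_Integration.integrable_bound)
    have "a * b \<le> a\<^sup>2 + b\<^sup>2" for a b :: real
    proof -
      have "2 * (a * b) \<le> a\<^sup>2 + b\<^sup>2"
        using zero_le_power2[of "a - b"] by (simp add: power2_eq_square algebra_simps)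
      moreover have "0 \<le> a\<^sup>2 + b\<^sup>2" by simp
      ultimately show ?thesis by linarith
    qed
    then have "norm (B (v x) (w x)) \<le> ((norm (v x))\<^sup>2 + (norm (w x))\<^sup>2) * K" for x
      using K(2)[of "v x" "w x"] K(1) by (meson mult_right_mono order_trans)
    then show "AE x in M. norm (B (v x) (w x)) \<le> norm (K * ((norm (v x))\<^sup>2 + (norm (w x))\<^sup>2))"
      using K(1) by (simp add: mult.commute)
  qed measurable
qed

text \<open>The first argument of the kernel is the variable of integration and the second is that
  of the result, as in \<open>kernel_op\<close>. Exchanging them gives the adjoint operator, and a
  common bound \<open>q\<close> for rows and columns makes the locale stable under this
  exchange.\<close>

locale schur_kernel = sigma_finite_measure M for M :: "'a measure" +
  fixes k :: "'a \<Rightarrow> 'a \<Rightarrow> real" and q :: real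
  assumes kernel_measurable [measurable]: "case_prod k \<in> borel_measurable (M \<Otimes>\<^sub>M M)"
    and kernel_nonneg: "\<And>x y. 0 \<le> k x y"
    and bound_nonneg: "0 \<le> q"
    and row_bound: "\<And>x. x \<in> space M \<Longrightarrow> (\<integral>\<^sup>+y. ennreal (k x y) \<partial>M) \<le> ennreal q"
    and col_bound: "\<And>y. y \<in> space M \<Longrightarrow> (\<integral>\<^sup>+x. ennreal (k x y) \<partial>M) \<le> ennreal q"
begin

lemma transpose: "schur_kernel M (\<lambda>x y. k y x) q"
proof unfold_locales
  show "(\<lambda>(x, y). k y x) \<in> borel_measurable (M \<Otimes>\<^sub>M M)" by measurable
qed (auto intro: kernel_nonneg bound_nonneg row_bound col_bound)

lemma kernel_measurable1: "x \<in> space M \<Longrightarrow> (\<lambda>y. k x y) \<in> borel_measurable M"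
  using measurable_Pair2[OF kernel_measurable] by simp

lemma kernel_measurable2: "y \<in> space M \<Longrightarrow> (\<lambda>x. k x y) \<in> borel_measurable M"
  using measurable_Pair1[OF kernel_measurable] by simp

text \<open>The Schur test. With the kernel written as a product of two square roots, Cauchy-Schwarz
  splits off a factor that \<open>col_bound\<close> controls; Tonelli then leaves an inner integral
  that \<open>row_bound\<close> controls. Each contributes one factor \<open>q\<close>.\<close>

lemma schur_nn_integral:
  assumes g[measurable]: "g \<in> borel_measurable M"
  shows "(\<integral>\<^sup>+y. (\<integral>\<^sup>+x. ennreal (k x y) * g x \<partial>M)\<^sup>2 \<partial>M) \<le> (ennreal q)\<^sup>2 * (\<integral>\<^sup>+x. (g x)\<^sup>2 \<partial>M)"
proof -
  interpret pair_sigma_finite M M ..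
  note kernel_measurable2[measurable]
  have sq: "ennreal (sqrt (k x y)) * ennreal (sqrt (k x y)) = ennreal (k x y)" for x y
    using kernel_nonneg[of x y] by (simp flip: ennreal_mult')
  have "(\<integral>\<^sup>+y. (\<integral>\<^sup>+x. ennreal (k x y) * g x \<partial>M)\<^sup>2 \<partial>M) \<le>
        (\<integral>\<^sup>+y. ennreal q * (\<integral>\<^sup>+x. ennreal (k x y) * (g x)\<^sup>2 \<partial>M) \<partial>M)"
  proof (intro nn_integral_mono)
    fix y assume y: "y \<in> space M"
    have "(\<integral>\<^sup>+x. ennreal (k x y) * g x \<partial>M) = (\<integral>\<^sup>+x. ennreal (sqrt (k x y)) * (ennreal (sqrt (k x y)) * g x) \<partial>M)"
      by (simp add: sq flip: mult.assoc)
    also have "\<dots>\<^sup>2 \<le> (\<integral>\<^sup>+x. (ennreal (sqrt (k x y)))\<^sup>2 \<partial>M) * (\<integral>\<^sup>+x. (ennreal (sqrt (k x y)) * g x)\<^sup>2 \<partial>M)"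
      using y by (intro Cauchy_Schwarz_nn_integral) measurable
    also have "\<dots> = (\<integral>\<^sup>+x. ennreal (k x y) \<partial>M) * (\<integral>\<^sup>+x. ennreal (k x y) * (g x)\<^sup>2 \<partial>M)"
      by (simp add: power_mult_distrib, simp add: power2_eq_square sq)
    also have "\<dots> \<le> ennreal q * (\<integral>\<^sup>+x. ennreal (k x y) * (g x)\<^sup>2 \<partial>M)"
      by (intro mult_right_mono col_bound y) simp
    finally show "(\<integral>\<^sup>+x. ennreal (k x y) * g x \<partial>M)\<^sup>2 \<le> ennreal q * (\<integral>\<^sup>+x. ennreal (k x y) * (g x)\<^sup>2 \<partial>M)" .
  qed
  also have "\<dots> = ennreal q * (\<integral>\<^sup>+y. (\<integral>\<^sup>+x. ennreal (k x y) * (g x)\<^sup>2 \<partial>M) \<partial>M)"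
    by (intro nn_integral_cmult) measurable
  also have "(\<integral>\<^sup>+y. (\<integral>\<^sup>+x. ennreal (k x y) * (g x)\<^sup>2 \<partial>M) \<partial>M) = (\<integral>\<^sup>+x. (\<integral>\<^sup>+y. ennreal (k x y) * (g x)\<^sup>2 \<partial>M) \<partial>M)"
    by (rule Fubini'[symmetric]) measurable
  also have "\<dots> = (\<integral>\<^sup>+x. (\<integral>\<^sup>+y. ennreal (k x y) \<partial>M) * (g x)\<^sup>2 \<partial>M)"
    by (intro nn_integral_cong nn_integral_multc) (use kernel_measurable1 in measurable)
  also have "\<dots> \<le> (\<integral>\<^sup>+x. ennreal q * (g x)\<^sup>2 \<partial>M)"
    by (intro nn_integral_mono mult_right_mono row_bound) simp_all
  also have "\<dots> = ennreal q * (\<integral>\<^sup>+x. (g x)\<^sup>2 \<partial>M)"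
    by (intro nn_integral_cmult) measurable
  finally show ?thesis by (simp add: power2_eq_square mult.assoc mult_left_mono)
qed

lemma kernel_op_measurable [measurable]:
  assumes [measurable]: "v \<in> borel_measurable M"
  shows "kernel_op M k v \<in> borel_measurable M"
  unfolding kernel_op_def by measurable

lemma AE_finite:
  assumes [measurable]: "g \<in> borel_measurable M" and "(\<integral>\<^sup>+x. (g x)\<^sup>2 \<partial>M) < \<infinity>"
  shows "AE y in M. (\<integral>\<^sup>+x. ennreal (k x y) * g x \<partial>M) < \<infinity>"
proof -
  have "(\<integral>\<^sup>+y. (\<integral>\<^sup>+x. ennreal (k x y) * g x \<partial>M)\<^sup>2 \<partial>M) < \<infinity>"
    using schur_nn_integral[OF assms(1)] assms(2)
    by (auto simp: ennreal_mult_less_top power2_eq_square intro: le_less_trans)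
  then have "AE y in M. (\<integral>\<^sup>+x. ennreal (k x y) * g x \<partial>M)\<^sup>2 \<noteq> \<infinity>"
    by (intro nn_integral_PInf_AE) auto
  then show ?thesis
    by eventually_elim (auto simp: power2_eq_square less_top ennreal_mult_eq_top_iff)
qed

lemma AE_integrable:
  assumes "sq_int M v"
  shows "AE y in M. integrable M (\<lambda>x. k x y *\<^sub>R v x)"
proof -
  note kernel_measurable2[measurable]
  have [measurable]: "v \<in> borel_measurable M" using assms by (simp add: sq_int_def)
  have "AE y in M. (\<integral>\<^sup>+x. ennreal (k x y) * ennreal (norm (v x)) \<partial>M) < \<infinity>"
    using assms by (intro AE_finite) (auto simp: sq_int_iff sq_norm_def)
  with AE_space show ?thesis
  proof eventually_elim
    case (elim y)
    then show ?case
      by (auto simp: integrable_iff_bounded ennreal_mult kernel_nonneg)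
  qed
qed

text \<open>This holds at every \<open>y\<close>: where the integral diverges, the left side is the
  norm of the default value 0.\<close>

lemma norm_kernel_op_le:
  "ennreal (norm (kernel_op M k v y)) \<le> (\<integral>\<^sup>+x. ennreal (k x y) * ennreal (norm (v x)) \<partial>M)"
proof (cases "integrable M (\<lambda>x. k x y *\<^sub>R v x)")
  case True
  then show ?thesis
    using integral_norm_bound_ennreal[OF True] by (simp add: kernel_op_def ennreal_mult kernel_nonneg)
qed (simp add: kernel_op_def not_integrable_integral_eq)

lemma sq_norm_kernel_op:
  assumes [measurable]: "v \<in> borel_measurable M"
  shows "sq_norm M (kernel_op M k v) \<le> (ennreal q)\<^sup>2 * sq_norm M v"
proof -
  have "sq_norm M (kernel_op M k v) \<le> (\<integral>\<^sup>+y. (\<integral>\<^sup>+x. ennreal (k x y) * ennreal (norm (v x)) \<partial>M)\<^sup>2 \<partial>M)"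
    unfolding sq_norm_def by (intro nn_integral_mono power_mono norm_kernel_op_le) simp
  also have "\<dots> \<le> (ennreal q)\<^sup>2 * sq_norm M v"
    unfolding sq_norm_def by (rule schur_nn_integral) measurable
  finally show ?thesis .
qed

lemma sq_int_kernel_op: "sq_int M v \<Longrightarrow> sq_int M (kernel_op M k v)"
  using sq_norm_kernel_op[of v] unfolding sq_int_iff
  by (auto simp: ennreal_mult_less_top power2_eq_square intro: le_less_trans)

text \<open>Only almost everywhere: at a point where the integral of \<open>v\<close> diverges and
  defaults to 0, that of \<open>h\<close> after \<open>v\<close> may still converge to something
  else.\<close>

lemma kernel_op_bounded_linear:
  assumes h: "bounded_linear h" and v: "sq_int M v"
  shows "AE y in M. kernel_op M k (\<lambda>x. h (v x)) y = h (kernel_op M k v y)"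
  using AE_integrable[OF v]
proof eventually_elim
  case (elim y)
  then show ?case
    using integral_bounded_linear[OF h elim] bounded_linear.linear[OF h]
    by (simp add: kernel_op_def linear_scale)
qed

lemma kernel_op_cong_AE:
  assumes "AE x in M. v x = w x" "v \<in> borel_measurable M" "w \<in> borel_measurable M" "y \<in> space M"
  shows "kernel_op M k v y = kernel_op M k w y"
  unfolding kernel_op_def using assms kernel_measurable2[OF assms(4)]
  by (intro integral_cong_AE) auto

lemma kernel_op_add:
  assumes "sq_int M v" "sq_int M w"
  shows "AE y in M. kernel_op M k (\<lambda>x. v x + w x) y = kernel_op M k v y + kernel_op M k w y"
  using AE_integrable[OF assms(1)] AE_integrable[OF assms(2)]
  by eventually_elim (simp add: kernel_op_def scaleR_right_distrib)

text \<open>The Fubini hypothesis for moving an operator across a pairing. The Schur test puts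
  \<open>P\<close>, the kernel applied to the norm of \<open>v\<close>, into L^2, and Cauchy-Schwarz
  pairs it with the norm of \<open>w\<close>.\<close>

lemma integrable_kernel_pair:
  assumes v: "sq_int M v" and w: "sq_int M w" and B: "bounded_bilinear B"
  shows "integrable (M \<Otimes>\<^sub>M M) (\<lambda>(x, y). k x y *\<^sub>R (B (v x) (w y) :: 'c::{banach, second_countable_topology}))"
proof -
  interpret pair_sigma_finite M M ..
  note kernel_measurable2[measurable]
  have [measurable]: "v \<in> borel_measurable M" "w \<in> borel_measurable M"
    using v w by (auto simp: sq_int_def)
  have [measurable]: "(\<lambda>p. B (v (fst p)) (w (snd p))) \<in> borel_measurable (M \<Otimes>\<^sub>M M)"
    by (rule borel_measurable_continuous_Pair)
       (auto intro!: bounded_bilinear.continuous_on[OF B] continuous_intros)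
  obtain K where K: "0 \<le> K" "\<And>a b. norm (B a b) \<le> norm a * norm b * K"
    using bounded_bilinear.nonneg_bounded[OF B] by blast
  define P where "P y = (\<integral>\<^sup>+x. ennreal (k x y) * ennreal (norm (v x)) \<partial>M)" for y
  have [measurable]: "P \<in> borel_measurable M" unfolding P_def by measurable
  have "(\<integral>\<^sup>+p. norm (k (fst p) (snd p) *\<^sub>R B (v (fst p)) (w (snd p))) \<partial>(M \<Otimes>\<^sub>M M))
      \<le> (\<integral>\<^sup>+p. ennreal K * (ennreal (k (fst p) (snd p)) * ennreal (norm (v (fst p))) * ennreal (norm (w (snd p)))) \<partial>(M \<Otimes>\<^sub>M M))"
    using K by (intro nn_integral_mono)
      (auto simp: kernel_nonneg ennreal_mult[symmetric] mult.assoc mult_left_mono intro!: ennreal_leI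
         intro: order_trans[OF mult_left_mono[OF K(2)]] simp: mult_ac)
  also have "\<dots> = (\<integral>\<^sup>+y. \<integral>\<^sup>+x. ennreal K * (ennreal (k x y) * ennreal (norm (v x)) * ennreal (norm (w y))) \<partial>M \<partial>M)"
    by (subst nn_integral_snd[symmetric]) (auto simp: split_beta')
  also have "\<dots> = ennreal K * (\<integral>\<^sup>+y. P y * ennreal (norm (w y)) \<partial>M)"
  proof -
    have "(\<integral>\<^sup>+x. ennreal K * (ennreal (k x y) * ennreal (norm (v x)) * ennreal (norm (w y))) \<partial>M)
        = ennreal K * (P y * ennreal (norm (w y)))" if "y \<in> space M" for y
      using that unfolding P_def by (simp add: nn_integral_cmult nn_integral_multc)
    then show ?thesis
      by (simp add: nn_integral_cmult cong: nn_integral_cong)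
  qed
  also have "\<dots> < \<infinity>"
  proof -
    have "(\<integral>\<^sup>+y. P y * ennreal (norm (w y)) \<partial>M)\<^sup>2 \<le> (\<integral>\<^sup>+y. (P y)\<^sup>2 \<partial>M) * sq_norm M w"
      unfolding sq_norm_def by (intro Cauchy_Schwarz_nn_integral) measurable
    also have "(\<integral>\<^sup>+y. (P y)\<^sup>2 \<partial>M) \<le> (ennreal q)\<^sup>2 * sq_norm M v"
      unfolding P_def sq_norm_def by (intro schur_nn_integral) measurable
    finally have "(\<integral>\<^sup>+y. P y * ennreal (norm (w y)) \<partial>M)\<^sup>2 \<le> (ennreal q)\<^sup>2 * sq_norm M v * sq_norm M w"
      by (simp add: mult_right_mono)
    also have "\<dots> < \<infinity>" using v w by (simp add: sq_int_iff ennreal_mult_less_top power2_eq_square)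
    finally show ?thesis by (auto simp: power2_eq_square ennreal_mult_less_top less_top ennreal_mult_eq_top_iff)
  qed
  finally show ?thesis
    by (auto simp: integrable_iff_bounded split_beta')
qed

lemma kernel_op_adjoint:
  assumes v: "sq_int M v" and w: "sq_int M w" and B: "bounded_bilinear B"
  shows "(LINT y|M. (B (kernel_op M k v y) (w y) :: 'c::{banach, second_countable_topology}))
       = (LINT x|M. B (v x) (kernel_op M (\<lambda>x y. k y x) w x))"
proof -
  interpret pair_sigma_finite M M ..
  interpret tr: schur_kernel M "\<lambda>x y. k y x" q by (rule transpose)
  note int = integrable_kernel_pair[OF v w B]
  have [measurable]: "(\<lambda>(x, y). k x y *\<^sub>R B (v x) (w y)) \<in> borel_measurable (M \<Otimes>\<^sub>M M)"
    using int by (rule borel_measurable_integrable)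
  have [measurable]: "(\<lambda>(y, x). k x y *\<^sub>R B (v x) (w y)) \<in> borel_measurable (M \<Otimes>\<^sub>M M)"
    using borel_measurable_integrable[OF integrable_product_swap[OF int]] by simp
  have [measurable]: "v \<in> borel_measurable M" "w \<in> borel_measurable M"
    using v w by (auto simp: sq_int_def)
  have [measurable]: "(\<lambda>y. B (kernel_op M k v y) (w y)) \<in> borel_measurable M"
      "(\<lambda>x. B (v x) (kernel_op M (\<lambda>x y. k y x) w x)) \<in> borel_measurable M"
    by (rule borel_measurable_continuous_Pair;
       auto intro!: bounded_bilinear.continuous_on[OF B] continuous_intros)+
  have "(LINT y|M. B (kernel_op M k v y) (w y)) = (LINT y|M. (LINT x|M. k x y *\<^sub>R B (v x) (w y)))"
  proof (intro integral_cong_AE)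
    show "AE y in M. B (kernel_op M k v y) (w y) = (LINT x|M. k x y *\<^sub>R B (v x) (w y))"
      using AE_integrable[OF v]
    proof eventually_elim
      case (elim y)
      show ?case
        using integral_bounded_linear[OF bounded_bilinear.bounded_linear_left[OF B] elim, of "w y"]
        by (simp add: kernel_op_def bounded_bilinear.scaleR_left[OF B])
    qed
    show "(\<lambda>y. LINT x|M. k x y *\<^sub>R B (v x) (w y)) \<in> borel_measurable M" by measurable
  qed measurable
  also have "\<dots> = (LINT x|M. (LINT y|M. k x y *\<^sub>R B (v x) (w y)))"
    using Fubini_integral[OF int] .
  also have "\<dots> = (LINT x|M. B (v x) (kernel_op M (\<lambda>x y. k y x) w x))"
  proof (intro integral_cong_AE)
    show "AE x in M. (LINT y|M. k x y *\<^sub>R B (v x) (w y)) = B (v x) (kernel_op M (\<lambda>x y. k y x) w x)"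
      using tr.AE_integrable[OF w]
    proof eventually_elim
      case (elim x)
      show ?case
        using integral_bounded_linear[OF bounded_bilinear.bounded_linear_right[OF B] elim, of "v x"]
        by (simp add: kernel_op_def bounded_bilinear.scaleR_right[OF B])
    qed
    show "(\<lambda>x. LINT y|M. k x y *\<^sub>R B (v x) (w y)) \<in> borel_measurable M" by measurable
  qed measurable
  finally show ?thesis .
qed

end

text \<open>Fubini at every \<open>z\<close> for which the iterated integral of absolute values is
  finite. Two Schur estimates, one for the norm of \<open>v\<close> and one for the resulting
  \<open>P\<close>, show that almost every \<open>z\<close> is of this kind.\<close>

lemma kernel_op_comp:
  assumes k1: "schur_kernel M k1 q1" and k2: "schur_kernel M k2 q2"
    and k3: "\<And>x z. x \<in> space M \<Longrightarrow> z \<in> space M \<Longrightarrow>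
        (\<integral>\<^sup>+y. ennreal (k1 x y) * ennreal (k2 y z) \<partial>M) = ennreal (k3 x z)"
    and nonneg: "\<And>x z. 0 \<le> k3 x z"
    and v: "sq_int M v"
  shows "AE z in M. kernel_op M k2 (kernel_op M k1 v) z = kernel_op M k3 v z"
proof -
  interpret k1: schur_kernel M k1 q1 by fact
  interpret k2: schur_kernel M k2 q2 by fact
  interpret pair_sigma_finite M M ..
  note k1.kernel_measurable2[measurable] k2.kernel_measurable2[measurable]
    k1.kernel_measurable1[measurable] k2.kernel_measurable1[measurable]
  have [measurable]: "v \<in> borel_measurable M"
    using v by (auto simp: sq_int_def)
  define P where "P y = (\<integral>\<^sup>+x. ennreal (k1 x y) * ennreal (norm (v x)) \<partial>M)" for y
  have [measurable]: "P \<in> borel_measurable M" unfolding P_def by measurable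
  have P2: "(\<integral>\<^sup>+y. (P y)\<^sup>2 \<partial>M) < \<infinity>"
  proof -
    have "(\<integral>\<^sup>+y. (P y)\<^sup>2 \<partial>M) \<le> (ennreal q1)\<^sup>2 * sq_norm M v"
      unfolding P_def sq_norm_def by (intro k1.schur_nn_integral) measurable
    also have "\<dots> < \<infinity>" using v by (simp add: sq_int_iff ennreal_mult_less_top power2_eq_square)
    finally show ?thesis .
  qed
  have "AE z in M. (\<integral>\<^sup>+y. ennreal (k2 y z) * P y \<partial>M) < \<infinity>"
    by (intro k2.AE_finite P2) measurable
  with AE_space show ?thesis
  proof (eventually_elim, goal_cases)
    case (1 z)
    have int: "integrable (M \<Otimes>\<^sub>M M) (\<lambda>(x, y). (k1 x y * k2 y z) *\<^sub>R v x)"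
    proof -
      have "(\<integral>\<^sup>+p. norm ((k1 (fst p) (snd p) * k2 (snd p) z) *\<^sub>R v (fst p)) \<partial>(M \<Otimes>\<^sub>M M))
        = (\<integral>\<^sup>+y. \<integral>\<^sup>+x. ennreal (k2 y z) * (ennreal (k1 x y) * ennreal (norm (v x))) \<partial>M \<partial>M)"
        using \<open>z \<in> space M\<close>
        by (subst nn_integral_snd[symmetric])
           (auto simp: split_beta' k1.kernel_nonneg k2.kernel_nonneg ennreal_mult mult_ac abs_mult)
      also have "\<dots> = (\<integral>\<^sup>+y. ennreal (k2 y z) * P y \<partial>M)"
        unfolding P_def by (intro nn_integral_cong nn_integral_cmult) measurable
      also have "\<dots> < \<infinity>" by fact
      finally show ?thesis using \<open>z \<in> space M\<close>
        by (auto simp: integrable_iff_bounded split_beta')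
    qed
    have "kernel_op M k2 (kernel_op M k1 v) z = (LINT y|M. LINT x|M. (k1 x y * k2 y z) *\<^sub>R v x)"
      unfolding kernel_op_def
      by (intro Bochner_Integration.integral_cong refl, subst integral_scaleR_right[symmetric])
         (simp add: mult.commute)
    also have "\<dots> = (LINT x|M. LINT y|M. (k1 x y * k2 y z) *\<^sub>R v x)"
      using Fubini_integral[OF int] .
    also have "\<dots> = (LINT x|M. k3 x z *\<^sub>R v x)"
    proof (intro Bochner_Integration.integral_cong refl)
      fix x assume x: "x \<in> space M"
      have "has_bochner_integral M (\<lambda>y. k1 x y * k2 y z) (k3 x z)"
        using x \<open>z \<in> space M\<close>
        by (intro has_bochner_integral_nn_integral)
           (auto simp: k1.kernel_nonneg k2.kernel_nonneg ennreal_mult k3 nonneg)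
      then show "(LINT y|M. (k1 x y * k2 y z) *\<^sub>R v x) = k3 x z *\<^sub>R v x"
        using has_bochner_integral_iff by (metis integral_scaleR_left)
    qed
    finally show ?case by (simp add: kernel_op_def)
  qed
qed

subsection \<open>The Riemann--Liouville kernel\<close>

text \<open>Extension by 0 to s >= t makes J^b an operator over the fixed interval (0,T) instead of
  (0,t). Its adjoint, which integrates over (t,T), then results from exchanging the
  arguments.\<close>

definition rl_kernel :: "real \<Rightarrow> real \<Rightarrow> real \<Rightarrow> real" where
  "rl_kernel b s t = (if s < t then (t - s) powr (b - 1) / Gamma b else 0)"

lemma rl_kernel_nonneg: "0 < b \<Longrightarrow> 0 \<le> rl_kernel b s t"
  by (simp add: rl_kernel_def Gamma_real_pos less_imp_le)

lemma rl_kernel_measurable_borel [measurable]: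
  assumes [measurable]: "f \<in> borel_measurable N" "g \<in> borel_measurable N"
  shows "(\<lambda>x. rl_kernel b (f x) (g x)) \<in> borel_measurable N"
  unfolding rl_kernel_def by measurable

lemma borel_measurable_id_lebesgue_on [measurable]: "(\<lambda>x::real. x) \<in> borel_measurable (lebesgue_on S)"
  by (intro measurable_restrict_space1 measurable_completion) simp

lemma rl_kernel_measurable_pair:
  "case_prod (rl_kernel b) \<in> borel_measurable (lebesgue_on S \<Otimes>\<^sub>M lebesgue_on S')"
proof -
  have [measurable]: "fst \<in> borel_measurable (lebesgue_on S \<Otimes>\<^sub>M lebesgue_on S')"
      "snd \<in> borel_measurable (lebesgue_on S \<Otimes>\<^sub>M lebesgue_on S')"
    using measurable_compose[OF measurable_fst borel_measurable_id_lebesgue_on]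
      measurable_compose[OF measurable_snd borel_measurable_id_lebesgue_on] by simp_all
  show ?thesis unfolding split_beta' by measurable
qed

lemma nn_integral_lebesgue_on:
  fixes S :: "real set"
  assumes "S \<in> sets lebesgue"
  shows "(\<integral>\<^sup>+x. f x \<partial>lebesgue_on S) = (\<integral>\<^sup>+x. f x * indicator S x \<partial>lborel)"
  using assms by (subst nn_integral_restrict_space) (simp_all add: nn_integral_completion)

lemma nn_integral_powr_interval:
  assumes "0 < b" "0 \<le> c"
  shows "(\<integral>\<^sup>+x. ennreal (x powr (b - 1)) * indicator {0..c} x \<partial>lborel) = ennreal (c powr b / b)"
  using has_integral_powr_from_0[of "b - 1" c] assms
  by (subst nn_integral_has_integral_lebesgue') auto

lemma rl_kernel_minus: "rl_kernel b (- t) (- s) = rl_kernel b s t"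
  by (auto simp: rl_kernel_def)

text \<open>A translation (for rows) or a reflection (for columns) bounds both integrals by that of
  y^(b-1) / Gamma b over (0,T), which is the stated constant.\<close>

lemma schur_rl_kernel:
  assumes b: "0 < b" and T: "0 < T"
  shows "schur_kernel (lebesgue_on {0<..<T}) (rl_kernel b) (T powr b / b / Gamma b)"
proof -
  let ?M = "lebesgue_on {0<..<T}"
  have G: "0 < Gamma b" using b by (rule Gamma_real_pos)
  have base: "(\<integral>\<^sup>+y. ennreal (rl_kernel b 0 y) * indicator {0<..<T} y \<partial>lborel) \<le> ennreal (T powr b / b / Gamma b)"
  proof -
    have "(\<integral>\<^sup>+y. ennreal (rl_kernel b 0 y) * indicator {0<..<T} y \<partial>lborel)
        \<le> (\<integral>\<^sup>+y. ennreal (1 / Gamma b) * (ennreal (y powr (b - 1)) * indicator {0..T} y) \<partial>lborel)"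
      using G by (intro nn_integral_mono) (auto simp: rl_kernel_def split: split_indicator simp flip: ennreal_mult')
    also have "\<dots> = ennreal (1 / Gamma b) * ennreal (T powr b / b)"
      using b T by (subst nn_integral_cmult) (auto simp: nn_integral_powr_interval)
    finally show ?thesis using G b by (simp add: mult.commute flip: ennreal_mult')
  qed
  show ?thesis
  proof (intro schur_kernel.intro schur_kernel_axioms.intro)
    show "sigma_finite_measure ?M"
      by (intro finite_measure.axioms finite_measure_lebesgue_on) auto
    show "case_prod (rl_kernel b) \<in> borel_measurable (?M \<Otimes>\<^sub>M ?M)" by (rule rl_kernel_measurable_pair)
    show "0 \<le> T powr b / b / Gamma b" using b G by simp
  next
    fix s assume s: "s \<in> space ?M"
    have "(\<integral>\<^sup>+t. ennreal (rl_kernel b s t) \<partial>?M) = (\<integral>\<^sup>+t. ennreal (rl_kernel b s t) * indicator {0<..<T} t \<partial>lborel)"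
      by (rule nn_integral_lebesgue_on) simp
    also have "\<dots> = (\<integral>\<^sup>+y. ennreal (rl_kernel b s (s + y)) * indicator {0<..<T} (s + y) \<partial>lborel)"
      using nn_integral_real_affine[of "\<lambda>t. ennreal (rl_kernel b s t) * indicator {0<..<T} t" 1 s] by simp
    also have "\<dots> \<le> (\<integral>\<^sup>+y. ennreal (rl_kernel b 0 y) * indicator {0<..<T} y \<partial>lborel)"
      using s by (intro nn_integral_mono) (auto simp: rl_kernel_def split: split_indicator)
    finally show "(\<integral>\<^sup>+t. ennreal (rl_kernel b s t) \<partial>?M) \<le> ennreal (T powr b / b / Gamma b)"
      using base by order
  next
    fix t assume t: "t \<in> space ?M"
    have "(\<integral>\<^sup>+s. ennreal (rl_kernel b s t) \<partial>?M) = (\<integral>\<^sup>+s. ennreal (rl_kernel b s t) * indicator {0<..<T} s \<partial>lborel)"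
      by (rule nn_integral_lebesgue_on) simp
    also have "\<dots> = (\<integral>\<^sup>+y. ennreal (rl_kernel b (t - y) t) * indicator {0<..<T} (t - y) \<partial>lborel)"
      using nn_integral_real_affine[of "\<lambda>s. ennreal (rl_kernel b s t) * indicator {0<..<T} s" "-1" t] by simp
    also have "\<dots> \<le> (\<integral>\<^sup>+y. ennreal (rl_kernel b 0 y) * indicator {0<..<T} y \<partial>lborel)"
      using t by (intro nn_integral_mono) (auto simp: rl_kernel_def split: split_indicator)
    finally show "(\<integral>\<^sup>+s. ennreal (rl_kernel b s t) \<partial>?M) \<le> ennreal (T powr b / b / Gamma b)"
      using base by order
  qed (use b rl_kernel_nonneg in auto)
qed

text \<open>The semigroup law of the fractional integrals, on the level of kernels. The substitution
  x = s + h y with h = t - s leaves the Beta integral, and Beta a b cancels the two Gamma factors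
  against Gamma (a + b).\<close>

lemma rl_kernel_comp:
  assumes a: "0 < a" and b: "0 < b" and s: "s \<in> {0<..<T}" and t: "t \<in> {0<..<T}"
  shows "(\<integral>\<^sup>+x. ennreal (rl_kernel a s x) * ennreal (rl_kernel b x t) \<partial>lebesgue_on {0<..<T}) = ennreal (rl_kernel (a + b) s t)"
proof (cases "s < t")
  case False
  then have "ennreal (rl_kernel a s x) * ennreal (rl_kernel b x t) = 0" for x
    by (auto simp: rl_kernel_def)
  then show ?thesis using False by (simp only: nn_integral_const) (simp add: rl_kernel_def)
next
  case True
  define h where "h = t - s"
  have h: "0 < h" using True by (simp add: h_def)
  note G = Gamma_real_pos[OF a] Gamma_real_pos[OF b]
  have Beta: "Beta a b = Gamma a * Gamma b / Gamma (a + b)" by (simp add: Beta_def)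
  have pt: "ennreal (rl_kernel a s (s + h * y)) * ennreal (rl_kernel b (s + h * y) t) * indicator {0<..<T} (s + h * y)
      = ennreal (h powr (a + b - 2) / (Gamma a * Gamma b)) * (ennreal (y powr (a - 1) * (1 - y) powr (b - 1)) * indicator {0..1} y)" for y
  proof (cases "0 < y \<and> y < 1")
    case y: True
    have "h * y < h" using y h by simp
    then have 1: "s + h * y < t" by (simp add: h_def)
    have "0 < h * y" using y h by simp
    then have 2: "s < s + h * y" "s + h * y \<in> {0<..<T}" using 1 s t by auto
    have 3: "t - (s + h * y) = h * (1 - y)" by (simp add: h_def algebra_simps)
    have 4: "h powr (a - 1) * h powr (b - 1) = h powr (a + b - 2)"
      using powr_add[of h "a - 1" "b - 1"] by (simp add: algebra_simps)
    have "rl_kernel a s (s + h * y) * rl_kernel b (s + h * y) t =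
        (h powr (a - 1) * h powr (b - 1)) / (Gamma a * Gamma b) * (y powr (a - 1) * (1 - y) powr (b - 1))"
      using 1 2 3 h y by (simp add: rl_kernel_def powr_mult)
    then have "rl_kernel a s (s + h * y) * rl_kernel b (s + h * y) t =
        h powr (a + b - 2) / (Gamma a * Gamma b) * (y powr (a - 1) * (1 - y) powr (b - 1))"
      by (simp only: 4)
    then show ?thesis using y 2 G by (simp add: rl_kernel_nonneg a b flip: ennreal_mult')
  next
    case y: False
    have "rl_kernel a s (s + h * y) = 0 \<or> rl_kernel b (s + h * y) t = 0"
    proof (cases "y \<le> 0")
      case True
      then have "h * y \<le> 0" using h by (simp add: mult_nonneg_nonpos)
      then show ?thesis by (simp add: rl_kernel_def)
    next
      case False
      then have "h * 1 \<le> h * y" using y h by (intro mult_left_mono) auto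
      then show ?thesis by (simp add: rl_kernel_def h_def)
    qed
    \<comment> \<open>At the end points 0 and 1 this rests on \<open>0 powr x = 0\<close>, in
      accordance with the strict inequality in \<open>rl_kernel\<close>.\<close>
    moreover have "y powr (a - 1) * (1 - y) powr (b - 1) * indicator {0..1} y = 0"
    proof -
      have "y < 0 \<or> y = 0 \<or> y = 1 \<or> 1 < y" using y by linarith
      then show ?thesis by (elim disjE) simp_all
    qed
    then have "ennreal (y powr (a - 1) * (1 - y) powr (b - 1)) * indicator {0..1} y = 0"
      by (auto split: split_indicator)
    ultimately show ?thesis by (elim disjE) simp_all
  qed
  have "(\<integral>\<^sup>+x. ennreal (rl_kernel a s x) * ennreal (rl_kernel b x t) \<partial>lebesgue_on {0<..<T})
      = (\<integral>\<^sup>+x. ennreal (rl_kernel a s x) * ennreal (rl_kernel b x t) * indicator {0<..<T} x \<partial>lborel)"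
    by (rule nn_integral_lebesgue_on) simp
  also have "\<dots> = ennreal h * (\<integral>\<^sup>+y. ennreal (rl_kernel a s (s + h * y)) * ennreal (rl_kernel b (s + h * y) t) * indicator {0<..<T} (s + h * y) \<partial>lborel)"
    using h nn_integral_real_affine[of "\<lambda>x. ennreal (rl_kernel a s x) * ennreal (rl_kernel b x t) * indicator {0<..<T} x" h s] by simp
  also have "\<dots> = ennreal h * (ennreal (h powr (a + b - 2) / (Gamma a * Gamma b)) * ennreal (Beta a b))"
    unfolding pt using has_integral_Beta_real[OF a b]
    by (subst nn_integral_cmult) (auto simp: nn_integral_has_integral_lebesgue')
  also have "\<dots> = ennreal (rl_kernel (a + b) s t)"
  proof -
    have "h powr (1 + (a + b - 2)) = h * h powr (a + b - 2)"
      using h by (subst powr_add) simp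
    then have *: "h * h powr (a + b - 2) = h powr (a + b - 1)" by (simp add: algebra_simps)
    have "h * (h powr (a + b - 2) / (Gamma a * Gamma b) * Beta a b) = h * h powr (a + b - 2) / Gamma (a + b)"
      using G by (simp add: Beta)
    also have "\<dots> = rl_kernel (a + b) s t" using True * by (simp add: rl_kernel_def h_def)
    finally show ?thesis using h G by (simp add: Beta Gamma_real_nonneg flip: ennreal_mult')
  qed
  finally show ?thesis .
qed

text \<open>The substitution y = x / m reduces this to the Gamma integral. The value will be the
  Schur bound of an exponentially weighted kernel; what matters is that it tends to 0 as
  \<open>m\<close> grows.\<close>

lemma rl_kernel_laplace:
  assumes b: "0 < b" and m: "0 < m"
  shows "(\<integral>\<^sup>+y. ennreal (exp (- m * y) * rl_kernel b 0 y) \<partial>lborel) = ennreal (m powr (- b))"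
proof -
  have G: "0 < Gamma b" using b by (rule Gamma_real_pos)
  have pt: "ennreal (exp (- m * (0 + (1/m) * x)) * rl_kernel b 0 (0 + (1/m) * x)) = ennreal (m powr (1 - b) / Gamma b) * (ennreal (x powr (b - 1) / exp x) * indicator {0..} x)" for x
  proof (cases "0 < x")
    case True
    have "m powr (1 - b) = 1 / m powr (b - 1)"
      using powr_minus_divide[of m "b - 1"] by simp
    then have "(x / m) powr (b - 1) = x powr (b - 1) * m powr (1 - b)"
      using True m by (simp add: powr_divide)
    then have "exp (- m * (0 + (1/m) * x)) * rl_kernel b 0 (0 + (1/m) * x) = m powr (1 - b) / Gamma b * (x powr (b - 1) / exp x)"
      using True m by (simp add: rl_kernel_def exp_minus divide_inverse mult_ac)
    then show ?thesis using True m G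
      by (simp flip: ennreal_mult')
  next
    case False
    then have "0 + (1/m) * x \<le> 0" using m by (simp add: divide_nonpos_pos)
    moreover have "x powr (b - 1) / exp x * indicator {0..} x = 0"
      using False by (auto split: split_indicator simp: not_less)
    then have "ennreal (x powr (b - 1) / exp x) * indicator {0..} x = 0"
      by (auto split: split_indicator)
    ultimately show ?thesis by (simp add: rl_kernel_def)
  qed
  have "(\<integral>\<^sup>+y. ennreal (exp (- m * y) * rl_kernel b 0 y) \<partial>lborel)
      = ennreal (1 / m) * (\<integral>\<^sup>+x. ennreal (exp (- m * (0 + (1/m) * x)) * rl_kernel b 0 (0 + (1/m) * x)) \<partial>lborel)"
    using m by (subst nn_integral_real_affine[where c = "1 / m" and t = 0]) auto
  also have "\<dots> = ennreal (1 / m) * (ennreal (m powr (1 - b) / Gamma b) * ennreal (Gamma b))"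
    unfolding pt using Gamma_integral_real[OF b]
    by (subst nn_integral_cmult) (auto simp: nn_integral_has_integral_lebesgue')
  also have "\<dots> = ennreal (m powr (1 - b) / m)"
    using m G by (simp flip: ennreal_mult')
  also have "m powr (1 - b) / m = m powr (- b)" using m by (simp add: powr_diff powr_minus divide_inverse)
  finally show ?thesis .
qed

text \<open>Used with a = \<alpha>/2, so this is where \<alpha> < 1 yields the sector. Below 1 the
  integrand is at most y^(a-1), above 1 it is at most y^(2a-2), and the latter is integrable at
  infinity because 2a < 1.\<close>

lemma rl_gram_integral_finite:
  fixes a :: real
  assumes a: "0 < a" "a < 1/2"
  shows "(\<integral>\<^sup>+y. ennreal (y powr (a - 1) * (1 + y) powr (a - 1)) * indicator {0<..} y \<partial>lborel) < \<infinity>"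
proof -
  have "(\<integral>\<^sup>+y. ennreal (y powr (a - 1) * (1 + y) powr (a - 1)) * indicator {0<..} y \<partial>lborel)
      \<le> (\<integral>\<^sup>+y. ennreal (y powr (a - 1)) * indicator {0..1} y + ennreal (y powr (2 * a - 2)) * indicator {1..} y \<partial>lborel)"
  proof (intro nn_integral_mono)
    fix y :: real
    show "ennreal (y powr (a - 1) * (1 + y) powr (a - 1)) * indicator {0<..} y
      \<le> ennreal (y powr (a - 1)) * indicator {0..1} y + ennreal (y powr (2 * a - 2)) * indicator {1..} y"
    proof (cases "0 < y")
      case y: True
      have "(1 + y) powr (a - 1) \<le> 1 powr (a - 1)" "(1 + y) powr (a - 1) \<le> y powr (a - 1)"
        using y a by (intro powr_mono2'; simp)+
      then have "y powr (a - 1) * (1 + y) powr (a - 1) \<le> y powr (a - 1) * 1"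
          "y powr (a - 1) * (1 + y) powr (a - 1) \<le> y powr (a - 1) * y powr (a - 1)"
        by (intro mult_left_mono; simp)+
      moreover have "y powr (a - 1) * y powr (a - 1) = y powr (2 * a - 2)"
        by (simp flip: powr_add add: algebra_simps)
      ultimately have 1: "y powr (a - 1) * (1 + y) powr (a - 1) \<le> y powr (a - 1)"
        and 2: "y powr (a - 1) * (1 + y) powr (a - 1) \<le> y powr (2 * a - 2)" by simp_all
      show ?thesis
      proof (cases "y \<le> 1")
        case True
        have "ennreal (y powr (a - 1) * (1 + y) powr (a - 1)) \<le> ennreal (y powr (a - 1))"
          by (rule ennreal_leI) (rule 1)
        then show ?thesis using True y by (simp add: add_increasing2)
      next
        case False
        then show ?thesis using y 2 by (auto intro: ennreal_leI)
      qed
    qed simp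
  qed
  also have "\<dots> = ennreal (1 powr a / a) + ennreal (- (1 powr (2 * a - 2 + 1)) / (2 * a - 2 + 1))"
    using a has_integral_powr_to_inf[of "2 * a - 2" 1]
    by (subst nn_integral_add)
       (auto simp: nn_integral_powr_interval nn_integral_has_integral_lebesgue')
  also have "\<dots> < \<infinity>" by simp
  finally show ?thesis .
qed

text \<open>Over the whole line the left side depends only on the distance of \<open>s\<close> and
  \<open>t\<close> and is homogeneous of degree 2a-1, so it must be a multiple of the symmetrised
  kernel of order 2a. On the diagonal the integral diverges.\<close>

lemma rl_kernel_gram:
  assumes a: "0 < a" "a < 1/2"
  obtains c where "0 \<le> c" "\<And>s t. s \<noteq> t \<Longrightarrow> (\<integral>\<^sup>+x. ennreal (rl_kernel a x s * rl_kernel a x t) \<partial>lborel)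
      = ennreal (c * (rl_kernel (2 * a) s t + rl_kernel (2 * a) t s))"
proof -
  define I where "I = (\<integral>\<^sup>+y. ennreal (y powr (a - 1) * (1 + y) powr (a - 1)) * indicator {0<..} y \<partial>lborel)"
  have I: "I = ennreal (enn2real I)"
    using rl_gram_integral_finite[OF a] by (simp add: I_def)
  \<comment> \<open>For h = t - s > 0 the Gram integral is h^(2a-1) I / (Gamma a)^2, while
    \<open>rl_kernel (2 * a) s t\<close> is h^(2a-1) / Gamma (2a); \<open>c\<close> is their
    quotient.\<close>
  define c where "c = enn2real I * Gamma (2 * a) / (Gamma a)\<^sup>2"
  have G: "0 < Gamma a" "0 < Gamma (2 * a)" using a by (auto intro: Gamma_real_pos)
  have c: "0 \<le> c" using G by (simp add: c_def)
  have main: "(\<integral>\<^sup>+x. ennreal (rl_kernel a x s * rl_kernel a x t) \<partial>lborel) = ennreal (c * rl_kernel (2 * a) s t)"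
    if st: "s < t" for s t
  proof -
    define h where "h = t - s"
    have h: "0 < h" using st by (simp add: h_def)
    have pt: "ennreal (rl_kernel a (s + - h * y) s * rl_kernel a (s + - h * y) t)
      = ennreal (h powr (2 * a - 2) / (Gamma a)\<^sup>2) * (ennreal (y powr (a - 1) * (1 + y) powr (a - 1)) * indicator {0<..} y)" for y
    proof (cases "0 < y")
      case True
      then have hy: "0 < h * y" using h by simp
      then have "s - h * y < t" using st by linarith
      have 1: "t - (s + - h * y) = h * (1 + y)" by (simp add: h_def algebra_simps)
      have 2: "h powr (a - 1) * h powr (a - 1) = h powr (2 * a - 2)"
        by (simp flip: powr_add add: algebra_simps)
      have "rl_kernel a (s + - h * y) s * rl_kernel a (s + - h * y) t
         = (h powr (a - 1) * h powr (a - 1)) / (Gamma a)\<^sup>2 * (y powr (a - 1) * (1 + y) powr (a - 1))"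
        using hy st h True 1 \<open>s - h * y < t\<close> by (simp add: rl_kernel_def powr_mult power2_eq_square)
      then show ?thesis using True by (simp add: 2 flip: ennreal_mult')
    next
      case False
      then have "h * y \<le> 0" using h by (simp add: mult_nonneg_nonpos)
      then show ?thesis using False by (simp add: rl_kernel_def)
    qed
    have "(\<integral>\<^sup>+x. ennreal (rl_kernel a x s * rl_kernel a x t) \<partial>lborel)
        = ennreal h * (\<integral>\<^sup>+y. ennreal (rl_kernel a (s + - h * y) s * rl_kernel a (s + - h * y) t) \<partial>lborel)"
      using h by (subst nn_integral_real_affine[where c = "- h" and t = s]) auto
    also have "\<dots> = ennreal h * (ennreal (h powr (2 * a - 2) / (Gamma a)\<^sup>2) * ennreal (enn2real I))"
      unfolding pt by (subst nn_integral_cmult) (simp_all add: flip: I_def I)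
    also have "\<dots> = ennreal (h * (h powr (2 * a - 2) / (Gamma a)\<^sup>2 * enn2real I))"
      using h by (simp flip: ennreal_mult')
    also have "h * (h powr (2 * a - 2) / (Gamma a)\<^sup>2 * enn2real I) = c * rl_kernel (2 * a) s t"
    proof -
      have "h powr (1 + (2 * a - 2)) = h * h powr (2 * a - 2)"
        using h by (subst powr_add) simp
      then have "h * h powr (2 * a - 2) = h powr (2 * a - 1)" by (simp add: algebra_simps)
      then show ?thesis using st G by (simp add: rl_kernel_def h_def c_def field_simps)
    qed
    finally show ?thesis .
  qed
  have "(\<integral>\<^sup>+x. ennreal (rl_kernel a x s * rl_kernel a x t) \<partial>lborel)
      = ennreal (c * (rl_kernel (2 * a) s t + rl_kernel (2 * a) t s))" if "s \<noteq> t" for s t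
  proof (cases "s < t")
    case True
    then show ?thesis using main[OF True] by (simp add: rl_kernel_def)
  next
    case False
    then have ts: "t < s" using that by simp
    show ?thesis using main[OF ts] ts by (simp add: rl_kernel_def mult.commute)
  qed
  with c show thesis by (rule that)
qed

text \<open>Removes the diagonal, on which the Gram identity fails.\<close>

lemma AE_pair_lebesgue_on_neq:
  fixes S :: "real set"
  assumes S: "S \<in> sets lebesgue" and sf: "sigma_finite_measure (lebesgue_on S)"
  shows "AE p in lebesgue_on S \<Otimes>\<^sub>M lebesgue_on S. fst p \<noteq> snd p"
proof -
  let ?M = "lebesgue_on S"
  interpret sigma_finite_measure ?M by fact
  interpret pair_sigma_finite ?M ?M ..
  have [measurable]: "fst \<in> borel_measurable (?M \<Otimes>\<^sub>M ?M)" "snd \<in> borel_measurable (?M \<Otimes>\<^sub>M ?M)"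
    using measurable_compose[OF measurable_fst borel_measurable_id_lebesgue_on]
      measurable_compose[OF measurable_snd borel_measurable_id_lebesgue_on] by simp_all
  have "AE y in ?M. x \<noteq> y" for x
  proof -
    have "AE y in lebesgue. y \<noteq> x" using AE_completion[OF AE_lborel_singleton[of x]] .
    then have "AE y in lebesgue. y \<in> S \<longrightarrow> x \<noteq> y" by eventually_elim auto
    then show ?thesis using S by (simp add: AE_restrict_space_iff)
  qed
  then have "AE x in ?M. AE y in ?M. fst (x, y) \<noteq> snd (x, y)" by simp
  then show ?thesis by (intro AE_pair_measure) auto
qed

lemma bounded_bilinear_mult_cnj: "bounded_bilinear (\<lambda>a b. a * cnj b)"
  using bounded_bilinear.comp[OF bounded_bilinear_mult bounded_linear_ident bounded_linear_cnj] .

text \<open>For a kernel \<open>\<kappa>\<close> with Gram kernel \<open>c * l\<close>, the operator \<open>l\<close> is \<open>\<kappa>\<^sup>*\<kappa>\<close> up to the factor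
  \<open>c\<close>; this is stated with \<open>\<kappa>\<close> on the whole line because the Gram kernel of the Riemann--Liouville
  kernel is homogeneous only there.\<close>

lemma gram_kernel:
  fixes v :: "real \<Rightarrow> complex"
  assumes l: "schur_kernel (lebesgue_on S) l q" and S: "S \<in> sets lebesgue"
    and kap[measurable]: "(\<lambda>p. kap (fst p) (snd p)) \<in> borel_measurable (lborel \<Otimes>\<^sub>M lebesgue_on S)"
    and kap_nonneg: "\<And>x s. 0 \<le> kap x s"
    and c: "0 \<le> c"
    and gram: "\<And>s t. s \<noteq> t \<Longrightarrow> (\<integral>\<^sup>+x. ennreal (kap x s * kap x t) \<partial>lborel) = ennreal (c * l s t)"
    and v: "sq_int (lebesgue_on S) v"
  shows "integrable lborel (\<lambda>x. (cmod (LINT s|lebesgue_on S. kap x s *\<^sub>R v s))\<^sup>2)"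
    and "complex_of_real (LINT x|lborel. (cmod (LINT s|lebesgue_on S. kap x s *\<^sub>R v s))\<^sup>2)
      = c * (LINT t|lebesgue_on S. kernel_op (lebesgue_on S) l v t * cnj (v t))"
proof -
  let ?M = "lebesgue_on S"
  interpret l: schur_kernel ?M l q by fact
  interpret M2: pair_sigma_finite ?M ?M ..
  interpret X: pair_sigma_finite lborel "?M \<Otimes>\<^sub>M ?M" ..
  have [measurable]: "v \<in> borel_measurable ?M" using v by (simp add: sq_int_def)
  have cnj_m[measurable]: "cnj \<in> borel_measurable borel"
    by (intro borel_measurable_continuous_onI continuous_intros)
  have kap2: "(\<lambda>z. kap (fst z) (fst (snd z))) \<in> borel_measurable (lborel \<Otimes>\<^sub>M (?M \<Otimes>\<^sub>M ?M))"
      "(\<lambda>z. kap (fst z) (snd (snd z))) \<in> borel_measurable (lborel \<Otimes>\<^sub>M (?M \<Otimes>\<^sub>M ?M))"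
  proof -
    have "(\<lambda>z. (fst z, fst (snd z))) \<in> lborel \<Otimes>\<^sub>M (?M \<Otimes>\<^sub>M ?M) \<rightarrow>\<^sub>M lborel \<Otimes>\<^sub>M ?M"
         "(\<lambda>z. (fst z, snd (snd z))) \<in> lborel \<Otimes>\<^sub>M (?M \<Otimes>\<^sub>M ?M) \<rightarrow>\<^sub>M lborel \<Otimes>\<^sub>M ?M"
      by measurable
    from this[THEN measurable_compose, OF kap]
    show "(\<lambda>z. kap (fst z) (fst (snd z))) \<in> borel_measurable (lborel \<Otimes>\<^sub>M (?M \<Otimes>\<^sub>M ?M))"
      "(\<lambda>z. kap (fst z) (snd (snd z))) \<in> borel_measurable (lborel \<Otimes>\<^sub>M (?M \<Otimes>\<^sub>M ?M))" by simp_all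
  qed
  have kap1: "(\<lambda>x. kap x s) \<in> borel_measurable lborel" if "s \<in> space ?M" for s
    using measurable_compose[OF measurable_Pair2'[OF that] kap] by simp
  have kap_prod: "AE p in ?M \<Otimes>\<^sub>M ?M. (\<lambda>x. kap x (fst p) * kap x (snd p)) \<in> borel_measurable lborel"
    by (intro AE_I2 borel_measurable_times kap1) (auto simp: space_pair_measure)
  \<comment> \<open>The integrand in three variables. Integrated over \<open>p\<close> first it
    gives the squared modulus of the integral of \<open>kap x s *\<^sub>R v s\<close> over
    \<open>s\<close>; integrated over \<open>x\<close> first it gives \<open>c\<close> times the
    quadratic form of \<open>l\<close>. Fubini equates the two.\<close>
  define F where "F x p = (kap x (fst p) * kap x (snd p)) *\<^sub>R (v (fst p) * cnj (v (snd p)))" for x p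
  have F_meas[measurable]: "case_prod F \<in> borel_measurable (lborel \<Otimes>\<^sub>M (?M \<Otimes>\<^sub>M ?M))"
    unfolding F_def split_beta'
    by (intro borel_measurable_scaleR borel_measurable_times kap2) measurable
  have bnd: "integrable (?M \<Otimes>\<^sub>M ?M) (\<lambda>(s, t). l s t *\<^sub>R (v s * cnj (v t)))"
    by (rule l.integrable_kernel_pair[OF v v bounded_bilinear_mult_cnj])
  have F_int: "integrable (lborel \<Otimes>\<^sub>M (?M \<Otimes>\<^sub>M ?M)) (case_prod F)"
  proof -
    have "(\<integral>\<^sup>+z. norm (case_prod F z) \<partial>(lborel \<Otimes>\<^sub>M (?M \<Otimes>\<^sub>M ?M)))
        = (\<integral>\<^sup>+p. \<integral>\<^sup>+x. norm (F x p) \<partial>lborel \<partial>(?M \<Otimes>\<^sub>M ?M))"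
      by (subst X.nn_integral_snd[symmetric]) simp_all
    also have "\<dots> = (\<integral>\<^sup>+p. ennreal c * ennreal (norm (case p of (s, t) \<Rightarrow> l s t *\<^sub>R (v s * cnj (v t)))) \<partial>(?M \<Otimes>\<^sub>M ?M))"
    proof (intro nn_integral_cong_AE)
      from kap_prod AE_pair_lebesgue_on_neq[OF S l.sigma_finite_measure_axioms]
      show "AE p in ?M \<Otimes>\<^sub>M ?M. (\<integral>\<^sup>+x. norm (F x p) \<partial>lborel)
        = ennreal c * ennreal (norm (case p of (s, t) \<Rightarrow> l s t *\<^sub>R (v s * cnj (v t))))"
      proof eventually_elim
        case (elim p)
        have "(\<integral>\<^sup>+x. norm (F x p) \<partial>lborel) = (\<integral>\<^sup>+x. ennreal (kap x (fst p) * kap x (snd p)) * ennreal (norm (v (fst p) * cnj (v (snd p)))) \<partial>lborel)"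
          by (intro nn_integral_cong) (simp add: F_def kap_nonneg abs_mult norm_mult flip: ennreal_mult')
        also have "\<dots> = ennreal (c * l (fst p) (snd p)) * ennreal (norm (v (fst p) * cnj (v (snd p))))"
          using elim by (subst nn_integral_multc) (auto simp: gram)
        finally show ?case
          using c by (simp add: split_beta' l.kernel_nonneg norm_mult mult.assoc flip: ennreal_mult')
      qed
    qed
    also have "\<dots> = ennreal c * (\<integral>\<^sup>+p. ennreal (norm (case p of (s, t) \<Rightarrow> l s t *\<^sub>R (v s * cnj (v t)))) \<partial>(?M \<Otimes>\<^sub>M ?M))"
      using borel_measurable_integrable[OF bnd] by (intro nn_integral_cmult) measurable
    also have "\<dots> < \<infinity>"
      using bnd by (auto simp: integrable_iff_bounded ennreal_mult_less_top)
    finally show ?thesis by (simp add: integrable_iff_bounded)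
  qed
  have inner: "AE x in lborel. (LINT p|(?M \<Otimes>\<^sub>M ?M). F x p) = complex_of_real ((cmod (LINT s|?M. kap x s *\<^sub>R v s))\<^sup>2)"
    using X.AE_integrable_fst[OF F_int]
  proof eventually_elim
    case (elim x)
    have "(LINT p|(?M \<Otimes>\<^sub>M ?M). F x p) = (LINT s|?M. LINT t|?M. F x (s, t))"
      using M2.integral_fst'[OF elim] by simp
    also have "\<dots> = (LINT s|?M. LINT t|?M. (kap x s *\<^sub>R v s) * cnj (kap x t *\<^sub>R v t))"
      by (simp add: F_def mult_ac scaleR_conv_of_real)
    also have "\<dots> = (LINT s|?M. kap x s *\<^sub>R v s) * cnj (LINT t|?M. kap x t *\<^sub>R v t)"
      by (simp only: integral_mult_right_zero integral_mult_left_zero Bochner_Integration.integral_cnj)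
    finally show ?case by (simp only: complex_norm_square)
  qed
  have intX: "integrable lborel (\<lambda>x. LINT p|(?M \<Otimes>\<^sub>M ?M). F x p)"
    using X.integrable_fst'[OF F_int] by simp
  have m[measurable]: "(\<lambda>x. (cmod (LINT s|?M. kap x s *\<^sub>R v s))\<^sup>2) \<in> borel_measurable lborel"
  proof -
    have [measurable]: "(\<lambda>(x, s). kap x s *\<^sub>R v s) \<in> borel_measurable (lborel \<Otimes>\<^sub>M ?M)"
      unfolding split_beta' by measurable
    show ?thesis by measurable
  qed
  have "integrable lborel (\<lambda>x. complex_of_real ((cmod (LINT s|?M. kap x s *\<^sub>R v s))\<^sup>2))"
    by (rule integrable_cong_AE_imp[OF intX]) (use inner in \<open>auto elim: eventually_mono\<close>)
  then show "integrable lborel (\<lambda>x. (cmod (LINT s|?M. kap x s *\<^sub>R v s))\<^sup>2)"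
    unfolding complex_of_real_integrable_eq .
  have "complex_of_real (LINT x|lborel. (cmod (LINT s|?M. kap x s *\<^sub>R v s))\<^sup>2) = (LINT x|lborel. LINT p|(?M \<Otimes>\<^sub>M ?M). F x p)"
    unfolding integral_complex_of_real[symmetric]
    by (intro integral_cong_AE) (use inner intX in \<open>auto elim: eventually_mono\<close>)
  also have "\<dots> = (LINT p|(?M \<Otimes>\<^sub>M ?M). LINT x|lborel. F x p)"
    using X.Fubini_integral[OF F_int] by simp
  also have "\<dots> = (LINT p|(?M \<Otimes>\<^sub>M ?M). c * (case p of (s, t) \<Rightarrow> l s t *\<^sub>R (v s * cnj (v t))))"
  proof (intro integral_cong_AE)
    show "(\<lambda>p. LINT x|lborel. F x p) \<in> borel_measurable (?M \<Otimes>\<^sub>M ?M)"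
      using X.integrable_snd[OF F_int] by (simp add: borel_measurable_integrable)
    show "(\<lambda>p. c * (case p of (s, t) \<Rightarrow> l s t *\<^sub>R (v s * cnj (v t)))) \<in> borel_measurable (?M \<Otimes>\<^sub>M ?M)"
      using borel_measurable_integrable[OF bnd] by measurable
    from kap_prod AE_pair_lebesgue_on_neq[OF S l.sigma_finite_measure_axioms]
    show "AE p in ?M \<Otimes>\<^sub>M ?M. (LINT x|lborel. F x p) = c * (case p of (s, t) \<Rightarrow> l s t *\<^sub>R (v s * cnj (v t)))"
    proof eventually_elim
      case (elim p)
      have "has_bochner_integral lborel (\<lambda>x. kap x (fst p) * kap x (snd p)) (c * l (fst p) (snd p))"
        using elim c by (intro has_bochner_integral_nn_integral) (auto simp: gram kap_nonneg l.kernel_nonneg)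
      then have "has_bochner_integral lborel (\<lambda>x. F x p) ((c * l (fst p) (snd p)) *\<^sub>R (v (fst p) * cnj (v (snd p))))"
        unfolding F_def by (rule has_bochner_integral_scaleR_left)
      then show ?case
        by (simp add: has_bochner_integral_integral_eq split_beta' scaleR_conv_of_real)
    qed
  qed
  also have "\<dots> = c * (LINT p|(?M \<Otimes>\<^sub>M ?M). (case p of (s, t) \<Rightarrow> l s t *\<^sub>R (v s * cnj (v t))))"
    by (rule integral_mult_right_zero)
  also have "(LINT p|(?M \<Otimes>\<^sub>M ?M). (case p of (s, t) \<Rightarrow> l s t *\<^sub>R (v s * cnj (v t)))) = (LINT t|?M. LINT s|?M. l s t *\<^sub>R (v s * cnj (v t)))"
    using M2.integral_snd[OF bnd] by simp
  also have "\<dots> = (LINT t|?M. kernel_op ?M l v t * cnj (v t))"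
    unfolding kernel_op_def by (simp flip: integral_mult_left_zero)
  finally show "complex_of_real (LINT x|lborel. (cmod (LINT s|?M. kap x s *\<^sub>R v s))\<^sup>2)
      = c * (LINT t|?M. kernel_op ?M l v t * cnj (v t))" .
qed

section \<open>The sector estimate for J^\<alpha> and the a priori bound\<close>

lemma schur_kernel_add:
  assumes "schur_kernel M k p" "schur_kernel M l q"
  shows "schur_kernel M (\<lambda>x y. k x y + l x y) (p + q)"
proof -
  interpret k: schur_kernel M k p by fact
  interpret l: schur_kernel M l q by fact
  note k.kernel_measurable1[measurable] l.kernel_measurable1[measurable]
    k.kernel_measurable2[measurable] l.kernel_measurable2[measurable]
  show ?thesis
  proof unfold_locales
    show "(\<lambda>(x, y). k x y + l x y) \<in> borel_measurable (M \<Otimes>\<^sub>M M)" by measurable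
  qed (auto simp: k.kernel_nonneg l.kernel_nonneg k.bound_nonneg l.bound_nonneg nn_integral_add add_mono
      k.row_bound l.row_bound k.col_bound l.col_bound)
qed

lemma integral_lebesgue_on_le_lborel:
  fixes g :: "real \<Rightarrow> real"
  assumes g: "integrable lborel g" and nonneg: "\<And>x. 0 \<le> g x" and S: "S \<in> sets lebesgue"
  shows "(LINT x|lebesgue_on S. g x) \<le> (LINT x|lborel. g x)"
proof -
  have i: "integrable lebesgue g" using g by (simp add: integrable_completion)
  have "(LINT x|lebesgue_on S. g x) = (LINT x|lebesgue. indicator S x *\<^sub>R g x)"
    using S by (subst integral_restrict_space) (simp_all add: set_lebesgue_integral_def)
  also have "\<dots> \<le> (LINT x|lebesgue. g x)"
    using S by (intro integral_mono integrable_mult_indicator i) (auto simp: nonneg split: split_indicator)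
  also have "\<dots> = (LINT x|lborel. g x)" using g by (intro integral_completion) auto
  finally show ?thesis .
qed

text \<open>The numerical range of \<open>J\<^sup>\<alpha>\<close> lies in a sector: \<open>\<langle>J\<^sup>\<alpha>v, v\<rangle> = \<langle>J\<^bsup>\<alpha>/2\<^esup>v, (J\<^bsup>\<alpha>/2\<^esup>)\<^sup>*v\<rangle>\<close>, and the squared
  norms of both factors over the whole line are constant multiples of \<open>Re \<langle>J\<^sup>\<alpha>v, v\<rangle>\<close>.\<close>

lemma rl_sectorial:
  fixes \<alpha> T :: real
  assumes \<alpha>: "0 < \<alpha>" "\<alpha> < 1" and T: "0 < T"
  obtains C where "0 \<le> C"
    "\<And>v. sq_int (lebesgue_on {0<..<T}) v \<Longrightarrow>
      cmod (LINT t|lebesgue_on {0<..<T}. kernel_op (lebesgue_on {0<..<T}) (rl_kernel \<alpha>) v t * cnj (v t))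
      \<le> C * Re (LINT t|lebesgue_on {0<..<T}. kernel_op (lebesgue_on {0<..<T}) (rl_kernel \<alpha>) v t * cnj (v t))"
proof -
  define M where "M = lebesgue_on {0<..<T}"
  define a where "a = \<alpha> / 2"
  have a: "0 < a" "a < 1/2" and a2: "2 * a = \<alpha>" "a + a = \<alpha>" using \<alpha> by (simp_all add: a_def)
  obtain c where c: "0 \<le> c" and gram: "\<And>s t. s \<noteq> t \<Longrightarrow> (\<integral>\<^sup>+x. ennreal (rl_kernel a x s * rl_kernel a x t) \<partial>lborel)
      = ennreal (c * (rl_kernel \<alpha> s t + rl_kernel \<alpha> t s))"
    using rl_kernel_gram[OF a] unfolding a2 by blast
  \<comment> \<open>The Gram identity for the transposed kernel: replacing x by -x reverses the
    order of the arguments and hence exchanges their roles.\<close>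
  have gram': "(\<integral>\<^sup>+x. ennreal (rl_kernel a s x * rl_kernel a t x) \<partial>lborel)
      = ennreal (c * (rl_kernel \<alpha> s t + rl_kernel \<alpha> t s))" if "s \<noteq> t" for s t
  proof -
    have "(\<integral>\<^sup>+x. ennreal (rl_kernel a s x * rl_kernel a t x) \<partial>lborel)
        = (\<integral>\<^sup>+x. ennreal (rl_kernel a x (- s) * rl_kernel a x (- t)) \<partial>lborel)"
    proof -
      have "rl_kernel a s (0 + - 1 * x) = rl_kernel a x (- s)" for x s
        using rl_kernel_minus[of a "- x" s] by simp
      then show ?thesis
        using nn_integral_real_affine[of "\<lambda>x. ennreal (rl_kernel a s x * rl_kernel a t x)" "- 1" 0] by simp
    qed
    also have "\<dots> = ennreal (c * (rl_kernel \<alpha> (- s) (- t) + rl_kernel \<alpha> (- t) (- s)))"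
      using that by (intro gram) simp
    finally show ?thesis by (simp add: rl_kernel_minus add.commute)
  qed
  interpret k: schur_kernel M "rl_kernel \<alpha>" "T powr \<alpha> / \<alpha> / Gamma \<alpha>"
    unfolding M_def by (rule schur_rl_kernel) fact+
  interpret kt: schur_kernel M "\<lambda>s t. rl_kernel \<alpha> t s" "T powr \<alpha> / \<alpha> / Gamma \<alpha>"
    by (rule k.transpose)
  interpret ka: schur_kernel M "rl_kernel a" "T powr a / a / Gamma a"
    unfolding M_def by (rule schur_rl_kernel) fact+
  interpret kat: schur_kernel M "\<lambda>s t. rl_kernel a t s" "T powr a / a / Gamma a"
    by (rule ka.transpose)
  let ?J = "\<lambda>v t. kernel_op M (rl_kernel \<alpha>) v t"
  let ?z = "\<lambda>v. LINT t|M. ?J v t * cnj (v t)"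
  have S: "{0<..<T} \<in> sets lebesgue" by simp
  \<comment> \<open>With \<open>?P\<close> for J^a v and \<open>?Q\<close> for the adjoint of J^a
    applied to \<open>v\<close>, each squared norm is at most 2 c Re z, and the modulus of z is at
    most half of their sum.\<close>
  have "cmod (?z v) \<le> (2 * c) * Re (?z v)" if v: "sq_int M v" for v :: "real \<Rightarrow> complex"
  proof -
    let ?l = "\<lambda>s t. rl_kernel \<alpha> s t + rl_kernel \<alpha> t s"
    have [measurable]: "v \<in> borel_measurable M" using v by (simp add: sq_int_def)
    have cnj_m[measurable]: "cnj \<in> borel_measurable borel"
      by (intro borel_measurable_continuous_onI continuous_intros)
    have l: "schur_kernel (lebesgue_on {0<..<T}) ?l (T powr \<alpha> / \<alpha> / Gamma \<alpha> + T powr \<alpha> / \<alpha> / Gamma \<alpha>)"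
      using schur_kernel_add[OF k.schur_kernel_axioms kt.schur_kernel_axioms] unfolding M_def .
    have snd_m: "snd \<in> borel_measurable (lborel \<Otimes>\<^sub>M lebesgue_on {0<..<T})"
      using measurable_compose[OF measurable_snd borel_measurable_id_lebesgue_on] by simp
    have fst_m: "fst \<in> borel_measurable (lborel \<Otimes>\<^sub>M lebesgue_on {0<..<T})"
      using measurable_fst[of lborel "lebesgue_on {0<..<T}"] by (simp add: measurable_def)
    have kap_m: "(\<lambda>p. rl_kernel a (snd p) (fst p)) \<in> borel_measurable (lborel \<Otimes>\<^sub>M lebesgue_on {0<..<T})"
        "(\<lambda>p. rl_kernel a (fst p) (snd p)) \<in> borel_measurable (lborel \<Otimes>\<^sub>M lebesgue_on {0<..<T})"
      by (intro rl_kernel_measurable_borel fst_m snd_m)+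
    have v': "sq_int (lebesgue_on {0<..<T}) v" using v by (simp add: M_def)
    \<comment> \<open>By adjointness the transposed half of the symmetrised kernel contributes the
      complex conjugate of z.\<close>
    have zl: "(LINT t|M. kernel_op M ?l v t * cnj (v t)) = of_real (2 * Re (?z v))"
    proof -
      have "(LINT t|M. kernel_op M ?l v t * cnj (v t))
          = (LINT t|M. ?J v t * cnj (v t) + kernel_op M (\<lambda>s t. rl_kernel \<alpha> t s) v t * cnj (v t))"
      proof (intro integral_cong_AE)
        interpret l: schur_kernel M ?l "T powr \<alpha> / \<alpha> / Gamma \<alpha> + T powr \<alpha> / \<alpha> / Gamma \<alpha>"
          using l by (simp add: M_def)
        show "(\<lambda>t. kernel_op M ?l v t * cnj (v t)) \<in> borel_measurable M" by measurable
        show "AE t in M. kernel_op M ?l v t * cnj (v t)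
           = ?J v t * cnj (v t) + kernel_op M (\<lambda>s t. rl_kernel \<alpha> t s) v t * cnj (v t)"
          using k.AE_integrable[OF v] kt.AE_integrable[OF v]
          by eventually_elim (simp add: kernel_op_def scaleR_left_distrib distrib_right)
      qed measurable
      also have "\<dots> = ?z v + (LINT t|M. kernel_op M (\<lambda>s t. rl_kernel \<alpha> t s) v t * cnj (v t))"
        by (intro Bochner_Integration.integral_add integrable_bilinear_sq_int[OF bounded_bilinear_mult_cnj]
            k.sq_int_kernel_op kt.sq_int_kernel_op v)
      also have "?z v = (LINT t|M. v t * cnj (kernel_op M (\<lambda>s t. rl_kernel \<alpha> t s) v t))"
        by (rule k.kernel_op_adjoint[OF v v bounded_bilinear_mult_cnj])
      then have "(LINT t|M. kernel_op M (\<lambda>s t. rl_kernel \<alpha> t s) v t * cnj (v t)) = cnj (?z v)"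
        by (simp add: mult.commute flip: Bochner_Integration.integral_cnj)
      finally show ?thesis by (simp add: complex_add_cnj)
    qed
    have "integrable lborel (\<lambda>x. (cmod (LINT s|M. rl_kernel a s x *\<^sub>R v s))\<^sup>2)"
      and P: "complex_of_real (LINT x|lborel. (cmod (LINT s|M. rl_kernel a s x *\<^sub>R v s))\<^sup>2) = c * of_real (2 * Re (?z v))"
      using gram_kernel[where kap = "\<lambda>x s. rl_kernel a s x", OF l S _ _ c gram' v'] kap_m a
      unfolding M_def[symmetric] zl by (simp_all add: rl_kernel_nonneg)
    \<comment> \<open>The exact value belongs to the whole line; restricting to (0,T) can only
      decrease the integral.\<close>
    then have P': "(LINT x|M. (cmod (kernel_op M (rl_kernel a) v x))\<^sup>2) \<le> c * (2 * Re (?z v))"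
      using integral_lebesgue_on_le_lborel[of "\<lambda>x. (cmod (LINT s|M. rl_kernel a s x *\<^sub>R v s))\<^sup>2" "{0<..<T}"]
      unfolding kernel_op_def M_def[symmetric] by (simp flip: of_real_mult)
    have "integrable lborel (\<lambda>x. (cmod (LINT s|M. rl_kernel a x s *\<^sub>R v s))\<^sup>2)"
      and Q: "complex_of_real (LINT x|lborel. (cmod (LINT s|M. rl_kernel a x s *\<^sub>R v s))\<^sup>2) = c * of_real (2 * Re (?z v))"
      using gram_kernel[where kap = "\<lambda>x s. rl_kernel a x s", OF l S _ _ c gram v'] kap_m a
      unfolding M_def[symmetric] zl by (simp_all add: rl_kernel_nonneg)
    then have Q': "(LINT x|M. (cmod (kernel_op M (\<lambda>s t. rl_kernel a t s) v x))\<^sup>2) \<le> c * (2 * Re (?z v))"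
      using integral_lebesgue_on_le_lborel[of "\<lambda>x. (cmod (LINT s|M. rl_kernel a x s *\<^sub>R v s))\<^sup>2" "{0<..<T}"]
      unfolding kernel_op_def M_def[symmetric] by (simp flip: of_real_mult)
    let ?P = "kernel_op M (rl_kernel a) v" and ?Q = "kernel_op M (\<lambda>s t. rl_kernel a t s) v"
    have PQ: "sq_int M ?P" "sq_int M ?Q" by (auto intro: ka.sq_int_kernel_op kat.sq_int_kernel_op v)
    have "?z v = (LINT t|M. kernel_op M (rl_kernel a) ?P t * cnj (v t))"
    proof (intro integral_cong_AE)
      have "AE t in M. kernel_op M (rl_kernel a) ?P t = ?J v t"
        using \<alpha> a rl_kernel_comp[OF a(1) a(1), of _ T]
        by (intro kernel_op_comp[OF ka.schur_kernel_axioms ka.schur_kernel_axioms _ _ v])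
           (auto simp: M_def a2 rl_kernel_nonneg)
      then show "AE t in M. ?J v t * cnj (v t) = kernel_op M (rl_kernel a) ?P t * cnj (v t)"
        by eventually_elim simp
    qed measurable
    also have "\<dots> = (LINT t|M. ?P t * cnj (?Q t))"
      by (rule ka.kernel_op_adjoint[OF PQ(1) v bounded_bilinear_mult_cnj])
    finally have "cmod (?z v) \<le> (LINT t|M. cmod (?P t * cnj (?Q t)))"
      by (simp only: integral_norm_bound)
    also have "\<dots> \<le> (LINT t|M. ((cmod (?P t))\<^sup>2 + (cmod (?Q t))\<^sup>2) / 2)"
    proof (intro integral_mono)
      show "integrable M (\<lambda>t. cmod (?P t * cnj (?Q t)))"
        by (intro integrable_norm integrable_bilinear_sq_int[OF bounded_bilinear_mult_cnj] PQ)
      show "integrable M (\<lambda>t. ((cmod (?P t))\<^sup>2 + (cmod (?Q t))\<^sup>2) / 2)"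
        using PQ by (auto simp: sq_int_def)
      show "cmod (?P t * cnj (?Q t)) \<le> ((cmod (?P t))\<^sup>2 + (cmod (?Q t))\<^sup>2) / 2" for t
        using zero_le_power2[of "cmod (?P t) - cmod (?Q t)"]
        by (simp add: norm_mult power2_eq_square algebra_simps)
    qed
    also have "\<dots> = ((LINT t|M. (cmod (?P t))\<^sup>2) + (LINT t|M. (cmod (?Q t))\<^sup>2)) / 2"
      using PQ by (simp add: sq_int_def)
    also have "\<dots> \<le> (2 * c) * Re (?z v)" using P' Q' by simp
    finally show ?thesis .
  qed
  then show thesis using that[of "2 * c"] c unfolding M_def by simp
qed

text \<open>With N = \<parallel>v\<parallel>^2 and w the pairing of \<open>f\<close> with
  \<open>v\<close>, the tested equation w = N + \<i> r z has the parts N = Re w + r Im z and Im w =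
  r Re z. The sector bounds r Im z by C r Re z = C Im w, so N \<le> Re w + C Im w, from which
  \<open>r\<close> has disappeared. This gives a constant chosen before \<open>r\<close>.\<close>

lemma rl_apriori:
  fixes \<alpha> T :: real
  assumes \<alpha>: "0 < \<alpha>" "\<alpha> < 1" and T: "0 < T"
  shows "\<exists>K>0. \<forall>v f r. 0 \<le> r \<longrightarrow> sq_int (lebesgue_on {0<..<T}) v \<longrightarrow> sq_int (lebesgue_on {0<..<T}) f \<longrightarrow>
      (AE t in lebesgue_on {0<..<T}. v t + \<i> * of_real r * kernel_op (lebesgue_on {0<..<T}) (rl_kernel \<alpha>) v t = f t) \<longrightarrow>
      (LINT t|lebesgue_on {0<..<T}. (cmod (v t))\<^sup>2) \<le> K * (LINT t|lebesgue_on {0<..<T}. (cmod (f t))\<^sup>2)"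
proof -
  define M where "M = lebesgue_on {0<..<T}"
  obtain C where C: "0 \<le> C" and sect: "\<And>v. sq_int M v \<Longrightarrow>
      cmod (LINT t|M. kernel_op M (rl_kernel \<alpha>) v t * cnj (v t)) \<le> C * Re (LINT t|M. kernel_op M (rl_kernel \<alpha>) v t * cnj (v t))"
    using rl_sectorial[OF assms] unfolding M_def by blast
  interpret k: schur_kernel M "rl_kernel \<alpha>" "T powr \<alpha> / \<alpha> / Gamma \<alpha>"
    unfolding M_def by (rule schur_rl_kernel) fact+
  have "(LINT t|M. (cmod (v t))\<^sup>2) \<le> (1 + C)\<^sup>2 * (LINT t|M. (cmod (f t))\<^sup>2)"
    if r: "0 \<le> r" and v: "sq_int M v" and f: "sq_int M f"
      and eq: "AE t in M. v t + \<i> * of_real r * kernel_op M (rl_kernel \<alpha>) v t = f t" for v f r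
  proof -
    have [measurable]: "v \<in> borel_measurable M" "f \<in> borel_measurable M" using v f by (simp_all add: sq_int_def)
    have cnj_m[measurable]: "cnj \<in> borel_measurable borel"
      by (intro borel_measurable_continuous_onI continuous_intros)
    define z where "z = (LINT t|M. kernel_op M (rl_kernel \<alpha>) v t * cnj (v t))"
    define N where "N = (LINT t|M. (cmod (v t))\<^sup>2)"
    define w where "w = (LINT t|M. f t * cnj (v t))"
    have "w = (LINT t|M. complex_of_real ((cmod (v t))\<^sup>2) + \<i> * of_real r * (kernel_op M (rl_kernel \<alpha>) v t * cnj (v t)))"
      unfolding w_def
    proof (intro integral_cong_AE)
      show "AE t in M. f t * cnj (v t) = complex_of_real ((cmod (v t))\<^sup>2) + \<i> * of_real r * (kernel_op M (rl_kernel \<alpha>) v t * cnj (v t))"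
        using eq
      proof eventually_elim
        case (elim t)
        have "f t * cnj (v t) = v t * cnj (v t) + \<i> * of_real r * (kernel_op M (rl_kernel \<alpha>) v t * cnj (v t))"
          unfolding elim[symmetric] by (simp add: algebra_simps)
        then show ?case by (simp only: complex_norm_square)
      qed
    qed measurable
    also have "\<dots> = of_real N + \<i> * of_real r * z"
      unfolding N_def z_def integral_complex_of_real[symmetric]
    proof (subst Bochner_Integration.integral_add)
      show "integrable M (\<lambda>t. \<i> * of_real r * (kernel_op M (rl_kernel \<alpha>) v t * cnj (v t)))"
        by (intro integrable_mult_right integrable_bilinear_sq_int[OF bounded_bilinear_mult_cnj] k.sq_int_kernel_op v)
      show "integrable M (\<lambda>t. complex_of_real ((cmod (v t))\<^sup>2))"
        using v by (intro integrable_of_real) (simp add: sq_int_def)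
    qed (simp only: integral_mult_right_zero)
    finally have w: "w = of_real N + \<i> * of_real r * z" .
    have "N = Re w + r * Im z" "r * Re z = Im w" by (simp_all add: w)
    moreover have "r * Im z \<le> C * (r * Re z)"
    proof -
      have "Im z \<le> C * Re z" using sect[OF v] abs_Im_le_cmod[of z] unfolding z_def by linarith
      then have "r * Im z \<le> r * (C * Re z)" using r by (rule mult_left_mono)
      then show ?thesis by (simp add: mult.left_commute)
    qed
    ultimately have "N \<le> Re w + C * Im w" by simp
    also have "\<dots> \<le> cmod w + C * cmod w"
      using C abs_Re_le_cmod[of w] abs_Im_le_cmod[of w] by (intro add_mono mult_left_mono) auto
    also have "\<dots> = (1 + C) * cmod w" by (simp add: algebra_simps)
    \<comment> \<open>Young's inequality, weighted so that after the factor 1 + C exactly N / 2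
      remains to be absorbed on the left.\<close>
    also have "\<dots> \<le> (1 + C) * (LINT t|M. (1 + C) / 2 * (cmod (f t))\<^sup>2 + 1 / (2 * (1 + C)) * (cmod (v t))\<^sup>2)"
    proof (intro mult_left_mono)
      have "cmod w \<le> (LINT t|M. cmod (f t * cnj (v t)))"
        unfolding w_def by (rule integral_norm_bound)
      also have "\<dots> \<le> (LINT t|M. (1 + C) / 2 * (cmod (f t))\<^sup>2 + 1 / (2 * (1 + C)) * (cmod (v t))\<^sup>2)"
      proof (intro integral_mono)
        show "integrable M (\<lambda>t. cmod (f t * cnj (v t)))"
          by (intro integrable_norm integrable_bilinear_sq_int[OF bounded_bilinear_mult_cnj] v f)
        show "integrable M (\<lambda>t. (1 + C) / 2 * (cmod (f t))\<^sup>2 + 1 / (2 * (1 + C)) * (cmod (v t))\<^sup>2)"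
          using v f by (auto simp: sq_int_def)
        fix t
        have "0 \<le> (1 / (2 * (1 + C))) * ((1 + C) * cmod (f t) - cmod (v t))\<^sup>2" using C by simp
        also have "\<dots> = (1 + C) / 2 * (cmod (f t))\<^sup>2 + 1 / (2 * (1 + C)) * (cmod (v t))\<^sup>2 - cmod (f t) * cmod (v t)"
          using C by (simp add: field_simps power2_eq_square)
        finally show "cmod (f t * cnj (v t)) \<le> (1 + C) / 2 * (cmod (f t))\<^sup>2 + 1 / (2 * (1 + C)) * (cmod (v t))\<^sup>2"
          by (simp add: norm_mult)
      qed
      finally show "cmod w \<le> (LINT t|M. (1 + C) / 2 * (cmod (f t))\<^sup>2 + 1 / (2 * (1 + C)) * (cmod (v t))\<^sup>2)" .
    qed (use C in simp)
    also have "\<dots> = (1 + C)\<^sup>2 / 2 * (LINT t|M. (cmod (f t))\<^sup>2) + N / 2"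
    proof -
      have "(LINT t|M. (1 + C) / 2 * (cmod (f t))\<^sup>2 + 1 / (2 * (1 + C)) * (cmod (v t))\<^sup>2)
        = (1 + C) / 2 * (LINT t|M. (cmod (f t))\<^sup>2) + 1 / (2 * (1 + C)) * N"
        unfolding N_def using v f by (subst Bochner_Integration.integral_add) (auto simp: sq_int_def)
      then show ?thesis using C by (simp add: field_simps power2_eq_square)
    qed
    finally show ?thesis by (simp add: N_def)
  qed
  then have "\<forall>v f r. 0 \<le> r \<longrightarrow> sq_int M v \<longrightarrow> sq_int M f \<longrightarrow>
      (AE t in M. v t + \<i> * of_real r * kernel_op M (rl_kernel \<alpha>) v t = f t) \<longrightarrow>
      (LINT t|M. (cmod (v t))\<^sup>2) \<le> (1 + C)\<^sup>2 * (LINT t|M. (cmod (f t))\<^sup>2)" by blast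
  moreover have "0 < (1 + C)\<^sup>2" using C by simp
  ultimately show ?thesis unfolding M_def by blast
qed

subsection \<open>Volterra equations with the Riemann--Liouville kernel\<close>

lemma sums_integral_nn:
  fixes f :: "nat \<Rightarrow> 'a \<Rightarrow> 'b::{banach, second_countable_topology}"
  assumes [measurable]: "\<And>n. f n \<in> borel_measurable M"
    and fin: "(\<integral>\<^sup>+x. (\<Sum>n. ennreal (norm (f n x))) \<partial>M) < \<infinity>"
  shows "(\<lambda>n. LINT x|M. f n x) sums (LINT x|M. (\<Sum>n. f n x))"
proof -
  have eq: "(\<integral>\<^sup>+x. (\<Sum>n. ennreal (norm (f n x))) \<partial>M) = (\<Sum>n. \<integral>\<^sup>+x. ennreal (norm (f n x)) \<partial>M)"
    by (rule nn_integral_suminf) measurable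
  have int: "integrable M (f n)" for n
  proof -
    have "(\<integral>\<^sup>+x. ennreal (norm (f n x)) \<partial>M) < \<infinity>"
      using fin unfolding eq by (metis ennreal_suminf_lessD infinity_ennreal_def)
    then show ?thesis by (simp add: integrable_iff_bounded)
  qed
  show ?thesis
  proof (rule sums_integral)
    show "AE x in M. summable (\<lambda>n. norm (f n x))"
    proof -
      have "AE x in M. (\<Sum>n. ennreal (norm (f n x))) \<noteq> \<infinity>"
        using fin by (intro nn_integral_PInf_AE) auto
      then show ?thesis
        by eventually_elim (auto intro!: summable_suminf_not_top)
    qed
    have "(\<Sum>n. ennreal (LINT x|M. norm (f n x))) \<noteq> top"
      using fin int unfolding eq by (simp add: nn_integral_eq_integral)
    then show "summable (\<lambda>n. LINT x|M. norm (f n x))"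
      by (intro summable_suminf_not_top) auto
  qed (rule int)
qed

text \<open>The kernel of J^b conjugated by the weight exp (- m * t). Dropping the restriction to
  (0,T), every row and column integral is bounded by the Laplace transform at \<open>m\<close>, so a
  large \<open>m\<close> makes the operator small, however long the interval.\<close>

lemma schur_rl_kernel_weighted:
  assumes b: "0 < b" and T: "0 < T" and m: "0 < m"
  shows "schur_kernel (lebesgue_on {0<..<T}) (\<lambda>s t. exp (- m * (t - s)) * rl_kernel b s t) (m powr (- b))"
proof -
  let ?M = "lebesgue_on {0<..<T}" and ?k = "\<lambda>s t. exp (- m * (t - s)) * rl_kernel b s t"
  have [measurable]: "fst \<in> borel_measurable (?M \<Otimes>\<^sub>M ?M)" "snd \<in> borel_measurable (?M \<Otimes>\<^sub>M ?M)"
    using measurable_compose[OF measurable_fst borel_measurable_id_lebesgue_on]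
      measurable_compose[OF measurable_snd borel_measurable_id_lebesgue_on] by simp_all
  have shift: "rl_kernel b s (s + y) = rl_kernel b 0 y" "rl_kernel b (t - y) t = rl_kernel b 0 y" for s t y
    by (simp_all add: rl_kernel_def)
  have base: "(\<integral>\<^sup>+y. ennreal (?k 0 y) * indicator {0<..<T} (g y) \<partial>lborel) \<le> ennreal (m powr (- b))" for g :: "real \<Rightarrow> real"
    unfolding rl_kernel_laplace[OF b m, symmetric]
    by (intro nn_integral_mono) (auto split: split_indicator)
  show ?thesis
  proof (intro schur_kernel.intro schur_kernel_axioms.intro)
    show "sigma_finite_measure ?M"
      by (intro finite_measure.axioms finite_measure_lebesgue_on) auto
    show "case_prod ?k \<in> borel_measurable (?M \<Otimes>\<^sub>M ?M)"
      unfolding split_beta' by measurable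
  next
    fix s assume s: "s \<in> space ?M"
    have "(\<integral>\<^sup>+t. ennreal (?k s t) \<partial>?M) = (\<integral>\<^sup>+t. ennreal (?k s t) * indicator {0<..<T} t \<partial>lborel)"
      by (rule nn_integral_lebesgue_on) simp
    also have "\<dots> = (\<integral>\<^sup>+y. ennreal (?k s (s + y)) * indicator {0<..<T} (s + y) \<partial>lborel)"
      using nn_integral_real_affine[of "\<lambda>t. ennreal (?k s t) * indicator {0<..<T} t" 1 s] by simp
    also have "\<dots> = (\<integral>\<^sup>+y. ennreal (?k 0 y) * indicator {0<..<T} (s + y) \<partial>lborel)"
      using shift by simp
    finally show "(\<integral>\<^sup>+t. ennreal (?k s t) \<partial>?M) \<le> ennreal (m powr (- b))"
      using base[of "\<lambda>y. s + y"] by simp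
  next
    fix t assume t: "t \<in> space ?M"
    have "(\<integral>\<^sup>+s. ennreal (?k s t) \<partial>?M) = (\<integral>\<^sup>+s. ennreal (?k s t) * indicator {0<..<T} s \<partial>lborel)"
      by (rule nn_integral_lebesgue_on) simp
    also have "\<dots> = (\<integral>\<^sup>+y. ennreal (?k (t - y) t) * indicator {0<..<T} (t - y) \<partial>lborel)"
      using nn_integral_real_affine[of "\<lambda>s. ennreal (?k s t) * indicator {0<..<T} s" "-1" t] by simp
    also have "\<dots> = (\<integral>\<^sup>+y. ennreal (?k 0 y) * indicator {0<..<T} (t - y) \<partial>lborel)"
      using shift by simp
    finally show "(\<integral>\<^sup>+s. ennreal (?k s t) \<partial>?M) \<le> ennreal (m powr (- b))"
      using base[of "\<lambda>y. t - y"] by simp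
  qed (use b rl_kernel_nonneg in auto)
qed

text \<open>The Neumann series converges because the weight \<open>exp (- m * t)\<close> makes the norm of \<open>c * J\<^sup>b\<close> small.\<close>

lemma rl_volterra:
  fixes f :: "real \<Rightarrow> complex"
  assumes b: "0 < b" and T: "0 < T" and f: "sq_int (lebesgue_on {0<..<T}) f"
  obtains v where "sq_int (lebesgue_on {0<..<T}) v"
    "AE t in lebesgue_on {0<..<T}. v t + c * kernel_op (lebesgue_on {0<..<T}) (rl_kernel b) v t = f t"
proof -
  define M where "M = lebesgue_on {0<..<T}"
  have sp: "space M = {0<..<T}" by (simp add: M_def)
  obtain m where m: "0 < m" and small: "cmod c * m powr (- b) \<le> 1/2"
  proof -
    have "((\<lambda>m. cmod c * m powr (- b)) \<longlongrightarrow> cmod c * 0) at_top"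
      using b by (intro tendsto_mult tendsto_const tendsto_neg_powr filterlim_ident) auto
    then have "\<forall>\<^sub>F m in at_top. cmod c * m powr (- b) < 1/2"
      by (intro order_tendstoD) auto
    with eventually_gt_at_top[of 0] have "\<forall>\<^sub>F m in at_top. 0 < m \<and> cmod c * m powr (- b) \<le> 1/2"
      by eventually_elim auto
    then have "\<exists>m. 0 < m \<and> cmod c * m powr (- b) \<le> 1/2"
      by (rule eventually_happens'[rotated]) simp
    then show ?thesis using that by blast
  qed
  interpret k: schur_kernel M "rl_kernel b" "T powr b / b / Gamma b"
    unfolding M_def by (rule schur_rl_kernel) fact+
  define kw where "kw s t = exp (- m * (t - s)) * rl_kernel b s t" for s t
  interpret kw: schur_kernel M kw "m powr (- b)"
    unfolding M_def kw_def by (rule schur_rl_kernel_weighted) fact+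
  note kw.kernel_measurable2[measurable] k.kernel_measurable2[measurable]
  have [measurable]: "f \<in> borel_measurable M" using f by (simp add: sq_int_def M_def)
  have [measurable]: "(\<lambda>t. t) \<in> borel_measurable M" by (simp add: M_def)
  \<comment> \<open>\<open>bb n\<close> is the n-th term of the Neumann series. \<open>aa n\<close>
    will majorise its modulus times exp (- m * t); being built from \<open>ennreal\<close>
    integrals, it can be summed before any convergence is known.\<close>
  define bb where "bb n = ((\<lambda>w t. - c * kernel_op M (rl_kernel b) w t) ^^ n) f" for n
  define aa where "aa n = ((\<lambda>w t. ennreal (cmod c) * (\<integral>\<^sup>+s. ennreal (kw s t) * w s \<partial>M)) ^^ n) (\<lambda>t. ennreal (exp (- m * t) * cmod (f t)))" for n
  have bb0: "bb 0 = f" and bbS: "bb (Suc n) = (\<lambda>t. - c * kernel_op M (rl_kernel b) (bb n) t)" for n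
    by (simp_all add: bb_def)
  have aa0: "aa 0 = (\<lambda>t. ennreal (exp (- m * t) * cmod (f t)))"
    and aaS: "aa (Suc n) = (\<lambda>t. ennreal (cmod c) * (\<integral>\<^sup>+s. ennreal (kw s t) * aa n s \<partial>M))" for n
    by (simp_all add: aa_def)
  have bb_m[measurable]: "bb n \<in> borel_measurable M" for n
    by (induction n) (simp_all add: bb0 bbS)
  have aa_m[measurable]: "aa n \<in> borel_measurable M" for n
    by (induction n) (simp_all add: aa0 aaS)
  have kw_split: "exp (- m * t) * rl_kernel b s t = kw s t * exp (- m * s)" for s t
    by (simp add: kw_def algebra_simps flip: exp_add)
  have dom: "ennreal (exp (- m * t) * cmod (bb n t)) \<le> aa n t" if "t \<in> space M" for n t
    using that
  proof (induction n arbitrary: t)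
    case 0
    then show ?case by (simp add: bb0 aa0)
  next
    case (Suc n)
    have "ennreal (exp (- m * t) * cmod (bb (Suc n) t))
        = ennreal (exp (- m * t) * cmod c) * ennreal (cmod (kernel_op M (rl_kernel b) (bb n) t))"
      by (simp add: bbS norm_mult mult.assoc flip: ennreal_mult')
    also have "\<dots> \<le> ennreal (exp (- m * t) * cmod c) * (\<integral>\<^sup>+s. ennreal (rl_kernel b s t) * ennreal (cmod (bb n s)) \<partial>M)"
      by (intro mult_left_mono k.norm_kernel_op_le) simp
    also have "\<dots> = ennreal (cmod c) * (\<integral>\<^sup>+s. ennreal (exp (- m * t)) * (ennreal (rl_kernel b s t) * ennreal (cmod (bb n s))) \<partial>M)"
    proof -
      have "(\<integral>\<^sup>+s. ennreal (exp (- m * t)) * (ennreal (rl_kernel b s t) * ennreal (cmod (bb n s))) \<partial>M)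
          = ennreal (exp (- m * t)) * (\<integral>\<^sup>+s. ennreal (rl_kernel b s t) * ennreal (cmod (bb n s)) \<partial>M)"
        using Suc.prems by (intro nn_integral_cmult) measurable
      moreover have "ennreal (exp (- m * t) * cmod c) = ennreal (cmod c) * ennreal (exp (- m * t))"
        by (simp add: mult.commute flip: ennreal_mult')
      ultimately show ?thesis by (simp only: mult.assoc)
    qed
    also have "\<dots> = ennreal (cmod c) * (\<integral>\<^sup>+s. ennreal (kw s t) * ennreal (exp (- m * s) * cmod (bb n s)) \<partial>M)"
    proof -
      have "ennreal (exp (- m * t)) * (ennreal (rl_kernel b s t) * ennreal (cmod (bb n s)))
          = ennreal (kw s t) * ennreal (exp (- m * s) * cmod (bb n s))" for s
        using kw_split[of t s] b
        by (simp add: rl_kernel_nonneg kw.kernel_nonneg mult.assoc[symmetric] flip: ennreal_mult')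
      then show ?thesis by simp
    qed
    also have "\<dots> \<le> aa (Suc n) t"
      unfolding aaS by (intro mult_left_mono nn_integral_mono Suc.IH) auto
    finally show ?case .
  qed
  define S where "S n t = (\<Sum>j<n. aa j t)" for n t
  have S_m[measurable]: "S n \<in> borel_measurable M" for n unfolding S_def by measurable
  have S_Suc: "S (Suc n) t = aa 0 t + ennreal (cmod c) * (\<integral>\<^sup>+s. ennreal (kw s t) * S n s \<partial>M)" if "t \<in> space M" for n t
    unfolding S_def sum.lessThan_Suc_shift using that
    by (simp add: aaS sum_distrib_left nn_integral_sum)
  define F where "F = sq_norm M f"
  have F: "F < \<infinity>" using f by (simp add: F_def sq_int_iff M_def)
  \<comment> \<open>The partial sums obey the recursion of the series, so one induction bounds them
    all. The constant 4 reproduces itself: by (x + y)^2 \<le> 2 x^2 + 2 y^2 and the choice of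
    \<open>m\<close>, the next bound is 2 F + 2 (1/2)^2 (4 F) = 4 F.\<close>
  have S_bound: "(\<integral>\<^sup>+t. (S n t)\<^sup>2 \<partial>M) \<le> 4 * F" for n
  proof (induction n)
    case 0
    show ?case by (simp add: S_def)
  next
    case (Suc n)
    have "(\<integral>\<^sup>+t. (S (Suc n) t)\<^sup>2 \<partial>M) \<le> (\<integral>\<^sup>+t. 2 * (aa 0 t)\<^sup>2 + 2 * (ennreal (cmod c))\<^sup>2 * (\<integral>\<^sup>+s. ennreal (kw s t) * S n s \<partial>M)\<^sup>2 \<partial>M)"
    proof (intro nn_integral_mono)
      fix t assume t: "t \<in> space M"
      show "(S (Suc n) t)\<^sup>2 \<le> 2 * (aa 0 t)\<^sup>2 + 2 * (ennreal (cmod c))\<^sup>2 * (\<integral>\<^sup>+s. ennreal (kw s t) * S n s \<partial>M)\<^sup>2"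
        using ennreal_square_add_le[of "aa 0 t" "ennreal (cmod c) * (\<integral>\<^sup>+s. ennreal (kw s t) * S n s \<partial>M)"]
        by (simp only: S_Suc[OF t] power_mult_distrib mult.assoc)
    qed
    also have "\<dots> = 2 * (\<integral>\<^sup>+t. (aa 0 t)\<^sup>2 \<partial>M) + 2 * (ennreal (cmod c))\<^sup>2 * (\<integral>\<^sup>+t. (\<integral>\<^sup>+s. ennreal (kw s t) * S n s \<partial>M)\<^sup>2 \<partial>M)"
      by (simp add: nn_integral_add nn_integral_cmult)
    also have "\<dots> \<le> 2 * F + 2 * (ennreal (cmod c))\<^sup>2 * ((ennreal (m powr (- b)))\<^sup>2 * (4 * F))"
    proof (intro add_mono mult_left_mono)
      show "(\<integral>\<^sup>+t. (aa 0 t)\<^sup>2 \<partial>M) \<le> F"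
        unfolding F_def sq_norm_def
      proof (intro nn_integral_mono power_mono)
        fix t assume "t \<in> space M"
        then have "exp (- m * t) \<le> 1" using m by (simp add: sp)
        then show "aa 0 t \<le> ennreal (cmod (f t))"
          unfolding aa0 by (intro ennreal_leI) (simp add: mult_left_le_one_le)
      qed simp
      show "(\<integral>\<^sup>+t. (\<integral>\<^sup>+s. ennreal (kw s t) * S n s \<partial>M)\<^sup>2 \<partial>M) \<le> (ennreal (m powr (- b)))\<^sup>2 * (4 * F)"
        using kw.schur_nn_integral[of "S n"] Suc by (meson S_m mult_left_mono order_trans zero_le)
    qed auto
    also have "\<dots> = 2 * F + ennreal (8 * (cmod c * m powr (- b))\<^sup>2) * F"
    proof -
      have "2 * (ennreal (cmod c))\<^sup>2 * ((ennreal (m powr (- b)))\<^sup>2 * 4) = ennreal (8 * (cmod c * m powr (- b))\<^sup>2)"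
        by (simp add: ennreal_power power_mult_distrib ennreal_mult' mult_ac flip: ennreal_numeral)
           (simp add: mult_ac flip: ennreal_mult' ennreal_numeral)
      then show ?thesis by (simp only: mult.assoc[symmetric])
    qed
    also have "\<dots> \<le> 2 * F + ennreal 2 * F"
    proof (intro add_left_mono mult_right_mono ennreal_leI)
      have "(cmod c * m powr (- b))\<^sup>2 \<le> (1/2)\<^sup>2" using small by (intro power_mono) auto
      then show "8 * (cmod c * m powr (- b))\<^sup>2 \<le> 2" unfolding power_divide by simp
    qed simp
    also have "\<dots> = 4 * F" by (simp flip: distrib_right)
    finally show ?case .
  qed
  define h where "h t = (\<Sum>n. aa n t)" for t
  have h_m[measurable]: "h \<in> borel_measurable M" unfolding h_def by measurable
  have lim: "(\<lambda>n. (S n t)\<^sup>2) \<longlonglongrightarrow> (h t)\<^sup>2" for t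
  proof -
    have "(\<lambda>n. S n t) \<longlonglongrightarrow> h t" unfolding S_def h_def by (intro summable_LIMSEQ) simp
    then show ?thesis unfolding power2_eq_square by (intro tendsto_mult_ennreal) auto
  qed
  have "(\<lambda>n. \<integral>\<^sup>+t. (S n t)\<^sup>2 \<partial>M) \<longlonglongrightarrow> (\<integral>\<^sup>+t. (h t)\<^sup>2 \<partial>M)"
  proof (rule nn_integral_LIMSEQ)
    show "incseq (\<lambda>n t. (S n t)\<^sup>2)"
      unfolding S_def by (intro incseq_SucI le_funI power_mono) auto
  qed (auto simp: lim)
  then have h2: "(\<integral>\<^sup>+t. (h t)\<^sup>2 \<partial>M) \<le> 4 * F"
    by (rule LIMSEQ_le_const2) (use S_bound in auto)
  then have h_fin: "(\<integral>\<^sup>+t. (h t)\<^sup>2 \<partial>M) < \<infinity>"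
    using F by (auto simp: ennreal_mult_less_top intro: le_less_trans)
  have AE_h: "AE t in M. h t < \<infinity>"
  proof -
    have "AE t in M. (h t)\<^sup>2 \<noteq> \<infinity>" using h_fin by (intro nn_integral_PInf_AE) auto
    then show ?thesis by eventually_elim (auto simp: power2_eq_square less_top ennreal_mult_eq_top_iff)
  qed
  \<comment> \<open>At such \<open>t\<close>, \<open>h\<close> dominates the series under the
    integral sign, which permits the exchange of sum and integral below.\<close>
  have AE_kh: "AE t in M. (\<integral>\<^sup>+s. ennreal (kw s t) * h s \<partial>M) < \<infinity>"
    by (rule kw.AE_finite[OF h_m h_fin])
  define v where "v t = (\<Sum>n. bb n t)" for t
  have v_m[measurable]: "v \<in> borel_measurable M" unfolding v_def by measurable
  have bb_h: "(\<Sum>n. ennreal (exp (- m * t) * cmod (bb n t))) \<le> h t" if "t \<in> space M" for t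
    unfolding h_def using that by (intro suminf_le dom) auto
  have summ: "summable (\<lambda>n. cmod (bb n t))" if "t \<in> space M" "h t < \<infinity>" for t
  proof -
    have "(\<Sum>n. ennreal (exp (- m * t) * cmod (bb n t))) \<noteq> top"
      using bb_h[OF that(1)] that(2) by (auto simp: top_unique)
    then have "summable (\<lambda>n. exp (- m * t) * cmod (bb n t))"
      by (intro summable_suminf_not_top) auto
    then show ?thesis by (simp add: summable_cmult_iff)
  qed
  \<comment> \<open>\<open>h\<close> majorises weighted terms; on (0,T) the weight is at least exp
    (- m * T), so removing it costs the factor exp (m * T).\<close>
  have v_h: "ennreal (cmod (v t)) \<le> ennreal (exp (m * T)) * h t" if t: "t \<in> space M" and ht: "h t < \<infinity>" for t
  proof -
    have "cmod (v t) \<le> (\<Sum>n. cmod (bb n t))"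
      unfolding v_def by (intro summable_norm summ t ht)
    then have "ennreal (cmod (v t)) \<le> ennreal (\<Sum>n. cmod (bb n t))" by (rule ennreal_leI)
    also have "\<dots> = (\<Sum>n. ennreal (cmod (bb n t)))"
      by (rule suminf_ennreal2[symmetric]) (auto intro: summ t ht)
    also have "\<dots> \<le> (\<Sum>n. ennreal (exp (m * T)) * ennreal (exp (- m * t) * cmod (bb n t)))"
    proof (intro suminf_le)
      fix n
      have "1 \<le> exp (m * T) * exp (- m * t)"
        using t m by (simp add: sp flip: exp_add)
      then have "1 * cmod (bb n t) \<le> exp (m * T) * exp (- m * t) * cmod (bb n t)"
        by (intro mult_right_mono) auto
      then show "ennreal (cmod (bb n t)) \<le> ennreal (exp (m * T)) * ennreal (exp (- m * t) * cmod (bb n t))"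
        by (simp add: mult.assoc flip: ennreal_mult')
    qed auto
    also have "\<dots> \<le> ennreal (exp (m * T)) * h t"
      unfolding ennreal_suminf_cmult by (intro mult_left_mono bb_h t) simp
    finally show ?thesis .
  qed
  have v: "sq_int M v"
  proof -
    have "sq_norm M v \<le> (\<integral>\<^sup>+t. (ennreal (exp (m * T)))\<^sup>2 * (h t)\<^sup>2 \<partial>M)"
      unfolding sq_norm_def
    proof (intro nn_integral_mono_AE)
      show "AE t in M. (ennreal (cmod (v t)))\<^sup>2 \<le> (ennreal (exp (m * T)))\<^sup>2 * (h t)\<^sup>2"
        using AE_h AE_space
      proof eventually_elim
        case (elim t)
        then show ?case using power_mono[OF v_h[OF elim(2,1)], of 2] by (simp add: power_mult_distrib)
      qed
    qed
    also have "\<dots> < \<infinity>" using h_fin by (simp add: nn_integral_cmult ennreal_mult_less_top power2_eq_square)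
    finally show ?thesis by (simp add: sq_int_iff)
  qed
  have "AE t in M. v t + c * kernel_op M (rl_kernel b) v t = f t"
    using AE_h AE_kh AE_space
  proof eventually_elim
    case (elim t)
    have [measurable]: "(\<lambda>s. rl_kernel b s t) \<in> borel_measurable M"
      using elim by (intro k.kernel_measurable2)
    have "(\<integral>\<^sup>+s. (\<Sum>n. ennreal (norm (rl_kernel b s t *\<^sub>R bb n s))) \<partial>M)
        \<le> (\<integral>\<^sup>+s. ennreal (exp (m * t)) * (ennreal (kw s t) * h s) \<partial>M)"
    proof (intro nn_integral_mono)
      fix s assume s: "s \<in> space M"
      have "exp (m * t) * (exp (- m * (t - s)) * exp (- m * s)) = 1"
        by (simp add: algebra_simps flip: exp_add)
      moreover have "exp (m * t) * (kw s t * exp (- m * s))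
          = (exp (m * t) * (exp (- m * (t - s)) * exp (- m * s))) * rl_kernel b s t"
        by (simp only: kw_def mult_ac)
      ultimately have "rl_kernel b s t = exp (m * t) * (kw s t * exp (- m * s))" by simp
      then have nrm: "norm (rl_kernel b s t *\<^sub>R bb n s) = exp (m * t) * (kw s t * (exp (- m * s) * cmod (bb n s)))" for n
        by (simp add: rl_kernel_nonneg[OF b] kw.kernel_nonneg abs_mult)
      have "ennreal (norm (rl_kernel b s t *\<^sub>R bb n s))
          = ennreal (exp (m * t)) * (ennreal (kw s t) * ennreal (exp (- m * s) * cmod (bb n s)))" for n
        unfolding nrm by (simp add: kw.kernel_nonneg flip: ennreal_mult')
      then have "(\<Sum>n. ennreal (norm (rl_kernel b s t *\<^sub>R bb n s)))
          = (\<Sum>n. ennreal (exp (m * t)) * (ennreal (kw s t) * ennreal (exp (- m * s) * cmod (bb n s))))"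
        by (simp only:)
      also have "\<dots> \<le> ennreal (exp (m * t)) * (ennreal (kw s t) * h s)"
        unfolding ennreal_suminf_cmult by (intro mult_left_mono bb_h s) auto
      finally show "(\<Sum>n. ennreal (norm (rl_kernel b s t *\<^sub>R bb n s))) \<le> ennreal (exp (m * t)) * (ennreal (kw s t) * h s)" .
    qed
    also have "\<dots> < \<infinity>"
      using elim by (simp add: nn_integral_cmult ennreal_mult_less_top)
    finally have "(\<lambda>n. LINT s|M. rl_kernel b s t *\<^sub>R bb n s) sums (LINT s|M. (\<Sum>n. rl_kernel b s t *\<^sub>R bb n s))"
      by (intro sums_integral_nn) measurable
    also have "(LINT s|M. (\<Sum>n. rl_kernel b s t *\<^sub>R bb n s)) = kernel_op M (rl_kernel b) v t"
      unfolding kernel_op_def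
    proof (intro integral_cong_AE)
      show "AE s in M. (\<Sum>n. rl_kernel b s t *\<^sub>R bb n s) = rl_kernel b s t *\<^sub>R v s"
        using AE_h AE_space
      proof eventually_elim
        case (elim s)
        then show ?case
          using bounded_linear.suminf[OF bounded_linear_scaleR_right summable_norm_cancel[OF summ[OF elim(2,1)]]]
          by (simp only: v_def)
      qed
    qed measurable
    finally have "(\<lambda>n. - c * kernel_op M (rl_kernel b) (bb n) t) sums (- c * kernel_op M (rl_kernel b) v t)"
      unfolding kernel_op_def by (rule sums_mult)
    \<comment> \<open>Applying - c J^b shifts the series by one index; restoring the missing term
      \<open>bb 0 = f\<close> gives the equation.\<close>
    then have "(\<lambda>n. bb (Suc n) t) sums (- c * kernel_op M (rl_kernel b) v t)"
      by (simp add: bbS)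
    then have "(\<lambda>n. bb n t) sums (- c * kernel_op M (rl_kernel b) v t + bb 0 t)"
      by (rule sums_Suc)
    then have "v t = - c * kernel_op M (rl_kernel b) v t + f t"
      unfolding v_def by (simp add: sums_iff bb0)
    then show ?case by simp
  qed
  with v show thesis using that unfolding M_def by blast
qed

subsection \<open>Moments and injectivity\<close>

lemma sigma_finite_lebesgue_real: "sigma_finite_measure (lebesgue :: real measure)"
proof
  obtain A :: "real set set" where A: "countable A" "A \<subseteq> sets lborel" "\<Union>A = space lborel" "\<forall>a\<in>A. emeasure lborel a \<noteq> \<infinity>"
    using lborel.sigma_finite_countable by blast
  then have "emeasure lebesgue a \<noteq> \<infinity>" if "a \<in> A" for a
  proof -
    have "a \<in> sets lborel" using A(2) that by blast
    then have "emeasure lebesgue a = emeasure lborel a" by simp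
    then show ?thesis using A(4) that by simp
  qed
  with A show "\<exists>A. countable A \<and> A \<subseteq> sets (lebesgue :: real measure) \<and> \<Union>A = space lebesgue \<and> (\<forall>a\<in>A. emeasure lebesgue a \<noteq> \<infinity>)"
    by (intro exI[of _ A]) auto
qed

text \<open>Half-lines are stable under intersection and generate the Borel sets, so the integral
  vanishes over every Borel set; \<open>total\<close> is what handles complements. A Lebesgue set
  differs from a Borel set by a null set only.\<close>

lemma AE_zero_if_integral_lessThan_zero:
  fixes g :: "real \<Rightarrow> 'b::{banach, second_countable_topology}"
  assumes g: "integrable lebesgue g"
    and zero: "\<And>c. (LINT x:{..<c}|lebesgue. g x) = 0" and total: "(LINT x|lebesgue. g x) = 0"
  shows "AE x in lebesgue. g x = 0"
proof (rule sigma_finite_measure.density_zero[OF sigma_finite_lebesgue_real g])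
  have int: "set_integrable lebesgue A g" if "A \<in> sets lebesgue" for A
    using integrable_mult_indicator[OF that g] by (simp add: set_integrable_def)
  have gen: "sigma_sets UNIV (range lessThan) = sets (borel :: real measure)"
    by (simp add: borel_Iio)
  have borel: "(LINT x:A|lebesgue. g x) = 0" if "A \<in> sets borel" for A :: "real set"
  proof -
    have "A \<in> sigma_sets UNIV (range lessThan)"
      using that by (simp add: gen)
    have stable: "Int_stable (range (lessThan :: real \<Rightarrow> _))"
    proof (rule Int_stableI, clarsimp)
      fix a b :: real
      show "{..<a} \<inter> {..<b} \<in> range lessThan"
        by (rule range_eqI[where x = "min a b"]) auto
    qed
    have "range (lessThan :: real \<Rightarrow> _) \<subseteq> Pow UNIV" by simp
    from stable this \<open>A \<in> sigma_sets UNIV (range lessThan)\<close> show ?thesis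
    proof (induction rule: sigma_sets_induct_disjoint)
      case (compl A)
      then have A: "A \<in> sets lebesgue" by (simp add: gen)
      have "(LINT x:UNIV - A|lebesgue. g x) = (LINT x|lebesgue. g x - indicator A x *\<^sub>R g x)"
        unfolding set_lebesgue_integral_def
        by (intro Bochner_Integration.integral_cong refl) (simp split: split_indicator)
      also have "\<dots> = (LINT x|lebesgue. g x) - (LINT x:A|lebesgue. g x)"
        using int[OF A] g unfolding set_integrable_def set_lebesgue_integral_def
        by (intro Bochner_Integration.integral_diff)
      finally show ?case using compl total by simp
    next
      case (union F)
      then have F: "F i \<in> sets lebesgue" for i by (auto simp: gen)
      have "(LINT x:(\<Union>i. F i)|lebesgue. g x) = (\<Sum>i. LINT x:F i|lebesgue. g x)"
        using F union(1) by (intro lebesgue_integral_countable_add int) (auto simp: disjoint_family_on_def)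
      then show ?case using union by simp
    qed (auto simp: zero set_lebesgue_integral_def[of _ "{}"])
  qed
  fix A assume A: "A \<in> sets (lebesgue :: real measure)"
  then obtain S N N' where A': "A = S \<union> N" "N \<subseteq> N'" "N' \<in> null_sets lborel" "S \<in> sets lborel"
    by (rule sets_completionE)
  have "(LINT x:A|lebesgue. g x) = (LINT x:S|lebesgue. g x)"
    unfolding set_lebesgue_integral_def
  proof (intro integral_cong_AE)
    have "AE x in lebesgue. x \<notin> N'" using A'(3) by (intro AE_completion AE_not_in)
    then show "AE x in lebesgue. indicator A x *\<^sub>R g x = indicator S x *\<^sub>R g x"
      by eventually_elim (use A' in \<open>auto split: split_indicator\<close>)
  qed (intro borel_measurable_scaleR borel_measurable_indicator borel_measurable_integrable[OF g] A
      sets_completionI_sets A'(4))+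
  then show "set_lebesgue_integral lebesgue A g = 0" using borel A' by simp
qed

text \<open>Vanishing moments mean vanishing integrals against polynomials, hence by
  Stone-Weierstrass against continuous functions, hence by dominated convergence against indicators
  of half-lines.\<close>

lemma AE_zero_if_moments_zero:
  fixes f :: "real \<Rightarrow> 'b::{banach, second_countable_topology}"
  assumes f: "integrable (lebesgue_on {0<..<T}) f"
    and mom: "\<And>k. (LINT t|lebesgue_on {0<..<T}. t ^ k *\<^sub>R f t) = 0"
  shows "AE t in lebesgue_on {0<..<T}. f t = 0"
proof -
  define M where "M = lebesgue_on {0<..<T}"
  have sp: "space M = {0<..<T}" by (simp add: M_def)
  have f: "integrable M f" and mom: "\<And>k. (LINT t|M. t ^ k *\<^sub>R f t) = 0" using f mom by (simp_all add: M_def)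
  have [measurable]: "f \<in> borel_measurable M" "(\<lambda>t. t) \<in> borel_measurable M" using f by (auto simp: M_def)
  have bdd: "integrable M (\<lambda>t. h t *\<^sub>R f t)" if [measurable]: "h \<in> borel_measurable M" and b: "\<And>t. t \<in> {0..T} \<Longrightarrow> \<bar>h t\<bar> \<le> B" for h B
  proof (rule Bochner_Integration.integrable_bound[of M "\<lambda>t. B * norm (f t)"])
    show "AE t in M. norm (h t *\<^sub>R f t) \<le> norm (B * norm (f t))"
      using AE_space
    proof eventually_elim
      case (elim t)
      then have "\<bar>h t\<bar> \<le> B" using b[of t] by (simp add: sp)
      then show ?case by (simp add: abs_mult mult_right_mono)
    qed
  qed (use f in auto)
  have cont: "(LINT t|M. h t *\<^sub>R f t) = 0" if h: "continuous_on UNIV h" for h :: "real \<Rightarrow> real"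
  proof -
    have [measurable]: "h \<in> borel_measurable borel" using h by (rule borel_measurable_continuous_onI)
    have hM[measurable]: "h \<in> borel_measurable M" by (rule measurable_compose[of "\<lambda>t. t" M borel h]) measurable
    have "norm (LINT t|M. h t *\<^sub>R f t) \<le> e * (LINT t|M. norm (f t))" if e: "0 < e" for e
    proof -
      obtain p where p: "real_polynomial_function p" and hp: "\<And>t. t \<in> {0..T} \<Longrightarrow> \<bar>h t - p t\<bar> < e"
        using Stone_Weierstrass_real_polynomial_function[OF compact_Icc continuous_on_subset[OF h subset_UNIV] e] by blast
      obtain a n where pa: "p = (\<lambda>t. \<Sum>i\<le>n. a i * t ^ i)"
        using p unfolding real_polynomial_function_iff_sum by blast
      have pow: "integrable M (\<lambda>t. t ^ k *\<^sub>R f t)" for k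
      proof (rule bdd[where B = "T ^ k"])
        show "\<bar>t ^ k\<bar> \<le> T ^ k" if "t \<in> {0..T}" for t
          using that by (auto simp: power_abs intro: power_mono)
      qed measurable
      have pf: "p t *\<^sub>R f t = (\<Sum>i\<le>n. a i *\<^sub>R (t ^ i *\<^sub>R f t))" for t
        unfolding pa by (simp add: scaleR_sum_left)
      have "(LINT t|M. p t *\<^sub>R f t) = (\<Sum>i\<le>n. LINT t|M. a i *\<^sub>R (t ^ i *\<^sub>R f t))"
        unfolding pf by (intro Bochner_Integration.integral_sum integrable_scaleR_right pow)
      also have "\<dots> = 0" by (simp only: integral_scaleR_right mom) simp
      finally have p0: "(LINT t|M. p t *\<^sub>R f t) = 0" .
      have pint: "integrable M (\<lambda>t. p t *\<^sub>R f t)"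
        unfolding pf by (intro Bochner_Integration.integrable_sum integrable_scaleR_right pow)
      have [measurable]: "p \<in> borel_measurable M" unfolding pa by measurable
      have dint: "integrable M (\<lambda>t. (h t - p t) *\<^sub>R f t)"
        by (rule bdd[where B = e]) (use hp in \<open>auto intro: less_imp_le\<close>)
      have "(LINT t|M. h t *\<^sub>R f t) = (LINT t|M. (h t - p t) *\<^sub>R f t + p t *\<^sub>R f t)"
        by (simp flip: scaleR_add_left)
      also have "\<dots> = (LINT t|M. (h t - p t) *\<^sub>R f t)"
        using dint pint by (simp add: p0)
      finally have "norm (LINT t|M. h t *\<^sub>R f t) \<le> (LINT t|M. norm ((h t - p t) *\<^sub>R f t))"
        by (simp only: integral_norm_bound)
      also have "\<dots> \<le> (LINT t|M. e * norm (f t))"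
      proof (intro integral_mono)
        show "norm ((h t - p t) *\<^sub>R f t) \<le> e * norm (f t)" if "t \<in> space M" for t
          using hp[of t] that by (auto simp: sp intro!: mult_right_mono)
      qed (use integrable_norm[OF dint] f in auto)
      finally show ?thesis by simp
    qed
    then have "norm (LINT t|M. h t *\<^sub>R f t) \<le> 0"
    proof -
      assume *: "\<And>e. 0 < e \<Longrightarrow> norm (LINT t|M. h t *\<^sub>R f t) \<le> e * (LINT t|M. norm (f t))"
      define I where "I = (LINT t|M. norm (f t))"
      have I: "0 \<le> I" by (simp add: I_def)
      show ?thesis
      proof (rule field_le_epsilon)
        fix e :: real assume e: "0 < e"
        have "0 < e / (I + 1)" using e I by simp
        then have "norm (LINT t|M. h t *\<^sub>R f t) \<le> e / (I + 1) * I" unfolding I_def by (rule *)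
        also have "\<dots> \<le> e" using e I by (simp add: field_simps)
        finally show "norm (LINT t|M. h t *\<^sub>R f t) \<le> 0 + e" by simp
      qed
    qed
    then show ?thesis by simp
  qed
  have ind: "(LINT t|M. indicator {..<c} t *\<^sub>R f t) = 0" for c
  proof -
    \<comment> \<open>Continuous ramps that are 0 for t >= c and eventually 1 for each t <
      c.\<close>
    let ?h = "\<lambda>n t. max 0 (min 1 (real n * (c - t)))"
    have "(\<lambda>n. LINT t|M. ?h n t *\<^sub>R f t) \<longlonglongrightarrow> (LINT t|M. indicator {..<c} t *\<^sub>R f t)"
    proof (rule integral_dominated_convergence[where w = "\<lambda>t. norm (f t)"])
      show "AE t in M. (\<lambda>n. ?h n t *\<^sub>R f t) \<longlonglongrightarrow> indicator {..<c} t *\<^sub>R f t"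
      proof (intro always_eventually allI tendsto_scaleR tendsto_const)
        fix t
        show "(\<lambda>n. ?h n t) \<longlonglongrightarrow> indicator {..<c} t"
        proof (cases "t < c")
          case True
          obtain N :: nat where N: "1 / (c - t) < real N" using reals_Archimedean2 by blast
          have "\<forall>\<^sub>F n in sequentially. ?h n t = 1"
            using eventually_ge_at_top[of N]
          proof eventually_elim
            case (elim n)
            have "1 \<le> real N * (c - t)" using N True by (simp add: field_simps)
            also have "\<dots> \<le> real n * (c - t)" using elim True by (intro mult_right_mono) auto
            finally show ?case by simp
          qed
          then show ?thesis using True by (simp add: tendsto_eventually)
        next
          case False
          have "?h n t = 0" for n
          proof -
            have "real n * (c - t) \<le> 0" using False by (intro mult_nonneg_nonpos) auto
            then show ?thesis by linarith
          qed
          then show ?thesis using False by simp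
        qed
      qed
      show "AE t in M. norm (?h n t *\<^sub>R f t) \<le> norm (f t)" for n
        by (intro always_eventually allI) (auto simp: mult_left_le_one_le)
    qed (use f in auto)
    moreover have "(LINT t|M. ?h n t *\<^sub>R f t) = 0" for n
      by (intro cont continuous_intros)
    ultimately show ?thesis by (simp add: LIMSEQ_const_iff)
  qed
  have S: "{0<..<T} \<in> sets lebesgue" by simp
  define g where "g t = indicator {0<..<T} t *\<^sub>R f t" for t
  have "integrable lebesgue g"
    using f S unfolding M_def g_def by (simp add: integrable_restrict_space set_integrable_def)
  moreover have eq: "(LINT t:A|lebesgue. g t) = (LINT t|M. indicator A t *\<^sub>R f t)" for A
    unfolding M_def g_def set_lebesgue_integral_def using S
    by (subst integral_restrict_space) (simp_all add: set_lebesgue_integral_def mult.commute)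
  moreover have "(LINT t|lebesgue. g t) = 0"
    using eq[of UNIV] mom[of 0] by (simp add: set_lebesgue_integral_def)
  ultimately have "AE t in lebesgue. g t = 0"
    by (intro AE_zero_if_integral_lessThan_zero) (simp_all add: ind)
  then have "AE t in lebesgue. t \<in> {0<..<T} \<longrightarrow> f t = 0"
    by eventually_elim (auto simp: g_def)
  then show ?thesis using S by (simp add: AE_restrict_space_iff)
qed

section \<open>Injectivity of the fractional integrals\<close>

lemma rl_kernel_one: "rl_kernel 1 s t = (if s < t then 1 else 0)"
  by (simp add: rl_kernel_def)

text \<open>The transposed kernel of order 1 integrates over (s,T), so this is the fundamental
  theorem of calculus. \<open>J_adj_one\<close> carries it over to Hilbert space values coordinate
  by coordinate.\<close>

lemma kernel_op_rl_one_FTC: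
  fixes \<theta> \<theta>' :: "real \<Rightarrow> 'b::euclidean_space"
  assumes der: "\<And>t. t \<in> {0..T} \<Longrightarrow> (\<theta> has_vector_derivative \<theta>' t) (at t within {0..T})"
    and cont: "continuous_on {0..T} \<theta>'" and s: "s \<in> {0<..<T}"
  shows "kernel_op (lebesgue_on {0<..<T}) (\<lambda>s t. rl_kernel 1 t s) \<theta>' s = \<theta> T - \<theta> s"
proof -
  have sub: "{s..T} \<subseteq> {0..T}" using s by auto
  have "(\<theta>' has_integral (\<theta> T - \<theta> s)) {s..T}"
    using s sub by (intro fundamental_theorem_of_calculus has_vector_derivative_within_subset[OF der]) auto
  moreover have "integrable (lebesgue_on {s..T}) \<theta>'"
    using continuous_on_subset[OF cont sub] by (rule continuous_imp_integrable_real)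
  then have "(\<theta>' has_integral (LINT t|lebesgue_on {s..T}. \<theta>' t)) {s..T}"
    by (intro has_integral_integral_lebesgue_on) auto
  ultimately have eq: "(LINT t|lebesgue_on {s..T}. \<theta>' t) = \<theta> T - \<theta> s"
    using has_integral_unique by blast
  have "kernel_op (lebesgue_on {0<..<T}) (\<lambda>s t. rl_kernel 1 t s) \<theta>' s
      = (LINT t|lebesgue. indicator {0<..<T} t *\<^sub>R (if s < t then \<theta>' t else 0))"
    unfolding kernel_op_def rl_kernel_one
    by (subst integral_restrict_space) (auto simp: set_lebesgue_integral_def intro!: Bochner_Integration.integral_cong)
  also have "\<dots> = (LINT t|lebesgue. indicator {s..T} t *\<^sub>R \<theta>' t)"
  proof (intro integral_cong_AE)
    have "AE t in lebesgue. t \<noteq> s \<and> t \<noteq> T"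
      using AE_completion[OF AE_lborel_singleton[of s]] AE_completion[OF AE_lborel_singleton[of T]]
      by eventually_elim simp
    then show "AE t in lebesgue. indicator {0<..<T} t *\<^sub>R (if s < t then \<theta>' t else 0) = indicator {s..T} t *\<^sub>R \<theta>' t"
      by eventually_elim (use s in \<open>auto split: split_indicator\<close>)
    show m: "(\<lambda>t. indicator {s..T} t *\<^sub>R \<theta>' t) \<in> borel_measurable lebesgue"
      using \<open>integrable (lebesgue_on {s..T}) \<theta>'\<close>
      by (auto simp: integrable_restrict_space set_integrable_def)
    have "(\<lambda>t. indicator {s<..<T} t *\<^sub>R (indicator {s..T} t *\<^sub>R \<theta>' t)) \<in> borel_measurable lebesgue"
      by (intro borel_measurable_scaleR borel_measurable_indicator m) simp
    also have "(\<lambda>t. indicator {s<..<T} t *\<^sub>R (indicator {s..T} t *\<^sub>R \<theta>' t)) = (\<lambda>t. indicator {0<..<T} t *\<^sub>R (if s < t then \<theta>' t else 0))"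
      using s by (auto split: split_indicator)
    finally show "(\<lambda>t. indicator {0<..<T} t *\<^sub>R (if s < t then \<theta>' t else 0)) \<in> borel_measurable lebesgue" .
  qed
  also have "\<dots> = (LINT t|lebesgue_on {s..T}. \<theta>' t)"
    by (subst integral_restrict_space) (auto simp: set_lebesgue_integral_def)
  finally show ?thesis using eq by simp
qed

lemma continuous_on_imp_sq_int:
  fixes g :: "real \<Rightarrow> 'b::{banach, second_countable_topology}"
  assumes g: "continuous_on {0..T} g"
  shows "sq_int (lebesgue_on {0<..<T}) g"
proof -
  obtain B where "\<forall>x\<in>g ` {0..T}. norm x \<le> B"
    using compact_imp_bounded[OF compact_continuous_image[OF g compact_Icc]] unfolding bounded_iff by blast
  then have B: "norm (g t) \<le> B" if "t \<in> {0..T}" for t using that by blast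
  interpret finite_measure "lebesgue_on {0<..<T}" by (rule finite_measure_lebesgue_on) auto
  have [measurable]: "g \<in> borel_measurable (lebesgue_on {0<..<T})"
    using g by (intro continuous_imp_measurable_on_sets_lebesgue continuous_on_subset[OF g]) auto
  have "integrable (lebesgue_on {0<..<T}) (\<lambda>t. (norm (g t))\<^sup>2)"
  proof (rule integrable_const_bound[where B = "B\<^sup>2"])
    show "AE t in lebesgue_on {0<..<T}. norm ((norm (g t))\<^sup>2) \<le> B\<^sup>2"
      using AE_space by eventually_elim (auto intro!: power_mono B)
  qed measurable
  then show ?thesis by (simp add: sq_int_def)
qed

text \<open>Pairing J^1 w = 0 with t^k and moving J^1 to the power shows that \<open>w\<close> is
  orthogonal to T^(k+1) - s^(k+1). Since t^k (T - t) = (T^(k+1) - t^(k+1)) - T (T^k - t^k), all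
  moments of (T - t) w vanish, and T - t has no zero in (0,T).\<close>

lemma rl_one_injective:
  fixes w :: "real \<Rightarrow> 'b::{banach, second_countable_topology}"
  assumes T: "0 < T" and w: "sq_int (lebesgue_on {0<..<T}) w"
    and zero: "AE t in lebesgue_on {0<..<T}. kernel_op (lebesgue_on {0<..<T}) (rl_kernel 1) w t = 0"
  shows "AE t in lebesgue_on {0<..<T}. w t = 0"
proof -
  let ?M = "lebesgue_on {0<..<T}"
  interpret k: schur_kernel ?M "rl_kernel 1" "T powr 1 / 1 / Gamma 1"
    by (rule schur_rl_kernel) (use T in auto)
  \<comment> \<open>Flipped because \<open>kernel_op_adjoint\<close> takes the function under the
    operator, here the vector-valued one, as first factor.\<close>
  have B: "bounded_bilinear (\<lambda>a r. r *\<^sub>R (a :: 'b))"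
    using bounded_bilinear.flip[OF bounded_bilinear_scaleR] .
  have [measurable]: "w \<in> borel_measurable ?M" using w by (simp add: sq_int_def)
  have pow: "sq_int ?M (\<lambda>t. t ^ k)" for k
    by (intro continuous_on_imp_sq_int continuous_intros)
  have wint: "integrable ?M (\<lambda>t. h t *\<^sub>R w t)" if "sq_int ?M h" for h :: "real \<Rightarrow> real"
    using integrable_bilinear_sq_int[OF B w that] .
  have mom: "(LINT s|?M. (T ^ Suc k - s ^ Suc k) *\<^sub>R w s) = 0" for k
  proof -
    define \<theta> where "\<theta> t = t ^ Suc k / real (Suc k)" for t :: real
    have \<theta>: "kernel_op ?M (\<lambda>s t. rl_kernel 1 t s) (\<lambda>t. t ^ k) s = \<theta> T - \<theta> s" if "s \<in> {0<..<T}" for s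
    proof (rule kernel_op_rl_one_FTC)
      fix t
      have "(\<theta> has_real_derivative (real (Suc k) * t ^ k / real (Suc k))) (at t within {0..T})"
        unfolding \<theta>_def by (auto intro!: derivative_eq_intros simp del: power_Suc of_nat_Suc)
      then show "(\<theta> has_vector_derivative t ^ k) (at t within {0..T})"
        by (simp add: has_real_derivative_iff_has_vector_derivative del: of_nat_Suc)
    qed (use that in \<open>auto intro!: continuous_intros\<close>)
    have "0 = (LINT t|?M. t ^ k *\<^sub>R kernel_op ?M (rl_kernel 1) w t)"
      using zero by (intro integral_eq_zero_AE[symmetric]) (auto elim: eventually_mono)
    also have "\<dots> = (LINT s|?M. kernel_op ?M (\<lambda>s t. rl_kernel 1 t s) (\<lambda>t. t ^ k) s *\<^sub>R w s)"
      by (rule k.kernel_op_adjoint[OF w pow B])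
    also have "\<dots> = (LINT s|?M. (1 / real (Suc k)) *\<^sub>R (T ^ Suc k - s ^ Suc k) *\<^sub>R w s)"
      by (intro Bochner_Integration.integral_cong refl) (simp add: \<theta> \<theta>_def diff_divide_distrib del: of_nat_Suc power_Suc)
    also have "\<dots> = (1 / real (Suc k)) *\<^sub>R (LINT s|?M. (T ^ Suc k - s ^ Suc k) *\<^sub>R w s)"
      by (rule integral_scaleR_right)
    finally show ?thesis by (simp del: of_nat_Suc power_Suc)
  qed
  have "AE t in ?M. (T - t) *\<^sub>R w t = 0"
  proof (rule AE_zero_if_moments_zero)
    show "integrable ?M (\<lambda>t. (T - t) *\<^sub>R w t)"
      by (intro wint continuous_on_imp_sq_int continuous_intros)
    fix k
    \<comment> \<open>\<open>mom\<close> starts at exponent 1; for exponent 0 the factor itself is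
      0.\<close>
    have mom': "(LINT s|?M. (T ^ k - s ^ k) *\<^sub>R w s) = 0"
      by (cases k) (use mom in auto)
    have "(LINT t|?M. t ^ k *\<^sub>R (T - t) *\<^sub>R w t) =
        (LINT t|?M. (T ^ Suc k - t ^ Suc k) *\<^sub>R w t - T *\<^sub>R ((T ^ k - t ^ k) *\<^sub>R w t))"
      by (intro Bochner_Integration.integral_cong refl) (simp add: algebra_simps)
    also have "\<dots> = (LINT t|?M. (T ^ Suc k - t ^ Suc k) *\<^sub>R w t) - T *\<^sub>R (LINT t|?M. (T ^ k - t ^ k) *\<^sub>R w t)"
      by (subst Bochner_Integration.integral_diff)
         (auto intro!: wint continuous_on_imp_sq_int continuous_intros simp del: scaleR_scaleR power_Suc)
    finally show "(LINT t|?M. t ^ k *\<^sub>R (T - t) *\<^sub>R w t) = 0" by (simp add: mom mom' del: power_Suc)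
  qed
  with AE_space show ?thesis by eventually_elim auto
qed

text \<open>Applying J^(1-b) turns J^b w = 0 into J^1 w = 0.\<close>

lemma rl_injective:
  fixes w :: "real \<Rightarrow> 'b::{banach, second_countable_topology}"
  assumes b: "0 < b" "b < 1" and T: "0 < T" and w: "sq_int (lebesgue_on {0<..<T}) w"
    and zero: "AE t in lebesgue_on {0<..<T}. kernel_op (lebesgue_on {0<..<T}) (rl_kernel b) w t = 0"
  shows "AE t in lebesgue_on {0<..<T}. w t = 0"
proof (rule rl_one_injective[OF T w])
  let ?M = "lebesgue_on {0<..<T}"
  interpret k: schur_kernel ?M "rl_kernel b" "T powr b / b / Gamma b"
    by (rule schur_rl_kernel) fact+
  interpret k': schur_kernel ?M "rl_kernel (1 - b)" "T powr (1 - b) / (1 - b) / Gamma (1 - b)"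
    by (rule schur_rl_kernel) (use b T in auto)
  have [measurable]: "w \<in> borel_measurable ?M" using w by (simp add: sq_int_def)
  have "AE t in ?M. kernel_op ?M (rl_kernel (1 - b)) (kernel_op ?M (rl_kernel b) w) t = kernel_op ?M (rl_kernel 1) w t"
    using b rl_kernel_comp[of b "1 - b"]
    by (intro kernel_op_comp[OF k.schur_kernel_axioms k'.schur_kernel_axioms _ _ w]) (auto simp: rl_kernel_nonneg)
  with AE_space show "AE t in ?M. kernel_op ?M (rl_kernel 1) w t = 0"
  proof eventually_elim
    case (elim t)
    have "kernel_op ?M (rl_kernel (1 - b)) (kernel_op ?M (rl_kernel b) w) t = kernel_op ?M (rl_kernel (1 - b)) (\<lambda>_. 0) t"
      using elim by (intro k'.kernel_op_cong_AE zero) auto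
    then show ?case using elim by (simp add: kernel_op_def)
  qed
qed

lemma rl_unique:
  fixes v w :: "real \<Rightarrow> 'b::{banach, second_countable_topology}"
  assumes b: "0 < b" "b < 1" and T: "0 < T"
    and v: "sq_int (lebesgue_on {0<..<T}) v" and w: "sq_int (lebesgue_on {0<..<T}) w"
    and eq: "AE t in lebesgue_on {0<..<T}. kernel_op (lebesgue_on {0<..<T}) (rl_kernel b) v t
      = kernel_op (lebesgue_on {0<..<T}) (rl_kernel b) w t"
  shows "AE t in lebesgue_on {0<..<T}. v t = w t"
proof -
  let ?M = "lebesgue_on {0<..<T}"
  interpret k: schur_kernel ?M "rl_kernel b" "T powr b / b / Gamma b"
    by (rule schur_rl_kernel) fact+
  have w': "sq_int ?M (\<lambda>t. - w t)"
    using w by (simp add: sq_int_def)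
  have "AE t in ?M. v t + - w t = 0"
  proof (rule rl_injective[OF b T sq_int_add[OF v w']])
    show "AE t in ?M. kernel_op ?M (rl_kernel b) (\<lambda>t. v t + - w t) t = 0"
      using eq k.kernel_op_add[OF v w'] by eventually_elim (simp add: kernel_op_def)
  qed
  then show ?thesis by eventually_elim simp
qed

subsection \<open>Time reflection\<close>

lemma reflect_measurable: "(\<lambda>t. T - t) \<in> lebesgue_on {0<..<T} \<rightarrow>\<^sub>M lebesgue_on {0<..<T :: real}"
proof (rule measurable_restrict_space3)
  show "(\<lambda>t. T - t) \<in> lebesgue \<rightarrow>\<^sub>M lebesgue"
    using lebesgue_affine_measurable[of "\<lambda>_. -1" T] by simp
qed auto

lemma distr_reflect: "distr (lebesgue_on {0<..<T}) (lebesgue_on {0<..<T}) (\<lambda>t. T - t) = lebesgue_on {0<..<T :: real}"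
proof (rule measure_eqI)
  have leb: "distr lebesgue lebesgue (\<lambda>t. T - t) = (lebesgue :: real measure)"
    using lebesgue_real_affine[of "-1" T] by (simp add: density_1)
  fix A assume "A \<in> sets (distr (lebesgue_on {0<..<T}) (lebesgue_on {0<..<T}) (\<lambda>t. T - t))"
  then have A: "A \<in> sets lebesgue" "A \<subseteq> {0<..<T}" by (auto simp: sets_restrict_space)
  have m: "(\<lambda>t. T - t) \<in> lebesgue \<rightarrow>\<^sub>M lebesgue"
    using lebesgue_affine_measurable[of "\<lambda>_. -1" T] by simp
  have pre: "(\<lambda>t. T - t) -` A \<inter> {0<..<T} = (\<lambda>t. T - t) -` A" using A(2) by auto
  have "emeasure (distr (lebesgue_on {0<..<T}) (lebesgue_on {0<..<T}) (\<lambda>t. T - t)) A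
      = emeasure (lebesgue_on {0<..<T}) ((\<lambda>t. T - t) -` A)"
    using A by (subst emeasure_distr[OF reflect_measurable]) (auto simp: sets_restrict_space_iff pre Int_absorb2)
  also have "\<dots> = emeasure lebesgue ((\<lambda>t. T - t) -` A)"
    using A(2) by (intro emeasure_restrict_space) auto
  also have "\<dots> = emeasure (distr lebesgue lebesgue (\<lambda>t. T - t)) A"
    using A m by (subst emeasure_distr) auto
  also have "\<dots> = emeasure (lebesgue_on {0<..<T}) A"
    unfolding leb using A(2) by (intro emeasure_restrict_space[symmetric]) auto
  finally show "emeasure (distr (lebesgue_on {0<..<T}) (lebesgue_on {0<..<T}) (\<lambda>t. T - t)) A = emeasure (lebesgue_on {0<..<T}) A" .
qed simp

lemma AE_reflect:
  assumes "AE t in lebesgue_on {0<..<T}. P t"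
  shows "AE t in lebesgue_on {0<..<T :: real}. P (T - t)"
  using assms by (rule AE_distrD[OF reflect_measurable, of P, unfolded distr_reflect])

lemma integral_reflect:
  fixes g :: "real \<Rightarrow> 'b::{banach, second_countable_topology}"
  assumes "g \<in> borel_measurable (lebesgue_on {0<..<T})"
  shows "(LINT t|lebesgue_on {0<..<T}. g (T - t)) = (LINT t|lebesgue_on {0<..<T}. g t)"
  using integral_distr[OF reflect_measurable assms] by (simp add: distr_reflect)

lemma sq_int_reflect:
  fixes v :: "real \<Rightarrow> 'b::{banach, second_countable_topology}"
  assumes "sq_int (lebesgue_on {0<..<T}) v"
  shows "sq_int (lebesgue_on {0<..<T}) (\<lambda>t. v (T - t))"
  using assms measurable_compose[OF reflect_measurable, of v]
    integrable_distr[OF reflect_measurable, where f = "\<lambda>t. (norm (v t))\<^sup>2"]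
  by (simp add: sq_int_def distr_reflect)

text \<open>Time reflection intertwines J^b with its adjoint; therefore the reflected derivative
  (\<partial>^\<alpha>)' inverts the adjoint of J^\<alpha>.\<close>

lemma kernel_op_reflect:
  fixes v :: "real \<Rightarrow> 'b::{banach, second_countable_topology}"
  assumes v: "v \<in> borel_measurable (lebesgue_on {0<..<T})"
  shows "kernel_op (lebesgue_on {0<..<T}) (rl_kernel b) v (T - t)
    = kernel_op (lebesgue_on {0<..<T}) (\<lambda>s t. rl_kernel b t s) (\<lambda>t. v (T - t)) t"
proof -
  have "(\<lambda>s. rl_kernel b s (T - t) *\<^sub>R v s) \<in> borel_measurable (lebesgue_on {0<..<T})"
    using v by measurable
  moreover have "rl_kernel b (T - s) (T - t) = rl_kernel b t s" for s
    by (simp add: rl_kernel_def)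
  ultimately show ?thesis
    unfolding kernel_op_def by (subst integral_reflect[symmetric]) simp_all
qed

subsection \<open>Complex Hilbert spaces\<close>

lemma cinner_add_right: "cinner x (y + z) = cinner x y + cinner (x :: 'a::complex_inner) z"
  by (metis cinner_add_left cinner_commute complex_cnj_add)

lemma cinner_scaleC_right: "cinner x (a *\<^sub>C y) = cnj a * cinner (x :: 'a::complex_inner) y"
  by (metis cinner_scaleC_left cinner_commute complex_cnj_mult)

lemma cinner_scaleR_left: "cinner (r *\<^sub>R x) y = of_real r * cinner (x :: 'a::complex_inner) y"
  by (metis cinner_scaleC_left scaleC_of_real)

lemma cinner_scaleR_right: "cinner x (r *\<^sub>R y) = of_real r * cinner (x :: 'a::complex_inner) y"
  by (metis cinner_scaleC_right complex_cnj_complex_of_real scaleC_of_real)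

lemma cinner_zero_left: "cinner 0 (y :: 'a::complex_inner) = 0"
  using cinner_scaleR_left[of 0 0 y] by simp

lemma cinner_zero_right: "cinner (x :: 'a::complex_inner) 0 = 0"
  using cinner_scaleR_right[of x 0 0] by simp

lemma cinner_minus_left: "cinner (- x) y = - cinner (x :: 'a::complex_inner) y"
  using cinner_scaleR_left[of "-1" x y] by simp

lemma cinner_diff_left: "cinner (x - y) z = cinner x z - cinner (y :: 'a::complex_inner) z"
  using cinner_add_left[of x "- y" z] by (simp add: cinner_minus_left)

lemma cinner_diff_right: "cinner x (y - z) = cinner x y - cinner (x :: 'a::complex_inner) z"
  using cinner_add_right[of x y "- z"] cinner_scaleR_right[of x "-1" z] by simp

lemma norm_scaleC: "norm (a *\<^sub>C (x :: 'a::complex_inner)) = cmod a * norm x"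
proof -
  have "complex_of_real ((norm (a *\<^sub>C x))\<^sup>2) = (a * cnj a) * cinner x x"
    unfolding cinner_self[symmetric] by (simp add: cinner_scaleC_left cinner_scaleC_right)
  also have "\<dots> = complex_of_real ((cmod a)\<^sup>2) * complex_of_real ((norm x)\<^sup>2)"
    by (simp only: complex_norm_square cinner_self)
  also have "\<dots> = complex_of_real ((cmod a * norm x)\<^sup>2)"
    by (simp add: power_mult_distrib)
  finally have "complex_of_real ((norm (a *\<^sub>C x))\<^sup>2) = complex_of_real ((cmod a * norm x)\<^sup>2)" .
  then have "(norm (a *\<^sub>C x))\<^sup>2 = (cmod a * norm x)\<^sup>2" by (simp only: of_real_eq_iff)
  then show ?thesis by (rule power2_eq_imp_eq) auto
qed

lemma cmod_cinner_le: "cmod (cinner x y) \<le> norm x * norm (y :: 'a::complex_inner)"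
proof (cases "y = 0")
  case False
  define t where "t = cinner x y / complex_of_real ((norm y)\<^sup>2)"
  have ny: "norm y \<noteq> 0" using False by simp
  have "complex_of_real ((norm (x - t *\<^sub>C y))\<^sup>2)
      = cinner x x - cnj t * cinner x y - t * cnj (cinner x y) + t * cnj t * cinner y y"
    unfolding cinner_self[symmetric]
    by (simp add: cinner_diff_left cinner_diff_right cinner_scaleC_left cinner_scaleC_right
        cinner_commute[of y x] algebra_simps)
  also have "\<dots> = complex_of_real ((norm x)\<^sup>2) - cinner x y * cnj (cinner x y) / complex_of_real ((norm y)\<^sup>2)"
    using ny by (simp add: t_def cinner_self field_simps power2_eq_square)
  also have "\<dots> = complex_of_real ((norm x)\<^sup>2 - (cmod (cinner x y))\<^sup>2 / (norm y)\<^sup>2)"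
    by (simp flip: complex_norm_square)
  finally have "(norm (x - t *\<^sub>C y))\<^sup>2 = (norm x)\<^sup>2 - (cmod (cinner x y))\<^sup>2 / (norm y)\<^sup>2"
    by (simp only: of_real_eq_iff)
  then have "(cmod (cinner x y))\<^sup>2 / (norm y)\<^sup>2 \<le> (norm x)\<^sup>2"
    using zero_le_power2[of "norm (x - t *\<^sub>C y)"] by linarith
  then have "(cmod (cinner x y))\<^sup>2 \<le> (norm x * norm y)\<^sup>2"
    using ny by (simp add: divide_le_eq power_mult_distrib)
  then show ?thesis by (rule power2_le_imp_le) simp
qed (simp add: cinner_zero_right)

lemma bounded_bilinear_cinner: "bounded_bilinear (cinner :: 'a::complex_inner \<Rightarrow> 'a \<Rightarrow> complex)"
proof
  show "\<exists>K. \<forall>a b :: 'a. norm (cinner a b) \<le> norm a * norm b * K"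
    by (rule exI[of _ 1]) (simp add: cmod_cinner_le)
qed (simp_all add: cinner_add_left cinner_add_right cinner_scaleR_left cinner_scaleR_right scaleR_conv_of_real)

lemma bounded_linear_scaleC: "bounded_linear (\<lambda>x :: 'a::complex_inner. a *\<^sub>C x)"
proof (rule bounded_linear_intro[where K = "cmod a"])
  show "a *\<^sub>C (r *\<^sub>R x) = r *\<^sub>R (a *\<^sub>C x)" for r and x :: 'a
    by (simp add: scaleC_scaleC mult.commute flip: scaleC_of_real)
qed (simp_all add: scaleC_add_right norm_scaleC)

lemma bounded_linear_scaleC_left: "bounded_linear (\<lambda>a. a *\<^sub>C (x :: 'a::complex_inner))"
proof (rule bounded_linear_intro[where K = "norm x"])
  show "(r *\<^sub>R a) *\<^sub>C x = r *\<^sub>R (a *\<^sub>C x)" for r a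
    by (simp add: scaleC_scaleC scaleR_conv_of_real flip: scaleC_of_real)
qed (simp_all add: scaleC_add_left norm_scaleC)

lemma module_scaleC: "module (scaleC :: complex \<Rightarrow> 'a::complex_inner \<Rightarrow> 'a)"
proof
  show "1 *\<^sub>C x = x" for x :: 'a using scaleC_of_real[of 1 x] by simp
qed (simp_all add: scaleC_add_right scaleC_add_left scaleC_scaleC)

locale hilbert_basis =
  fixes \<phi> :: "nat \<Rightarrow> 'h::chilbert_space"
  assumes basis: "orthonormal_basis \<phi>"
begin

lemma cinner_basis: "cinner (\<phi> m) (\<phi> n) = (if m = n then 1 else 0)"
  using basis by (simp add: orthonormal_basis_def)

lemma cinner_sum_left: "cinner (\<Sum>i\<in>I. f i) (y :: 'h) = (\<Sum>i\<in>I. cinner (f i) y)"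
  using bounded_linear.linear[OF bounded_bilinear.bounded_linear_left[OF bounded_bilinear_cinner, of y]]
  by (rule linear_sum)

lemma cinner_combination:
  "finite I \<Longrightarrow> cinner (\<Sum>i\<in>I. c i *\<^sub>C \<phi> i) (\<phi> n) = (if n \<in> I then c n else 0)"
  by (simp add: cinner_sum_left cinner_scaleC_left cinner_basis if_distrib cong: if_cong)

lemma norm_combination:
  assumes "finite I" shows "(norm (\<Sum>i\<in>I. c i *\<^sub>C \<phi> i))\<^sup>2 = (\<Sum>i\<in>I. (cmod (c i))\<^sup>2)"
proof -
  let ?s = "\<Sum>i\<in>I. c i *\<^sub>C \<phi> i"
  have "complex_of_real ((norm ?s)\<^sup>2) = (\<Sum>i\<in>I. c i * cinner (\<phi> i) ?s)"
    by (subst cinner_self[symmetric], subst cinner_sum_left) (simp add: cinner_scaleC_left)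
  also have "\<dots> = (\<Sum>i\<in>I. c i * cnj (c i))"
    using assms by (intro sum.cong refl, subst cinner_commute) (simp add: cinner_combination)
  also have "\<dots> = complex_of_real (\<Sum>i\<in>I. (cmod (c i))\<^sup>2)"
    by (simp flip: complex_norm_square)
  finally show ?thesis by (simp only: of_real_eq_iff)
qed

definition proj :: "nat \<Rightarrow> 'h \<Rightarrow> 'h" where
  "proj N x = (\<Sum>n<N. cinner x (\<phi> n) *\<^sub>C \<phi> n)"

text \<open>Bessel's inequality: the inner product of the projection with \<open>x\<close> is the
  squared norm of the projection, and Cauchy-Schwarz bounds it.\<close>

lemma norm_proj_le: "norm (proj N x) \<le> norm x"
proof -
  have "cinner (proj N x) x = (\<Sum>n<N. cinner x (\<phi> n) * cinner (\<phi> n) x)"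
    by (simp add: proj_def cinner_sum_left cinner_scaleC_left)
  also have "\<dots> = (\<Sum>n<N. complex_of_real ((cmod (cinner x (\<phi> n)))\<^sup>2))"
    by (intro sum.cong refl) (simp only: cinner_commute[of "\<phi> _" x] complex_norm_square)
  also have "\<dots> = complex_of_real ((norm (proj N x))\<^sup>2)"
    unfolding proj_def norm_combination[OF finite_lessThan] by simp
  finally have "cinner (proj N x) x = complex_of_real ((norm (proj N x))\<^sup>2)" .
  then have "(norm (proj N x))\<^sup>2 = cmod (cinner (proj N x) x)"
    by (simp add: norm_power)
  also have "\<dots> \<le> norm (proj N x) * norm x" by (rule cmod_cinner_le)
  finally have "norm (proj N x) * norm (proj N x) \<le> norm (proj N x) * norm x"
    by (simp only: power2_eq_square)
  then show ?thesis by (cases "norm (proj N x) = 0") (auto simp: mult_le_cancel_left)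
qed

lemma proj_add: "proj N (x + y) = proj N x + proj N y"
  by (simp add: proj_def cinner_add_left scaleC_add_left sum.distrib)

lemma proj_scaleC: "proj N (a *\<^sub>C x) = a *\<^sub>C proj N x"
  by (simp add: proj_def cinner_scaleC_left scaleC_scaleC module.scale_sum_right[OF module_scaleC])

text \<open>On a basis vector the sequence is eventually constant, so convergence holds on the span;
  the uniform bound \<open>norm_proj_le\<close> extends it to the closure.\<close>

lemma proj_tendsto: "(\<lambda>N. proj N x) \<longlonglongrightarrow> x"
proof -
  define U where "U = {x. (\<lambda>N. proj N x) \<longlonglongrightarrow> x}"
  have U: "x \<in> U" if "x \<in> module.span scaleC (range \<phi>)" for x
    using that unfolding U_def mem_Collect_eq
  proof (rule module.span_induct[OF module_scaleC])
    show "module.subspace scaleC {x. (\<lambda>N. proj N x) \<longlonglongrightarrow> x}"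
    proof (rule module.subspaceI[OF module_scaleC])
      have "proj N 0 = 0" for N using proj_scaleC[of N 0 0] by (simp add: proj_def cinner_zero_left module.scale_zero_left[OF module_scaleC])
      then show "0 \<in> {x. (\<lambda>N. proj N x) \<longlonglongrightarrow> x}" by simp
    qed (auto simp: proj_add proj_scaleC intro!: tendsto_add bounded_linear.tendsto[OF bounded_linear_scaleC])
  next
    fix y assume "y \<in> range \<phi>"
    then obtain m where y: "y = \<phi> m" by blast
    have "\<forall>\<^sub>F N in sequentially. proj N (\<phi> m) = \<phi> m"
      using eventually_gt_at_top[of m]
    proof eventually_elim
      case (elim N)
      have "proj N (\<phi> m) = (\<Sum>n<N. if n = m then \<phi> m else 0)"
        unfolding proj_def
        by (intro sum.cong refl) (simp add: cinner_basis module.scale_one[OF module_scaleC] module.scale_zero_left[OF module_scaleC])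
      then show ?case using elim by simp
    qed
    then show "(\<lambda>N. proj N y) \<longlonglongrightarrow> y" by (simp add: y tendsto_eventually)
  qed
  show ?thesis
  proof (rule LIMSEQ_I)
    fix e :: real assume e: "0 < e"
    have "x \<in> closure (module.span scaleC (range \<phi>))" using basis by (simp add: orthonormal_basis_def)
    then obtain y where y: "y \<in> module.span scaleC (range \<phi>)" "dist y x < e / 3"
      using e by (auto simp: closure_approachable dest: spec[of _ "e / 3"])
    then have "(\<lambda>N. proj N y) \<longlonglongrightarrow> y" using U by (simp add: U_def)
    then obtain N0 where N0: "\<And>N. N0 \<le> N \<Longrightarrow> norm (proj N y - y) < e / 3"
      using LIMSEQ_D[of _ _ "e / 3"] e by (metis divide_pos_pos zero_less_numeral)
    have "norm (proj N x - x) < e" if "N0 \<le> N" for N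
    proof -
      have "proj N x = proj N (x - y) + proj N y" by (simp flip: proj_add)
      then have "proj N x - x = proj N (x - y) + (proj N y - y) + (y - x)" by simp
      also have "norm \<dots> \<le> norm (proj N (x - y)) + norm (proj N y - y) + norm (y - x)"
        by (intro order_trans[OF norm_triangle_ineq] add_mono norm_triangle_ineq) simp
      also have "\<dots> < e / 3 + e / 3 + e / 3"
        using norm_proj_le[of N "x - y"] y(2) N0[OF that]
        by (intro add_strict_mono) (auto simp: dist_norm norm_minus_commute)
      finally show ?thesis by simp
    qed
    then show "\<exists>no. \<forall>n\<ge>no. norm (proj n x - x) < e" by blast
  qed
qed

lemma basis_sums: "(\<lambda>n. cinner x (\<phi> n) *\<^sub>C \<phi> n) sums x"
  using proj_tendsto[of x] by (simp add: sums_def proj_def)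

lemma parseval: "(\<lambda>n. cinner x (\<phi> n) * cnj (cinner y (\<phi> n))) sums cinner x y"
  using bounded_linear.sums[OF bounded_bilinear.bounded_linear_left[OF bounded_bilinear_cinner] basis_sums[of x], of y]
  by (simp add: cinner_scaleC_left flip: cinner_commute)

lemma parseval_norm: "(\<lambda>n. (cmod (cinner x (\<phi> n)))\<^sup>2) sums (norm x)\<^sup>2"
  using bounded_linear.sums[OF bounded_linear_Re parseval[of x x]]
  by (simp add: cinner_self flip: complex_norm_square)

lemma basis_eqI: "(\<And>n. cinner x (\<phi> n) = cinner y (\<phi> n)) \<Longrightarrow> x = y"
  using basis_sums[of x] basis_sums[of y] sums_unique2 by auto

lemma riesz_fischer:
  assumes "summable (\<lambda>n. (cmod (c n))\<^sup>2)"
  shows "summable (\<lambda>n. c n *\<^sub>C \<phi> n)" and "cinner (\<Sum>n. c n *\<^sub>C \<phi> n) (\<phi> m) = c m"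
proof -
  show s: "summable (\<lambda>n. c n *\<^sub>C \<phi> n)"
    unfolding summable_Cauchy
  proof (intro allI impI)
    fix e :: real assume e: "0 < e"
    then obtain N where N: "\<And>m n. N \<le> m \<Longrightarrow> norm (\<Sum>i\<in>{m..<n}. (cmod (c i))\<^sup>2) < e\<^sup>2"
      using assms unfolding summable_Cauchy by (metis zero_less_power)
    have "norm (\<Sum>i\<in>{m..<n}. c i *\<^sub>C \<phi> i) < e" if "N \<le> m" for m n
    proof (rule power_less_imp_less_base)
      have "(norm (\<Sum>i\<in>{m..<n}. c i *\<^sub>C \<phi> i))\<^sup>2 = (\<Sum>i\<in>{m..<n}. (cmod (c i))\<^sup>2)"
        by (rule norm_combination) simp
      also have "\<dots> < e\<^sup>2" using N[OF that, of n] by (simp add: sum_nonneg)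
      finally show "(norm (\<Sum>i\<in>{m..<n}. c i *\<^sub>C \<phi> i))\<^sup>2 < e\<^sup>2" .
    qed (use e in simp)
    then show "\<exists>N. \<forall>m\<ge>N. \<forall>n. norm (\<Sum>i\<in>{m..<n}. c i *\<^sub>C \<phi> i) < e" by blast
  qed
  have "(\<lambda>n. cinner (c n *\<^sub>C \<phi> n) (\<phi> m)) sums cinner (\<Sum>n. c n *\<^sub>C \<phi> n) (\<phi> m)"
    using bounded_linear.sums[OF bounded_bilinear.bounded_linear_left[OF bounded_bilinear_cinner] summable_sums[OF s]] .
  moreover have "(\<lambda>n. cinner (c n *\<^sub>C \<phi> n) (\<phi> m)) sums c m"
    using sums_single[of m "\<lambda>_. c m"] by (simp add: cinner_scaleC_left cinner_basis if_distrib eq_commute cong: if_cong)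
  ultimately show "cinner (\<Sum>n. c n *\<^sub>C \<phi> n) (\<phi> m) = c m" by (rule sums_unique2)
qed

end

subsection \<open>Negative diagonal operators\<close>

locale diagonal_operator = hilbert_basis \<phi> for \<phi> :: "nat \<Rightarrow> 'h::chilbert_space" +
  fixes D :: "'h set" and A :: "'h \<Rightarrow> 'h" and lam :: "nat \<Rightarrow> real"
  assumes self_adj: "self_adjoint D A"
    and basis_dom: "\<And>n. \<phi> n \<in> D" and eigen: "\<And>n. A (\<phi> n) = - (lam n *\<^sub>R \<phi> n)"
    and lam0: "0 < lam 0" and lam_mono: "mono lam"
begin

lemma lam_ge: "lam 0 \<le> lam n"
  using lam_mono by (simp add: monoD)

lemma lam_pos: "0 < lam n"
  using lam0 lam_ge[of n] by linarith

lemma dom_add: "x \<in> D \<Longrightarrow> y \<in> D \<Longrightarrow> x + y \<in> D"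
  and dom_scaleC: "x \<in> D \<Longrightarrow> a *\<^sub>C x \<in> D"
  and op_add: "x \<in> D \<Longrightarrow> y \<in> D \<Longrightarrow> A (x + y) = A x + A y"
  and op_scaleC: "x \<in> D \<Longrightarrow> A (a *\<^sub>C x) = a *\<^sub>C A x"
  using self_adj module.subspace_add[OF module_scaleC] module.subspace_scale[OF module_scaleC]
  unfolding self_adjoint_def linear_op_def by blast+

lemma dom_scaleR: "x \<in> D \<Longrightarrow> r *\<^sub>R x \<in> D"
  and op_scaleR: "x \<in> D \<Longrightarrow> A (r *\<^sub>R x) = r *\<^sub>R A x"
  using dom_scaleC[of x "of_real r"] op_scaleC[of x "of_real r"] by (simp_all add: scaleC_of_real)

lemma dom_diff: "x \<in> D \<Longrightarrow> y \<in> D \<Longrightarrow> x - y \<in> D"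
  and op_diff: "x \<in> D \<Longrightarrow> y \<in> D \<Longrightarrow> A (x - y) = A x - A y"
  using dom_add[of x "- y"] dom_scaleR[of y "-1"] op_add[of x "- y"] op_scaleR[of y "-1"] by auto

lemma op_symmetric: "x \<in> D \<Longrightarrow> u \<in> D \<Longrightarrow> cinner (A x) u = cinner x (A u)"
  using self_adj unfolding self_adjoint_def op_graph_def adjoint_graph_def by blast

lemma op_coef: "x \<in> D \<Longrightarrow> cinner (A x) (\<phi> n) = - of_real (lam n) * cinner x (\<phi> n)"
  using op_symmetric[OF _ basis_dom, of x n] cinner_scaleR_right[of x "- lam n" "\<phi> n"] by (simp add: eigen)

text \<open>Parseval turns the relation of coefficients into
  \<open>cinner (A x) u = cinner x w\<close> for all \<open>x\<close> in \<open>D\<close>, so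
  \<open>(u, w)\<close> lies in the adjoint graph. Self-adjointness, as opposed to mere symmetry,
  then places \<open>u\<close> in the domain.\<close>

lemma dom_by_coef:
  assumes "\<And>n. cinner w (\<phi> n) = - of_real (lam n) * cinner u (\<phi> n)"
  shows "u \<in> D" and "A u = w"
proof -
  have "(u, w) \<in> adjoint_graph D A"
    unfolding adjoint_graph_def
  proof (clarify)
    fix x assume x: "x \<in> D"
    have "cinner (A x) (\<phi> n) * cnj (cinner u (\<phi> n)) = cinner x (\<phi> n) * cnj (cinner w (\<phi> n))" for n
      by (simp add: op_coef[OF x] assms)
    then show "cinner (A x) u = cinner x w"
      using parseval[of "A x" u] parseval[of x w] sums_unique2 by auto
  qed
  then have "(u, w) \<in> op_graph D A" using self_adj by (simp add: self_adjoint_def)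
  then show "u \<in> D" "A u = w" by (auto simp: op_graph_def)
qed

lemma norm_le_op:
  assumes x: "x \<in> D" shows "lam 0 * norm x \<le> norm (A x)"
proof -
  have "(lam 0 * norm x)\<^sup>2 \<le> (norm (A x))\<^sup>2"
  proof (rule sums_le)
    show "(\<lambda>n. (lam 0)\<^sup>2 * (cmod (cinner x (\<phi> n)))\<^sup>2) sums (lam 0 * norm x)\<^sup>2"
      unfolding power_mult_distrib by (intro sums_mult parseval_norm)
    show "(\<lambda>n. (cmod (cinner (A x) (\<phi> n)))\<^sup>2) sums (norm (A x))\<^sup>2" by (rule parseval_norm)
    show "(lam 0)\<^sup>2 * (cmod (cinner x (\<phi> n)))\<^sup>2 \<le> (cmod (cinner (A x) (\<phi> n)))\<^sup>2" for n
      using lam_ge[of n] lam0 lam_pos[of n]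
      by (simp add: op_coef[OF x] norm_mult power_mult_distrib mult_right_mono power_mono)
  qed
  then show ?thesis by (rule power2_le_imp_le) simp
qed

text \<open>Solve coordinatewise by dividing by \<open>- lam n\<close>; the lower bound
  \<open>lam 0\<close> keeps the quotients square summable.\<close>

lemma op_surjective: "\<exists>x\<in>D. A x = w"
proof -
  define c where "c n = - cinner w (\<phi> n) / of_real (lam n)" for n
  have "summable (\<lambda>n. (cmod (c n))\<^sup>2)"
  proof (rule summable_comparison_test')
    show "summable (\<lambda>n. (1 / lam 0)\<^sup>2 * (cmod (cinner w (\<phi> n)))\<^sup>2)"
      using parseval_norm[of w] by (intro summable_mult) (auto simp: sums_iff)
    fix n
    have "cmod (c n) = 1 / lam n * cmod (cinner w (\<phi> n))"
      using lam_pos[of n] by (simp add: c_def norm_divide)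
    also have "\<dots> \<le> 1 / lam 0 * cmod (cinner w (\<phi> n))"
      using lam0 lam_ge[of n] by (intro mult_right_mono) (auto simp: frac_le)
    finally have "(cmod (c n))\<^sup>2 \<le> (1 / lam 0 * cmod (cinner w (\<phi> n)))\<^sup>2" by (intro power_mono) auto
    then show "norm ((cmod (c n))\<^sup>2) \<le> (1 / lam 0)\<^sup>2 * (cmod (cinner w (\<phi> n)))\<^sup>2"
      by (simp only: power_mult_distrib) simp
  qed
  note rf = riesz_fischer[OF this]
  have "cinner w (\<phi> n) = - of_real (lam n) * cinner (\<Sum>n. c n *\<^sub>C \<phi> n) (\<phi> n)" for n
    using lam_pos[of n] by (simp add: rf(2), simp add: c_def)
  then show ?thesis using dom_by_coef by blast
qed

text \<open>The bounded inverse of \<open>A\<close>, an isometry from H onto D(A) with its norm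
  \<parallel>A u\<parallel>. It reduces differentiability and measurability in D(A) to the same
  properties of the H-valued function \<open>A\<close> after \<open>u\<close>.\<close>

definition op_inv :: "'h \<Rightarrow> 'h" where
  "op_inv w = (SOME x. x \<in> D \<and> A x = w)"

lemma op_inv_dom: "op_inv w \<in> D" and op_op_inv: "A (op_inv w) = w"
  unfolding op_inv_def using someI_ex[of "\<lambda>x. x \<in> D \<and> A x = w"] op_surjective[of w] by auto

lemma op_inj: "x \<in> D \<Longrightarrow> y \<in> D \<Longrightarrow> A x = A y \<Longrightarrow> x = y"
  using norm_le_op[of "x - y"] lam0 by (simp add: dom_diff op_diff mult_le_0_iff)

lemma bounded_linear_op_inv: "bounded_linear op_inv"
proof (rule bounded_linear_intro[where K = "1 / lam 0"])
  show "op_inv (x + y) = op_inv x + op_inv y" for x y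
    by (rule op_inj) (simp_all add: op_inv_dom op_op_inv dom_add op_add)
  show "op_inv (r *\<^sub>R x) = r *\<^sub>R op_inv x" for r x
    by (rule op_inj) (simp_all add: op_inv_dom op_op_inv dom_scaleR op_scaleR)
  show "norm (op_inv x) \<le> norm x * (1 / lam 0)" for x
    using norm_le_op[OF op_inv_dom, of x] lam0 by (simp add: op_op_inv field_simps)
qed

end

subsection \<open>The fractional derivative on \<open>L\<^sup>2\<close>\<close>

lemma Lp_two_iff: "v \<in> Lp 2 T \<longleftrightarrow> sq_int (lebesgue_on {0<..<T}) v"
  by (simp add: Lp_def sq_int_def powr_numeral)

lemma Lp_norm_two: "Lp_norm 2 T v = sqrt (LINT t|lebesgue_on {0<..<T}. (norm (v t))\<^sup>2)"
  by (simp add: Lp_norm_def powr_numeral powr_half_sqrt)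

lemma frac_int_eq_kernel_op:
  assumes "t \<in> {0<..<T}"
  shows "frac_int \<alpha> v t = kernel_op (lebesgue_on {0<..<T}) (rl_kernel \<alpha>) v t"
proof -
  have "kernel_op (lebesgue_on {0<..<T}) (rl_kernel \<alpha>) v t
      = (LINT s|lebesgue. indicator {0<..<T} s *\<^sub>R (rl_kernel \<alpha> s t *\<^sub>R v s))"
    unfolding kernel_op_def by (subst integral_restrict_space) (auto simp: set_lebesgue_integral_def)
  also have "\<dots> = (LINT s|lebesgue. (1 / Gamma \<alpha>) *\<^sub>R (indicator {0<..<t} s *\<^sub>R ((t - s) powr (\<alpha> - 1) *\<^sub>R v s)))"
    using assms by (intro Bochner_Integration.integral_cong refl) (auto simp: rl_kernel_def split: split_indicator)
  also have "\<dots> = frac_int \<alpha> v t"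
    unfolding frac_int_def set_lebesgue_integral_def by (rule integral_scaleR_right)
  finally show ?thesis ..
qed

lemma AE_frac_int_iff:
  "(AE t in lebesgue_on {0<..<T}. w t = frac_int \<alpha> v t)
    \<longleftrightarrow> (AE t in lebesgue_on {0<..<T}. w t = kernel_op (lebesgue_on {0<..<T}) (rl_kernel \<alpha>) v t)"
  using frac_int_eq_kernel_op[of _ T \<alpha> v] by (intro AE_cong) simp

text \<open>By \<open>rl_unique\<close> the choice in \<open>frac_deriv\<close> agrees a.e. with any
  explicitly found \<open>v\<close> that represents \<open>w\<close>.\<close>

lemma frac_deriv_AE_eq:
  assumes \<alpha>: "0 < \<alpha>" "\<alpha> < 1" and T: "0 < T" and v: "sq_int (lebesgue_on {0<..<T}) v"
    and w: "AE t in lebesgue_on {0<..<T}. w t = kernel_op (lebesgue_on {0<..<T}) (rl_kernel \<alpha>) v t"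
  shows "sq_int (lebesgue_on {0<..<T}) (frac_deriv \<alpha> 2 T w)"
    and "AE t in lebesgue_on {0<..<T}. frac_deriv \<alpha> 2 T w t = v t"
proof -
  have "frac_deriv \<alpha> 2 T w \<in> Lp 2 T \<and> (AE t in lebesgue_on {0<..<T}. w t = frac_int \<alpha> (frac_deriv \<alpha> 2 T w) t)"
    unfolding frac_deriv_def
    by (rule someI_ex[of "\<lambda>v. v \<in> Lp 2 T \<and> (AE t in lebesgue_on {0<..<T}. w t = frac_int \<alpha> v t)"])
       (use v w in \<open>auto simp: Lp_two_iff AE_frac_int_iff\<close>)
  then have d: "sq_int (lebesgue_on {0<..<T}) (frac_deriv \<alpha> 2 T w)"
    and wd: "AE t in lebesgue_on {0<..<T}. w t = kernel_op (lebesgue_on {0<..<T}) (rl_kernel \<alpha>) (frac_deriv \<alpha> 2 T w) t"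
    by (simp_all add: Lp_two_iff AE_frac_int_iff)
  show "sq_int (lebesgue_on {0<..<T}) (frac_deriv \<alpha> 2 T w)" by fact
  show "AE t in lebesgue_on {0<..<T}. frac_deriv \<alpha> 2 T w t = v t"
  proof (rule rl_unique[OF \<alpha> T d v])
    show "AE t in lebesgue_on {0<..<T}. kernel_op (lebesgue_on {0<..<T}) (rl_kernel \<alpha>) (frac_deriv \<alpha> 2 T w) t
        = kernel_op (lebesgue_on {0<..<T}) (rl_kernel \<alpha>) v t"
      using w wd by eventually_elim simp
  qed
qed

lemma frac_deriv_adj_AE_eq:
  assumes \<alpha>: "0 < \<alpha>" "\<alpha> < 1" and T: "0 < T" and v: "sq_int (lebesgue_on {0<..<T}) v"
    and w: "AE t in lebesgue_on {0<..<T}. w t = kernel_op (lebesgue_on {0<..<T}) (\<lambda>s t. rl_kernel \<alpha> t s) v t"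
  shows "sq_int (lebesgue_on {0<..<T}) (frac_deriv_adj \<alpha> 2 T w)"
    and "AE t in lebesgue_on {0<..<T}. frac_deriv_adj \<alpha> 2 T w t = v t"
proof -
  let ?M = "lebesgue_on {0<..<T}"
  have rv: "sq_int ?M (\<lambda>t. v (T - t))" by (rule sq_int_reflect[OF v])
  have rw: "AE t in ?M. time_reflect T w t = kernel_op ?M (rl_kernel \<alpha>) (\<lambda>t. v (T - t)) t"
    using AE_reflect[OF w]
  proof eventually_elim
    case (elim t)
    then show ?case
      using kernel_op_reflect[OF sq_int_measurable[OF rv], of \<alpha> "T - t"] by (simp add: time_reflect_def)
  qed
  note fd = frac_deriv_AE_eq[OF \<alpha> T rv, where w = "time_reflect T w", OF rw]
  show "sq_int ?M (frac_deriv_adj \<alpha> 2 T w)"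
    using sq_int_reflect[OF fd(1)] by (simp add: frac_deriv_adj_def time_reflect_def[abs_def])
  show "AE t in ?M. frac_deriv_adj \<alpha> 2 T w t = v t"
    using AE_reflect[OF fd(2)] by eventually_elim (simp add: frac_deriv_adj_def time_reflect_def)
qed

lemma has_vector_derivative_quotient:
  fixes f :: "real \<Rightarrow> 'a::real_normed_vector"
  assumes "((\<lambda>s. norm ((1 / (s - t)) *\<^sub>R (f s - f t) - f')) \<longlongrightarrow> 0) (at t within S)"
  shows "(f has_vector_derivative f') (at t within S)"
  unfolding has_vector_derivative_def has_derivative_iff_norm
proof
  show "bounded_linear (\<lambda>x. x *\<^sub>R f')" by (rule bounded_linear_scaleR_left)
  have "\<forall>\<^sub>F s in at t within S. norm ((1 / (s - t)) *\<^sub>R (f s - f t) - f') = norm (f s - f t - (s - t) *\<^sub>R f') / norm (s - t)"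
    using eventually_neq_at_within[of t t S]
  proof eventually_elim
    case (elim s)
    then have "(1 / (s - t)) *\<^sub>R (f s - f t) - f' = (1 / (s - t)) *\<^sub>R (f s - f t - (s - t) *\<^sub>R f')"
      by (simp add: scaleR_right_diff_distrib)
    then show ?case by (simp add: divide_inverse mult.commute)
  qed
  then show "((\<lambda>s. norm (f s - f t - (s - t) *\<^sub>R f') / norm (s - t)) \<longlongrightarrow> 0) (at t within S)"
    using assms by (rule Lim_transform_eventually[rotated])
qed

section \<open>The problem in H: test functions, weak and strong solutions, uniqueness and
  existence\<close>

locale fractional_problem = diagonal_operator \<phi> D A lam
  for \<phi> :: "nat \<Rightarrow> 'h::{chilbert_space, second_countable_topology}" and D A lam +
  fixes \<alpha> T :: real
  assumes \<alpha>: "0 < \<alpha>" "\<alpha> < 1" and T: "0 < T"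
begin

abbreviation M :: "real measure" where "M \<equiv> lebesgue_on {0<..<T}"

abbreviation J :: "real \<Rightarrow> (real \<Rightarrow> 'b::{banach, second_countable_topology}) \<Rightarrow> real \<Rightarrow> 'b" where
  "J b \<equiv> kernel_op M (rl_kernel b)"

abbreviation J_adj :: "real \<Rightarrow> (real \<Rightarrow> 'b::{banach, second_countable_topology}) \<Rightarrow> real \<Rightarrow> 'b" where
  "J_adj b \<equiv> kernel_op M (\<lambda>s t. rl_kernel b t s)"

lemma schur_J: "0 < b \<Longrightarrow> schur_kernel M (rl_kernel b) (T powr b / b / Gamma b)"
  using schur_rl_kernel[OF _ T] .

lemma schur_J_adj: "0 < b \<Longrightarrow> schur_kernel M (\<lambda>s t. rl_kernel b t s) (T powr b / b / Gamma b)"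
  using schur_kernel.transpose[OF schur_J] .

lemma J_comp:
  assumes "0 < a" "0 < b" "sq_int M v"
  shows "AE t in M. J b (J a v) t = J (a + b) v t"
  using assms rl_kernel_comp[of a b]
  by (intro kernel_op_comp[OF schur_J schur_J]) (auto simp: rl_kernel_nonneg)

lemma J_adj_comp:
  assumes "0 < a" "0 < b" "sq_int M v"
  shows "AE t in M. J_adj b (J_adj a v) t = J_adj (a + b) v t"
  using assms rl_kernel_comp[of b a]
  by (intro kernel_op_comp[OF schur_J_adj schur_J_adj]) (auto simp: rl_kernel_nonneg mult.commute add.commute)

lemma sq_int_coef: "sq_int M v \<Longrightarrow> sq_int M (\<lambda>t. cinner (v t) y)"
  using sq_int_bounded_linear[OF bounded_bilinear.bounded_linear_left[OF bounded_bilinear_cinner]] .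

text \<open>The fundamental theorem of calculus in each coordinate; the countably many exceptional
  null sets are united before the coordinates are reassembled. The end condition removes the
  boundary term at T.\<close>

lemma J_adj_one:
  fixes \<psi> \<psi>' :: "real \<Rightarrow> 'h"
  assumes der: "\<And>t. t \<in> {0..T} \<Longrightarrow> (\<psi> has_vector_derivative \<psi>' t) (at t within {0..T})"
    and cont: "continuous_on {0..T} \<psi>'" and end0: "\<psi> T = 0"
  shows "AE t in M. \<psi> t = J_adj 1 (\<lambda>t. - \<psi>' t) t"
proof -
  have sq: "sq_int M (\<lambda>t. - \<psi>' t)" by (intro continuous_on_imp_sq_int continuous_intros cont)
  have lin: "bounded_linear (\<lambda>x :: 'h. cinner x (\<phi> n))" for n
    by (rule bounded_bilinear.bounded_linear_left[OF bounded_bilinear_cinner])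
  have "AE t in M. \<forall>n. J_adj 1 (\<lambda>t. cinner (- \<psi>' t) (\<phi> n)) t = cinner (J_adj 1 (\<lambda>t. - \<psi>' t) t) (\<phi> n)"
    unfolding AE_all_countable
    by (intro allI schur_kernel.kernel_op_bounded_linear[OF schur_J_adj lin sq]) simp
  with AE_space show ?thesis
  proof eventually_elim
    case (elim t)
    have "J_adj 1 (\<lambda>t. cinner (- \<psi>' t) (\<phi> n)) t = cinner (- \<psi> T) (\<phi> n) - cinner (- \<psi> t) (\<phi> n)" for n
    proof (rule kernel_op_rl_one_FTC)
      show "((\<lambda>t. cinner (- \<psi> t) (\<phi> n)) has_vector_derivative cinner (- \<psi>' s) (\<phi> n)) (at s within {0..T})"
        if "s \<in> {0..T}" for s
        by (intro bounded_linear.has_vector_derivative[OF lin] has_vector_derivative_minus der that)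
      show "continuous_on {0..T} (\<lambda>t. cinner (- \<psi>' t) (\<phi> n))"
        by (intro bounded_linear.continuous_on[OF lin] continuous_intros cont)
    qed (use elim in auto)
    then show ?case
      using elim by (intro basis_eqI) (simp add: end0 cinner_minus_left cinner_zero_left)
  qed
qed

text \<open>Splitting order 1 as (1 - \<alpha>) + \<alpha> identifies (\<partial>^\<alpha>)' \<psi>
  as the adjoint of J^(1-\<alpha>) applied to -\<psi>'.\<close>

lemma J_adj_repr:
  fixes \<psi> \<psi>' :: "real \<Rightarrow> 'h"
  assumes der: "\<And>t. t \<in> {0..T} \<Longrightarrow> (\<psi> has_vector_derivative \<psi>' t) (at t within {0..T})"
    and cont: "continuous_on {0..T} \<psi>'" and end0: "\<psi> T = 0"
  shows "AE t in M. \<psi> t = J_adj \<alpha> (J_adj (1 - \<alpha>) (\<lambda>t. - \<psi>' t)) t"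
proof -
  have sq: "sq_int M (\<lambda>t. - \<psi>' t)" by (intro continuous_on_imp_sq_int continuous_intros cont)
  have "AE t in M. J_adj \<alpha> (J_adj (1 - \<alpha>) (\<lambda>t. - \<psi>' t)) t = J_adj 1 (\<lambda>t. - \<psi>' t) t"
    using J_adj_comp[OF _ _ sq, of "1 - \<alpha>" \<alpha>] \<alpha> by simp
  moreover have "AE t in M. \<psi> t = J_adj 1 (\<lambda>t. - \<psi>' t) t"
    by (rule J_adj_one) (use assms in auto)
  ultimately show ?thesis by eventually_elim simp
qed

text \<open>Difference quotients that converge in the norm of D(A) are an ordinary derivative of
  \<open>A\<close> after \<open>g k\<close>. Composing with the bounded inverse gives the derivative
  of \<open>g k\<close> in H.\<close>

lemma test_function_regular:
  assumes "\<psi> \<in> test_functions D A T"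
  obtains \<psi>' where "\<And>t. t \<in> {0..T} \<Longrightarrow> (\<psi> has_vector_derivative \<psi>' t) (at t within {0..T})"
    "continuous_on {0..T} \<psi>'" "\<psi> T = 0" "continuous_on {0..T} \<psi>" "continuous_on {0..T} (\<lambda>t. A (\<psi> t))"
    "\<And>t. t \<in> {0..T} \<Longrightarrow> \<psi> t \<in> D"
proof -
  obtain g where g0: "\<And>t. t \<in> {0..T} \<Longrightarrow> g 0 t = \<psi> t" and gD: "\<And>k t. t \<in> {0..T} \<Longrightarrow> g k t \<in> D"
    and lim: "\<And>k t. t \<in> {0..T} \<Longrightarrow>
        ((\<lambda>s. norm (A ((1 / (s - t)) *\<^sub>R (g k s - g k t) - g (Suc k) t))) \<longlongrightarrow> 0) (at t within {0..T})"
    and end0: "\<psi> T = 0"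
    using assms unfolding test_functions_def smooth_dom_def by blast
  have derA: "((\<lambda>t. A (g k t)) has_vector_derivative A (g (Suc k) t)) (at t within {0..T})" if t: "t \<in> {0..T}" for k t
  proof (rule has_vector_derivative_quotient)
    have "\<forall>\<^sub>F s in at t within {0..T}. s \<in> {0..T}" by (simp add: eventually_at_filter)
    then have "\<forall>\<^sub>F s in at t within {0..T}. norm (A ((1 / (s - t)) *\<^sub>R (g k s - g k t) - g (Suc k) t))
        = norm ((1 / (s - t)) *\<^sub>R (A (g k s) - A (g k t)) - A (g (Suc k) t))"
    proof eventually_elim
      case (elim s)
      note D = gD[OF elim, of k] gD[OF t, of k] gD[OF t, of "Suc k"]
      show ?case
        by (simp only: op_diff[OF dom_scaleR[OF dom_diff[OF D(1,2)]] D(3)] op_scaleR[OF dom_diff[OF D(1,2)]] op_diff[OF D(1,2)])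
    qed
    then show "((\<lambda>s. norm ((1 / (s - t)) *\<^sub>R (A (g k s) - A (g k t)) - A (g (Suc k) t))) \<longlongrightarrow> 0) (at t within {0..T})"
      using lim[OF t] by (rule Lim_transform_eventually[rotated])
  qed
  have inv: "g k t = op_inv (A (g k t))" if "t \<in> {0..T}" for k t
    by (rule op_inj[OF gD[OF that] op_inv_dom]) (simp add: op_op_inv)
  have der: "(g k has_vector_derivative g (Suc k) t) (at t within {0..T})" if t: "t \<in> {0..T}" for k t
  proof (rule has_vector_derivative_transform[OF t])
    show "((\<lambda>t. op_inv (A (g k t))) has_vector_derivative g (Suc k) t) (at t within {0..T})"
      using bounded_linear.has_vector_derivative[OF bounded_linear_op_inv derA[OF t, of k]] inv[OF t, of "Suc k"] by simp
  qed (use inv in auto)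
  have contg: "continuous_on {0..T} (g k)" for k
    unfolding continuous_on_eq_continuous_within using der has_vector_derivative_continuous by blast
  have contA: "continuous_on {0..T} (\<lambda>t. A (g k t))" for k
    unfolding continuous_on_eq_continuous_within using derA has_vector_derivative_continuous by blast
  show thesis
  proof (rule that)
    show "(\<psi> has_vector_derivative g 1 t) (at t within {0..T})" if "t \<in> {0..T}" for t
      using has_vector_derivative_transform[OF that _ der[OF that, of 0]] g0 by simp
    show "continuous_on {0..T} \<psi>" by (rule continuous_on_eq[OF contg[of 0]]) (rule g0)
    show "continuous_on {0..T} (\<lambda>t. A (\<psi> t))" by (rule continuous_on_eq[OF contA[of 0]]) (simp add: g0)
    show "\<psi> t \<in> D" if "t \<in> {0..T}" for t using gD[OF that, of 0] g0[OF that] by simp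
  qed (fact contg end0)+
qed

lemma test_function_frac_deriv_adj:
  assumes "\<psi> \<in> test_functions D A T"
  obtains \<eta> where "sq_int M \<eta>" "AE t in M. \<psi> t = J_adj \<alpha> \<eta> t"
    "sq_int M (frac_deriv_adj \<alpha> 2 T \<psi>)" "AE t in M. frac_deriv_adj \<alpha> 2 T \<psi> t = \<eta> t"
proof -
  obtain \<psi>' where reg: "\<And>t. t \<in> {0..T} \<Longrightarrow> (\<psi> has_vector_derivative \<psi>' t) (at t within {0..T})"
    "continuous_on {0..T} \<psi>'" "\<psi> T = 0"
    using test_function_regular[OF assms] by blast
  have "sq_int M (\<lambda>t. - \<psi>' t)" by (intro continuous_on_imp_sq_int continuous_intros reg(2))
  then have sq: "sq_int M (J_adj (1 - \<alpha>) (\<lambda>t. - \<psi>' t))"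
    using \<alpha> by (intro schur_kernel.sq_int_kernel_op[OF schur_J_adj]) auto
  have repr: "AE t in M. \<psi> t = J_adj \<alpha> (J_adj (1 - \<alpha>) (\<lambda>t. - \<psi>' t)) t"
    by (rule J_adj_repr) (use reg in auto)
  show thesis
    using that[OF sq repr frac_deriv_adj_AE_eq[OF \<alpha> T sq repr]] .
qed

lemma test_function_sq_int:
  assumes "\<psi> \<in> test_functions D A T"
  shows "sq_int M \<psi>" and "sq_int M (\<lambda>t. A (\<psi> t))" and "AE t in M. \<psi> t \<in> D"
proof -
  obtain \<psi>' where reg: "continuous_on {0..T} \<psi>" "continuous_on {0..T} (\<lambda>t. A (\<psi> t))"
    "\<And>t. t \<in> {0..T} \<Longrightarrow> \<psi> t \<in> D"
    using test_function_regular[OF assms] by blast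
  then show "sq_int M \<psi>" "sq_int M (\<lambda>t. A (\<psi> t))" by (auto intro: continuous_on_imp_sq_int)
  show "AE t in M. \<psi> t \<in> D" using AE_space by eventually_elim (use reg(3) in auto)
qed

lemma weak_solution_integrable:
  assumes "\<psi> \<in> test_functions D A T" and "sq_int M u"
  shows "integrable M (\<lambda>t. cinner (u t) (frac_deriv_adj \<alpha> 2 T \<psi> t + \<i> *\<^sub>C A (\<psi> t)))"
proof -
  obtain \<eta> where "sq_int M (frac_deriv_adj \<alpha> 2 T \<psi>)"
    using test_function_frac_deriv_adj[OF assms(1)] by blast
  then have "sq_int M (\<lambda>t. frac_deriv_adj \<alpha> 2 T \<psi> t + \<i> *\<^sub>C A (\<psi> t))"
    by (intro sq_int_add sq_int_bounded_linear[OF bounded_linear_scaleC] test_function_sq_int(2)[OF assms(1)])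
  then show ?thesis by (rule integrable_bilinear_sq_int[OF bounded_bilinear_cinner assms(2)])
qed

text \<open>Both operators pass to the other side: \<open>A\<close> by symmetry, J^\<alpha> by
  adjointness. The first yields the pairing of f - v with \<psi>, the second that of v with \<psi>,
  so the contributions of v cancel.\<close>

lemma weak_solution_of_strong:
  assumes f: "sq_int M f" and v: "sq_int M v" and u: "sq_int M u"
    and uJ: "AE t in M. u t = J \<alpha> v t" and uD: "\<And>t. u t \<in> D" and eq: "\<And>t. A (u t) = \<i> *\<^sub>C (f t - v t)"
  shows "weak_solution D A \<alpha> 2 T f u"
proof -
  have "(LINT t|M. cinner (u t) (frac_deriv_adj \<alpha> 2 T \<psi> t + \<i> *\<^sub>C A (\<psi> t))) = (LINT t|M. cinner (f t) (\<psi> t))"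
    if \<psi>: "\<psi> \<in> test_functions D A T" for \<psi>
  proof -
    obtain \<eta> where \<eta>: "sq_int M \<eta>" "AE t in M. \<psi> t = J_adj \<alpha> \<eta> t" "sq_int M (frac_deriv_adj \<alpha> 2 T \<psi>)"
        "AE t in M. frac_deriv_adj \<alpha> 2 T \<psi> t = \<eta> t"
      using test_function_frac_deriv_adj[OF \<psi>] by blast
    note tf = test_function_sq_int[OF \<psi>]
    interpret k: schur_kernel M "rl_kernel \<alpha>" "T powr \<alpha> / \<alpha> / Gamma \<alpha>" using \<alpha>(1) by (rule schur_J)
    interpret kt: schur_kernel M "\<lambda>s t. rl_kernel \<alpha> t s" "T powr \<alpha> / \<alpha> / Gamma \<alpha>" using \<alpha>(1) by (rule schur_J_adj)
    note int = integrable_bilinear_sq_int[OF bounded_bilinear_cinner, where M = M]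
    have "(LINT t|M. cinner (u t) (frac_deriv_adj \<alpha> 2 T \<psi> t + \<i> *\<^sub>C A (\<psi> t)))
        = (LINT t|M. cinner (J \<alpha> v t) (\<eta> t) + (cinner (f t) (\<psi> t) - cinner (v t) (\<psi> t)))"
    proof (intro integral_cong_AE)
      show "(\<lambda>t. cinner (u t) (frac_deriv_adj \<alpha> 2 T \<psi> t + \<i> *\<^sub>C A (\<psi> t))) \<in> borel_measurable M"
        using weak_solution_integrable[OF \<psi> u] by (rule borel_measurable_integrable)
      show "(\<lambda>t. cinner (J \<alpha> v t) (\<eta> t) + (cinner (f t) (\<psi> t) - cinner (v t) (\<psi> t))) \<in> borel_measurable M"
        by (intro borel_measurable_add borel_measurable_diff borel_measurable_integrable int k.sq_int_kernel_op v f tf \<eta>(1))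
      show "AE t in M. cinner (u t) (frac_deriv_adj \<alpha> 2 T \<psi> t + \<i> *\<^sub>C A (\<psi> t))
          = cinner (J \<alpha> v t) (\<eta> t) + (cinner (f t) (\<psi> t) - cinner (v t) (\<psi> t))"
        using uJ \<eta>(4) tf(3)
      proof eventually_elim
        case (elim t)
        \<comment> \<open>The inner product is conjugate linear in its second argument, which turns
          \<i> into -\<i>; with A u = \<i> (f - v) the product of the units is 1.\<close>
        have "cinner (u t) (\<i> *\<^sub>C A (\<psi> t)) = - \<i> * cinner (A (u t)) (\<psi> t)"
          using op_symmetric[OF uD elim(3), of t] by (simp add: cinner_scaleC_right)
        also have "\<dots> = cinner (f t) (\<psi> t) - cinner (v t) (\<psi> t)"
          by (simp add: eq cinner_scaleC_left cinner_diff_left flip: mult.assoc)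
        finally show ?case using elim by (simp add: cinner_add_right)
      qed
    qed
    also have "\<dots> = (LINT t|M. cinner (J \<alpha> v t) (\<eta> t)) + ((LINT t|M. cinner (f t) (\<psi> t)) - (LINT t|M. cinner (v t) (\<psi> t)))"
    proof -
      have "integrable M (\<lambda>t. cinner (J \<alpha> v t) (\<eta> t))" "integrable M (\<lambda>t. cinner (f t) (\<psi> t))"
          "integrable M (\<lambda>t. cinner (v t) (\<psi> t))"
        by (intro int k.sq_int_kernel_op v f tf \<eta>(1))+
      then show ?thesis by simp
    qed
    also have "(LINT t|M. cinner (J \<alpha> v t) (\<eta> t)) = (LINT t|M. cinner (v t) (J_adj \<alpha> \<eta> t))"
      by (rule k.kernel_op_adjoint[OF v \<eta>(1) bounded_bilinear_cinner])
    also have "\<dots> = (LINT t|M. cinner (v t) (\<psi> t))"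
      by (intro integral_cong_AE borel_measurable_integrable int kt.sq_int_kernel_op v tf \<eta>(1))
         (use \<eta>(2) in \<open>eventually_elim, simp\<close>)
    finally show ?thesis by simp
  qed
  then show ?thesis using u by (simp add: weak_solution_def Lp_two_iff)
qed

text \<open>Divided by k + 1 so that the derivative is exactly -t^k times the basis vector and the
  test produces the k-th moment. Being polynomial in t, all higher derivatives are available through
  \<open>pderiv\<close>.\<close>

lemma power_test_function:
  "(\<lambda>t. ((T ^ Suc k - t ^ Suc k) / real (Suc k)) *\<^sub>R \<phi> n) \<in> test_functions D A T"
proof -
  define q where "q = smult (1 / real (Suc k)) ([:T ^ Suc k:] - monom 1 (Suc k))"
  define g where "g j t = poly ((pderiv ^^ j) q) t *\<^sub>R \<phi> n" for j t
  have g0: "g 0 t = ((T ^ Suc k - t ^ Suc k) / real (Suc k)) *\<^sub>R \<phi> n" for t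
    by (simp add: g_def q_def poly_monom del: power_Suc of_nat_Suc)
  have "((\<lambda>s. norm (A ((1 / (s - t)) *\<^sub>R (g j s - g j t) - g (Suc j) t))) \<longlongrightarrow> 0) (at t within {0..T})" for j t
  proof -
    let ?p = "(pderiv ^^ j) q"
    have "A ((1 / (s - t)) *\<^sub>R (g j s - g j t) - g (Suc j) t)
        = ((poly ?p s - poly ?p t) / (s - t) - poly (pderiv ?p) t) *\<^sub>R A (\<phi> n)" for s
    proof -
      have "(1 / (s - t)) *\<^sub>R (g j s - g j t) - g (Suc j) t
          = ((poly ?p s - poly ?p t) / (s - t) - poly (pderiv ?p) t) *\<^sub>R \<phi> n"
        by (simp add: g_def scaleR_left_diff_distrib flip: scaleR_left_diff_distrib)
      then show ?thesis by (simp add: op_scaleR basis_dom)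
    qed
    moreover have "((\<lambda>s. (poly ?p s - poly ?p t) / (s - t)) \<longlongrightarrow> poly (pderiv ?p) t) (at t within {0..T})"
      using has_field_derivative_at_within[OF poly_DERIV[of ?p t]] by (simp add: has_field_derivative_iff)
    then have "((\<lambda>s. norm (((poly ?p s - poly ?p t) / (s - t) - poly (pderiv ?p) t) *\<^sub>R A (\<phi> n)))
        \<longlongrightarrow> norm ((poly (pderiv ?p) t - poly (pderiv ?p) t) *\<^sub>R A (\<phi> n))) (at t within {0..T})"
      by (intro tendsto_intros)
    ultimately show ?thesis by simp
  qed
  then show ?thesis
    unfolding test_functions_def smooth_dom_def
    using g0 by (auto intro!: exI[of _ g] simp: g_def dom_scaleR basis_dom)
qed

text \<open>Once the moments vanish, injectivity of J^(1-\<alpha>) strips off the outer operator,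
  and the a priori bound with right-hand side 0 kills the coordinate of the difference. The null
  sets of all coordinates are then united.\<close>

lemma weak_solution_unique:
  assumes u: "weak_solution D A \<alpha> 2 T f u" and w: "weak_solution D A \<alpha> 2 T f w"
  shows "AE t in M. u t = w t"
proof -
  have sq: "sq_int M u" "sq_int M w"
    using u w by (simp_all add: weak_solution_def Lp_two_iff)
  define d where "d t = u t + - w t" for t
  have d: "sq_int M d" unfolding d_def using sq(2)
    by (intro sq_int_add sq(1)) (simp add: sq_int_def)
  have weak: "(LINT t|M. cinner (d t) (frac_deriv_adj \<alpha> 2 T \<psi> t + \<i> *\<^sub>C A (\<psi> t))) = 0"
    if \<psi>: "\<psi> \<in> test_functions D A T" for \<psi>
  proof -
    have "(LINT t|M. cinner (d t) (frac_deriv_adj \<alpha> 2 T \<psi> t + \<i> *\<^sub>C A (\<psi> t)))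
      = (LINT t|M. cinner (u t) (frac_deriv_adj \<alpha> 2 T \<psi> t + \<i> *\<^sub>C A (\<psi> t)))
      - (LINT t|M. cinner (w t) (frac_deriv_adj \<alpha> 2 T \<psi> t + \<i> *\<^sub>C A (\<psi> t)))"
      unfolding d_def by (subst Bochner_Integration.integral_diff[symmetric])
        (auto intro: weak_solution_integrable \<psi> sq simp: cinner_diff_left)
    then show ?thesis using u w \<psi> by (simp add: weak_solution_def)
  qed
  have "AE t in M. cinner (d t) (\<phi> n) = 0" for n
  proof -
    define dn where "dn t = cinner (d t) (\<phi> n)" for t
    have dn: "sq_int M dn" unfolding dn_def by (rule sq_int_coef[OF d])
    define c where "c = \<i> * of_real (lam n)"
    have b: "0 < 1 - \<alpha>" using \<alpha> by simp
    interpret k1: schur_kernel M "rl_kernel 1" "T powr 1 / 1 / Gamma 1" by (rule schur_J) simp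
    interpret k1t: schur_kernel M "\<lambda>s t. rl_kernel 1 t s" "T powr 1 / 1 / Gamma 1" by (rule schur_J_adj) simp
    interpret kb: schur_kernel M "rl_kernel (1 - \<alpha>)" "T powr (1 - \<alpha>) / (1 - \<alpha>) / Gamma (1 - \<alpha>)" by (rule schur_J[OF b])
    interpret kbt: schur_kernel M "\<lambda>s t. rl_kernel (1 - \<alpha>) t s" "T powr (1 - \<alpha>) / (1 - \<alpha>) / Gamma (1 - \<alpha>)" by (rule schur_J_adj[OF b])
    interpret ka: schur_kernel M "rl_kernel \<alpha>" "T powr \<alpha> / \<alpha> / Gamma \<alpha>" using \<alpha>(1) by (rule schur_J)
    have B: "bounded_bilinear (\<lambda>(a :: complex) r. r *\<^sub>R a)"
      using bounded_bilinear.flip[OF bounded_bilinear_scaleR] .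
    note int = integrable_bilinear_sq_int[OF B, where M = M]
    \<comment> \<open>This is J^(1-\<alpha>) applied to the scalar equation for \<open>dn\<close>;
      composing with J^\<alpha> gives the order 1 in the second term.\<close>
    define E where "E t = J (1 - \<alpha>) dn t + c * J 1 dn t" for t
    have cJ: "sq_int M (\<lambda>t. c * J 1 dn t)"
      by (intro sq_int_bounded_linear[OF bounded_linear_mult_right] k1.sq_int_kernel_op dn)
    have E: "sq_int M E"
      unfolding E_def by (intro sq_int_add kb.sq_int_kernel_op dn cJ)
    have zeroE: "AE t in M. E t = 0"
    proof (rule AE_zero_if_moments_zero)
      show "integrable M E"
        by (rule sq_int_integrable[OF _ E]) (rule finite_measure_lebesgue_on, auto)
      fix k
      define p where "p t = t ^ k" for t :: real
      define \<psi> where "\<psi> t = ((T ^ Suc k - t ^ Suc k) / real (Suc k)) *\<^sub>R \<phi> n" for t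
      have \<psi>: "\<psi> \<in> test_functions D A T" unfolding \<psi>_def by (rule power_test_function)
      have p: "sq_int M p" unfolding p_def by (intro continuous_on_imp_sq_int continuous_intros)
      have der: "(\<psi> has_vector_derivative - (p t *\<^sub>R \<phi> n)) (at t within {0..T})" for t
      proof -
        have "((\<lambda>t. (T ^ Suc k - t ^ Suc k) / real (Suc k)) has_real_derivative - (real (Suc k) * t ^ k) / real (Suc k)) (at t within {0..T})"
          by (auto intro!: derivative_eq_intros simp del: power_Suc of_nat_Suc)
        then have "((\<lambda>t. (T ^ Suc k - t ^ Suc k) / real (Suc k)) has_vector_derivative - p t) (at t within {0..T})"
          by (simp add: p_def has_real_derivative_iff_has_vector_derivative del: of_nat_Suc power_Suc)
        from bounded_linear.has_vector_derivative[OF bounded_linear_scaleR_left this, of "\<phi> n"]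
        show ?thesis by (simp add: \<psi>_def[abs_def] del: of_nat_Suc power_Suc)
      qed
      have cont: "continuous_on {0..T} (\<lambda>t. - (p t *\<^sub>R \<phi> n))"
        unfolding p_def by (intro continuous_intros)
      have pn: "sq_int M (\<lambda>t. p t *\<^sub>R \<phi> n)"
        using sq_int_bounded_linear[OF bounded_linear_scaleR_left p] .
      have repr: "AE t in M. \<psi> t = J_adj \<alpha> (J_adj (1 - \<alpha>) (\<lambda>t. p t *\<^sub>R \<phi> n)) t"
        using J_adj_repr[OF der cont] by (simp add: \<psi>_def)
      note fda = frac_deriv_adj_AE_eq[OF \<alpha> T kbt.sq_int_kernel_op[OF pn] repr]
      \<comment> \<open>The scalar factor of \<psi> is itself the adjoint of J^1 applied to
        \<open>p\<close>, so both terms of the weak equation have operators acting on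
        \<open>p\<close> that can be moved to \<open>dn\<close>.\<close>
      have \<psi>J: "(T ^ Suc k - t ^ Suc k) / real (Suc k) = J_adj 1 p t" if "t \<in> {0<..<T}" for t
      proof -
        have "J_adj 1 p t = T ^ Suc k / real (Suc k) - t ^ Suc k / real (Suc k)"
        proof (rule kernel_op_rl_one_FTC[OF _ _ that])
          fix s
          have "((\<lambda>t. t ^ Suc k / real (Suc k)) has_real_derivative (real (Suc k) * s ^ k) / real (Suc k)) (at s within {0..T})"
            by (auto intro!: derivative_eq_intros simp del: power_Suc of_nat_Suc)
          then show "((\<lambda>t. t ^ Suc k / real (Suc k)) has_vector_derivative p s) (at s within {0..T})"
            by (simp add: p_def has_real_derivative_iff_has_vector_derivative del: of_nat_Suc power_Suc)
        qed (auto simp: p_def intro!: continuous_intros)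
        then show ?thesis by (simp only: diff_divide_distrib)
      qed
      have "0 = (LINT t|M. cinner (d t) (frac_deriv_adj \<alpha> 2 T \<psi> t + \<i> *\<^sub>C A (\<psi> t)))"
        using weak[OF \<psi>] by simp
      also have "\<dots> = (LINT t|M. J_adj (1 - \<alpha>) p t *\<^sub>R dn t + c * (J_adj 1 p t *\<^sub>R dn t))"
      proof (intro integral_cong_AE)
        show "(\<lambda>t. cinner (d t) (frac_deriv_adj \<alpha> 2 T \<psi> t + \<i> *\<^sub>C A (\<psi> t))) \<in> borel_measurable M"
          using weak_solution_integrable[OF \<psi> d] by (rule borel_measurable_integrable)
        show "(\<lambda>t. J_adj (1 - \<alpha>) p t *\<^sub>R dn t + c * (J_adj 1 p t *\<^sub>R dn t)) \<in> borel_measurable M"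
          by (intro borel_measurable_integrable Bochner_Integration.integrable_add integrable_mult_right int
              kbt.sq_int_kernel_op k1t.sq_int_kernel_op p dn)
        show "AE t in M. cinner (d t) (frac_deriv_adj \<alpha> 2 T \<psi> t + \<i> *\<^sub>C A (\<psi> t))
            = J_adj (1 - \<alpha>) p t *\<^sub>R dn t + c * (J_adj 1 p t *\<^sub>R dn t)"
          using fda(2) kbt.kernel_op_bounded_linear[OF bounded_linear_scaleR_left p, of "\<phi> n"] AE_space
        proof eventually_elim
          case (elim t)
          have "\<psi> t = J_adj 1 p t *\<^sub>R \<phi> n" using \<psi>J elim(3) by (simp add: \<psi>_def)
          then have "A (\<psi> t) = (- lam n * J_adj 1 p t) *\<^sub>R \<phi> n"
            by (simp add: op_scaleR basis_dom eigen mult.commute)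
          then have "cinner (d t) (A (\<psi> t)) = of_real (- lam n * J_adj 1 p t) * dn t"
            by (simp only: cinner_scaleR_right dn_def)
          then show ?case
            using elim(1,2) by (simp add: cinner_add_right cinner_scaleC_right cinner_scaleR_right c_def
                scaleR_conv_of_real mult_ac flip: dn_def)
        qed
      qed
      also have "\<dots> = (LINT t|M. J_adj (1 - \<alpha>) p t *\<^sub>R dn t) + c * (LINT t|M. J_adj 1 p t *\<^sub>R dn t)"
        by (subst Bochner_Integration.integral_add)
           (auto intro!: integrable_mult_right int kbt.sq_int_kernel_op k1t.sq_int_kernel_op p dn simp only: integral_mult_right_zero)
      also have "(LINT t|M. J_adj (1 - \<alpha>) p t *\<^sub>R dn t) = (LINT t|M. p t *\<^sub>R J (1 - \<alpha>) dn t)"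
        by (rule kb.kernel_op_adjoint[OF dn p B, symmetric])
      also have "(LINT t|M. J_adj 1 p t *\<^sub>R dn t) = (LINT t|M. p t *\<^sub>R J 1 dn t)"
        by (rule k1.kernel_op_adjoint[OF dn p B, symmetric])
      also have "(LINT t|M. p t *\<^sub>R J (1 - \<alpha>) dn t) + c * (LINT t|M. p t *\<^sub>R J 1 dn t) = (LINT t|M. p t *\<^sub>R E t)"
      proof -
        have "(LINT t|M. p t *\<^sub>R E t) = (LINT t|M. p t *\<^sub>R J (1 - \<alpha>) dn t + c * (p t *\<^sub>R J 1 dn t))"
          by (simp add: E_def scaleR_right_distrib)
        also have "\<dots> = (LINT t|M. p t *\<^sub>R J (1 - \<alpha>) dn t) + (LINT t|M. c * (p t *\<^sub>R J 1 dn t))"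
          by (intro Bochner_Integration.integral_add integrable_mult_right int kb.sq_int_kernel_op k1.sq_int_kernel_op p dn)
        finally show ?thesis by (simp only: integral_mult_right_zero)
      qed
      finally show "(LINT t|M. t ^ k *\<^sub>R E t) = 0" by (simp add: p_def)
    qed
    have Ja: "sq_int M (\<lambda>t. c * J \<alpha> dn t)"
      by (intro sq_int_bounded_linear[OF bounded_linear_mult_right] ka.sq_int_kernel_op dn)
    have J0: "AE t in M. J (1 - \<alpha>) (\<lambda>t. dn t + c * J \<alpha> dn t) t = 0"
      using zeroE kb.kernel_op_add[OF dn Ja] J_comp[OF \<alpha>(1) b dn]
        kb.kernel_op_bounded_linear[OF bounded_linear_mult_right ka.sq_int_kernel_op[OF dn], of c]
      by eventually_elim (simp add: E_def)
    have b1: "1 - \<alpha> < 1" using \<alpha> by simp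
    have zero: "AE t in M. dn t + c * J \<alpha> dn t = 0"
      by (rule rl_injective[OF b b1 T sq_int_add[OF dn Ja] J0])
    obtain K where K: "\<And>v f r. 0 \<le> r \<Longrightarrow> sq_int M v \<Longrightarrow> sq_int M f \<Longrightarrow>
      (AE t in M. v t + \<i> * of_real r * J \<alpha> v t = f t) \<Longrightarrow>
      (LINT t|M. (cmod (v t))\<^sup>2) \<le> K * (LINT t|M. (cmod (f t))\<^sup>2)"
      using rl_apriori[OF \<alpha> T] by auto
    have "(LINT t|M. (cmod (dn t))\<^sup>2) \<le> 0"
      using K[of "lam n" dn "\<lambda>_. 0"] zero lam_pos[of n] dn by (simp add: c_def sq_int_def)
    then have "AE t in M. (cmod (dn t))\<^sup>2 = 0"
      using dn by (subst integral_nonneg_eq_0_iff_AE[symmetric]) (auto simp: sq_int_def intro: antisym)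
    then show ?thesis by eventually_elim (simp add: dn_def)
  qed
  then have "AE t in M. \<forall>n. cinner (d t) (\<phi> n) = 0" by (simp add: AE_all_countable)
  then show ?thesis
  proof eventually_elim
    case (elim t)
    then have "d t = 0" by (intro basis_eqI) (simp add: cinner_zero_left)
    then show ?case by (simp add: d_def)
  qed
qed

text \<open>\<open>v\<close> is assembled from scalar solutions by Riesz-Fischer. \<open>u\<close>
  is defined through the inverse of \<open>A\<close>, hence lies in \<open>D\<close> at every
  \<open>t\<close>, and is identified with J^\<alpha> v only afterwards and only a.e.\<close>

lemma strong_solution_exists:
  obtains K where "0 < K"
    "\<And>f. sq_int M f \<Longrightarrow> \<exists>u v. sq_int M v \<and> sq_int M u \<and> (AE t in M. u t = J \<alpha> v t) \<and>
      (\<forall>t. u t \<in> D \<and> A (u t) = \<i> *\<^sub>C (f t - v t)) \<and>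
      (LINT t|M. (norm (v t))\<^sup>2) \<le> K * (LINT t|M. (norm (f t))\<^sup>2)"
proof -
  obtain K where K: "0 < K" and apriori: "\<And>v f r. 0 \<le> r \<Longrightarrow> sq_int M v \<Longrightarrow> sq_int M f \<Longrightarrow>
      (AE t in M. v t + \<i> * of_real r * J \<alpha> v t = f t) \<Longrightarrow>
      (LINT t|M. (cmod (v t))\<^sup>2) \<le> K * (LINT t|M. (cmod (f t))\<^sup>2)"
    using rl_apriori[OF \<alpha> T] by auto
  have "\<exists>u v. sq_int M v \<and> sq_int M u \<and> (AE t in M. u t = J \<alpha> v t) \<and>
      (\<forall>t. u t \<in> D \<and> A (u t) = \<i> *\<^sub>C (f t - v t)) \<and>
      (LINT t|M. (norm (v t))\<^sup>2) \<le> K * (LINT t|M. (norm (f t))\<^sup>2)" if f: "sq_int M f" for f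
  proof -
    interpret ka: schur_kernel M "rl_kernel \<alpha>" "T powr \<alpha> / \<alpha> / Gamma \<alpha>" using \<alpha>(1) by (rule schur_J)
    have fn: "sq_int M (\<lambda>t. cinner (f t) (\<phi> n))" for n by (rule sq_int_coef[OF f])
    have "\<exists>w. sq_int M w \<and> (AE t in M. w t + \<i> * of_real (lam n) * J \<alpha> w t = cinner (f t) (\<phi> n))" for n
      using rl_volterra[OF \<alpha>(1) T fn[of n]] by blast
    then have "\<exists>vn. \<forall>n. sq_int M (vn n) \<and>
        (AE t in M. vn n t + \<i> * of_real (lam n) * J \<alpha> (vn n) t = cinner (f t) (\<phi> n))"
      by (intro choice allI)
    then obtain vn where vn_all: "\<forall>n. sq_int M (vn n) \<and>
        (AE t in M. vn n t + \<i> * of_real (lam n) * J \<alpha> (vn n) t = cinner (f t) (\<phi> n))" ..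
    have vn: "sq_int M (vn n)"
      and vn_eq: "AE t in M. vn n t + \<i> * of_real (lam n) * J \<alpha> (vn n) t = cinner (f t) (\<phi> n)" for n
      using vn_all[rule_format, of n] by (rule conjunct1, rule conjunct2)
    have vn_m[measurable]: "vn n \<in> borel_measurable M" for n using vn[of n] by (simp add: sq_int_def)
    have [measurable]: "f \<in> borel_measurable M" using f by (simp add: sq_int_def)
    have fn_m[measurable]: "(\<lambda>t. cinner (f t) (\<phi> n)) \<in> borel_measurable M" for n using fn[of n] by (simp add: sq_int_def)
    have bound: "sq_norm M (vn n) \<le> ennreal K * sq_norm M (\<lambda>t. cinner (f t) (\<phi> n))" for n
      using apriori[OF _ vn fn vn_eq, of n] lam_pos[of n] K
      by (simp add: sq_norm_eq vn fn ennreal_leI flip: ennreal_mult')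
    \<comment> \<open>To become the squared norm of \<open>v t\<close>. As \<open>K\<close> does not
      depend on \<open>n\<close>, the coordinate bounds add up by Tonelli and Parseval.\<close>
    define S where "S t = (\<Sum>n. (ennreal (cmod (vn n t)))\<^sup>2)" for t
    have S_int: "(\<integral>\<^sup>+t. S t \<partial>M) \<le> ennreal K * sq_norm M f"
    proof -
      have "(\<integral>\<^sup>+t. S t \<partial>M) = (\<Sum>n. sq_norm M (vn n))"
        unfolding S_def sq_norm_def by (rule nn_integral_suminf) measurable
      also have "\<dots> \<le> (\<Sum>n. ennreal K * sq_norm M (\<lambda>t. cinner (f t) (\<phi> n)))"
        by (intro suminf_le bound) auto
      also have "\<dots> = ennreal K * (\<Sum>n. sq_norm M (\<lambda>t. cinner (f t) (\<phi> n)))"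
        by (rule ennreal_suminf_cmult)
      also have "(\<Sum>n. sq_norm M (\<lambda>t. cinner (f t) (\<phi> n))) = (\<integral>\<^sup>+t. (\<Sum>n. (ennreal (cmod (cinner (f t) (\<phi> n))))\<^sup>2) \<partial>M)"
        unfolding sq_norm_def by (rule nn_integral_suminf[symmetric]) measurable
      also have "\<dots> = sq_norm M f"
        unfolding sq_norm_def
      proof (intro nn_integral_cong)
        fix t
        have "(\<Sum>n. (ennreal (cmod (cinner (f t) (\<phi> n))))\<^sup>2) = ennreal (\<Sum>n. (cmod (cinner (f t) (\<phi> n)))\<^sup>2)"
          using parseval_norm[of "f t"] by (subst suminf_ennreal2[symmetric]) (auto simp: ennreal_power sums_iff)
        then show "(\<Sum>n. (ennreal (cmod (cinner (f t) (\<phi> n))))\<^sup>2) = (ennreal (norm (f t)))\<^sup>2"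
          using parseval_norm[of "f t"] by (simp add: sums_iff ennreal_power)
      qed
      finally show ?thesis .
    qed
    have S_m[measurable]: "S \<in> borel_measurable M" unfolding S_def by measurable
    have "ennreal K * sq_norm M f < \<infinity>" using f by (simp add: sq_int_iff ennreal_mult_less_top)
    then have AE_S: "AE t in M. S t \<noteq> \<infinity>"
      using S_int by (intro nn_integral_PInf_AE) (auto simp: top_unique)
    define v where "v t = (\<Sum>n. vn n t *\<^sub>C \<phi> n)" for t
    have [measurable]: "(\<lambda>t. vn n t *\<^sub>C \<phi> n) \<in> borel_measurable M" for n
    proof -
      have "(\<lambda>a. a *\<^sub>C \<phi> n) \<in> borel_measurable borel"
        by (intro borel_measurable_continuous_onI linear_continuous_on bounded_linear_scaleC_left)
      then show ?thesis by measurable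
    qed
    have v_m[measurable]: "v \<in> borel_measurable M" unfolding v_def by measurable
    have coef: "AE t in M. (\<forall>n. cinner (v t) (\<phi> n) = vn n t) \<and> (ennreal (norm (v t)))\<^sup>2 = S t"
      using AE_S
    proof eventually_elim
      case (elim t)
      have "summable (\<lambda>n. (cmod (vn n t))\<^sup>2)"
        using elim by (intro summable_suminf_not_top) (auto simp: S_def ennreal_power)
      note rf = riesz_fischer[OF this]
      have c: "cinner (v t) (\<phi> n) = vn n t" for n unfolding v_def by (rule rf(2))
      have "S t = ennreal ((norm (v t))\<^sup>2)"
        using parseval_norm[of "v t"] \<open>summable (\<lambda>n. (cmod (vn n t))\<^sup>2)\<close>
        unfolding S_def by (simp add: c sums_iff ennreal_power suminf_ennreal2)
      with c show ?case by (simp add: ennreal_power)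
    qed
    have v_norm: "sq_norm M v \<le> ennreal K * sq_norm M f"
    proof -
      have "sq_norm M v = (\<integral>\<^sup>+t. S t \<partial>M)"
        unfolding sq_norm_def by (intro nn_integral_cong_AE) (use coef in \<open>auto elim: eventually_mono\<close>)
      then show ?thesis using S_int by simp
    qed
    have v: "sq_int M v"
      using v_norm \<open>ennreal K * sq_norm M f < \<infinity>\<close> by (auto simp: sq_int_iff intro: le_less_trans)
    have v_bound: "(LINT t|M. (norm (v t))\<^sup>2) \<le> K * (LINT t|M. (norm (f t))\<^sup>2)"
      using v_norm K by (simp add: sq_norm_eq v f flip: ennreal_mult')
    define u where "u t = op_inv (\<i> *\<^sub>C (f t - v t))" for t
    have diff: "sq_int M (\<lambda>t. f t - v t)"
      using sq_int_add[OF f, of "\<lambda>t. - v t"] v by (simp add: sq_int_def)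
    have u: "sq_int M u"
      unfolding u_def by (intro sq_int_bounded_linear[OF bounded_linear_op_inv] sq_int_bounded_linear[OF bounded_linear_scaleC] diff)
    have uD: "u t \<in> D" and uA: "A (u t) = \<i> *\<^sub>C (f t - v t)" for t
      by (simp_all add: u_def op_inv_dom op_op_inv)
    have lin: "bounded_linear (\<lambda>x :: 'h. cinner x (\<phi> n))" for n
      by (rule bounded_bilinear.bounded_linear_left[OF bounded_bilinear_cinner])
    have "AE t in M. \<forall>n. J \<alpha> (\<lambda>t. cinner (v t) (\<phi> n)) t = cinner (J \<alpha> v t) (\<phi> n)"
      unfolding AE_all_countable by (intro allI ka.kernel_op_bounded_linear lin v)
    moreover have "AE t in M. \<forall>n. vn n t + \<i> * of_real (lam n) * J \<alpha> (vn n) t = cinner (f t) (\<phi> n)"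
      unfolding AE_all_countable using vn_eq by blast
    ultimately have "AE t in M. u t = J \<alpha> v t"
      using coef AE_space
    proof eventually_elim
      case (elim t)
      have "J \<alpha> (\<lambda>t. cinner (v t) (\<phi> n)) t = J \<alpha> (vn n) t" for n
      proof (rule ka.kernel_op_cong_AE)
        show "AE t in M. cinner (v t) (\<phi> n) = vn n t" using coef by eventually_elim simp
        show "(\<lambda>t. cinner (v t) (\<phi> n)) \<in> borel_measurable M" using sq_int_coef[OF v] by (simp add: sq_int_def)
      qed (use elim vn_m in auto)
      then have Jv: "cinner (J \<alpha> v t) (\<phi> n) = J \<alpha> (vn n) t" for n using elim(1) by simp
      \<comment> \<open>The scalar equation says that \<i> (f - v) has the coefficients of
        \<open>A\<close> applied to J^\<alpha> v, so \<open>dom_by_coef\<close> shows that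
        J^\<alpha> v lies in the domain.\<close>
      have "cinner (\<i> *\<^sub>C (f t - v t)) (\<phi> n) = - of_real (lam n) * cinner (J \<alpha> v t) (\<phi> n)" for n
      proof -
        have "cinner (\<i> *\<^sub>C (f t - v t)) (\<phi> n) = \<i> * (cinner (f t) (\<phi> n) - vn n t)"
          using elim(3) by (simp add: cinner_scaleC_left cinner_diff_left)
        also have "cinner (f t) (\<phi> n) - vn n t = \<i> * of_real (lam n) * J \<alpha> (vn n) t"
          using elim(2)[rule_format, of n] by (simp add: diff_eq_eq add.commute)
        also have "\<i> * (\<i> * of_real (lam n) * J \<alpha> (vn n) t) = - of_real (lam n) * J \<alpha> (vn n) t"
          by (simp flip: mult.assoc)
        finally show ?thesis by (simp only: Jv)
      qed
      then have Jv_dom: "J \<alpha> v t \<in> D" "A (J \<alpha> v t) = \<i> *\<^sub>C (f t - v t)" by (rule dom_by_coef)+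
      show ?case by (rule op_inj[OF uD Jv_dom(1)]) (simp only: uA Jv_dom(2))
    qed
    then show ?thesis using v u uD uA v_bound by blast
  qed
  with K show thesis using that by blast
qed

text \<open>Simple functions approximating \<open>w\<close> in H are pulled back by
  \<open>op_inv\<close>: the distance in the norm of D(A) is the distance of the images under
  \<open>A\<close>.\<close>

lemma Lp_dom_of_measurable:
  assumes uD: "\<And>t. u t \<in> D" and w: "sq_int M w" and uA: "\<And>t. A (u t) = w t"
  shows "u \<in> Lp_dom D A 2 T"
proof -
  obtain s where s: "\<And>i. simple_function M (s i)" "\<And>t. t \<in> space M \<Longrightarrow> (\<lambda>i. s i t) \<longlonglongrightarrow> w t"
    using borel_measurable_implies_sequence_metric[OF sq_int_measurable[OF w], of 0] by blast
  have sf: "simple_function M (\<lambda>t. op_inv (s i t))" for i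
    using simple_function_compose[OF s(1), of op_inv i] by (simp add: comp_def)
  have "AE t in M. (\<lambda>i. norm (A (op_inv (s i t) - u t))) \<longlonglongrightarrow> 0"
    using AE_space
  proof eventually_elim
    case (elim t)
    have "(\<lambda>i. norm (s i t - w t)) \<longlonglongrightarrow> 0"
      using s(2)[OF elim] by (simp add: LIM_zero_iff tendsto_norm_zero_iff)
    then show ?case by (simp add: op_diff op_inv_dom uD op_op_inv uA)
  qed
  moreover have "integrable M (\<lambda>t. norm (A (u t)) powr 2)"
    using w by (simp add: uA sq_int_def powr_numeral)
  ultimately show ?thesis
    unfolding Lp_dom_def using sf uD
    by (auto intro!: exI[of _ "\<lambda>i t. op_inv (s i t)"] simp: op_inv_dom)
qed

text \<open>The constant is sqrt K + sqrt (2 + 2 K). The first summand bounds \<partial>^\<alpha> u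
  = v; the second bounds A u = \<i> (f - v) through \<parallel>f - v\<parallel>^2 \<le> 2
  \<parallel>f\<parallel>^2 + 2 \<parallel>v\<parallel>^2.\<close>

lemma maximal_regularity:
  "\<exists>C>0. \<forall>f\<in>Lp 2 T. \<exists>u.
     weak_solution D A \<alpha> 2 T f u \<and>
     (\<forall>u'. weak_solution D A \<alpha> 2 T f u' \<longrightarrow> (AE t in lebesgue_on {0<..<T}. u' t = u t)) \<and>
     u \<in> frac_Sobolev \<alpha> 2 T \<and> u \<in> Lp_dom D A 2 T \<and>
     frac_Sobolev_norm \<alpha> 2 T u + Lp_dom_norm A 2 T u \<le> C * Lp_norm 2 T f"
proof -
  obtain K where K: "0 < K" and ex: "\<And>f. sq_int M f \<Longrightarrow> \<exists>u v. sq_int M v \<and> sq_int M u \<and> (AE t in M. u t = J \<alpha> v t) \<and>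
      (\<forall>t. u t \<in> D \<and> A (u t) = \<i> *\<^sub>C (f t - v t)) \<and>
      (LINT t|M. (norm (v t))\<^sup>2) \<le> K * (LINT t|M. (norm (f t))\<^sup>2)"
    using strong_solution_exists by blast
  have "\<exists>u. weak_solution D A \<alpha> 2 T f u \<and>
     (\<forall>u'. weak_solution D A \<alpha> 2 T f u' \<longrightarrow> (AE t in M. u' t = u t)) \<and>
     u \<in> frac_Sobolev \<alpha> 2 T \<and> u \<in> Lp_dom D A 2 T \<and>
     frac_Sobolev_norm \<alpha> 2 T u + Lp_dom_norm A 2 T u \<le> (sqrt K + sqrt (2 + 2 * K)) * Lp_norm 2 T f"
    if "f \<in> Lp 2 T" for f
  proof -
    have f: "sq_int M f" using that by (simp add: Lp_two_iff)
    obtain u v where v: "sq_int M v" and u: "sq_int M u" and uJ: "AE t in M. u t = J \<alpha> v t"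
      and uD: "\<And>t. u t \<in> D" and uA: "\<And>t. A (u t) = \<i> *\<^sub>C (f t - v t)"
      and vf: "(LINT t|M. (norm (v t))\<^sup>2) \<le> K * (LINT t|M. (norm (f t))\<^sup>2)"
      using ex[OF f] by blast
    define F where "F = (LINT t|M. (norm (f t))\<^sup>2)"
    have diff: "sq_int M (\<lambda>t. f t - v t)"
      using sq_int_add[OF f, of "\<lambda>t. - v t"] v by (simp add: sq_int_def)
    have weak: "weak_solution D A \<alpha> 2 T f u"
      by (rule weak_solution_of_strong[OF f v u uJ uD uA])
    moreover have "\<forall>u'. weak_solution D A \<alpha> 2 T f u' \<longrightarrow> (AE t in M. u' t = u t)"
      using weak_solution_unique[OF _ weak] by blast
    moreover have "u \<in> frac_Sobolev \<alpha> 2 T"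
      unfolding frac_Sobolev_def using v uJ by (auto simp: Lp_two_iff AE_frac_int_iff)
    moreover have "u \<in> Lp_dom D A 2 T"
      using uD sq_int_bounded_linear[OF bounded_linear_scaleC diff] uA by (rule Lp_dom_of_measurable)
    moreover have "frac_Sobolev_norm \<alpha> 2 T u + Lp_dom_norm A 2 T u \<le> (sqrt K + sqrt (2 + 2 * K)) * Lp_norm 2 T f"
    proof -
      note fd = frac_deriv_AE_eq[OF \<alpha> T v uJ]
      have "(LINT t|M. (norm (frac_deriv \<alpha> 2 T u t))\<^sup>2) = (LINT t|M. (norm (v t))\<^sup>2)"
      proof (rule integral_cong_AE)
        show "AE t in M. (norm (frac_deriv \<alpha> 2 T u t))\<^sup>2 = (norm (v t))\<^sup>2"
          using fd(2) by eventually_elim simp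
      qed (use fd(1) v in \<open>auto simp: sq_int_def\<close>)
      then have 1: "frac_Sobolev_norm \<alpha> 2 T u \<le> sqrt (K * F)"
        using vf by (simp add: frac_Sobolev_norm_def Lp_norm_two F_def)
      have "(LINT t|M. (norm (f t - v t))\<^sup>2) \<le> (LINT t|M. 2 * (norm (f t))\<^sup>2 + 2 * (norm (v t))\<^sup>2)"
      proof (rule integral_mono)
        fix t
        have "(norm (f t - v t))\<^sup>2 \<le> (norm (f t) + norm (v t))\<^sup>2"
          by (intro power_mono norm_triangle_ineq4) simp
        also have "\<dots> \<le> 2 * (norm (f t))\<^sup>2 + 2 * (norm (v t))\<^sup>2"
          using zero_le_power2[of "norm (f t) - norm (v t)"] by (simp add: power2_eq_square algebra_simps)
        finally show "(norm (f t - v t))\<^sup>2 \<le> 2 * (norm (f t))\<^sup>2 + 2 * (norm (v t))\<^sup>2" .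
      qed (use f v diff in \<open>auto simp: sq_int_def\<close>)
      also have "\<dots> = 2 * F + 2 * (LINT t|M. (norm (v t))\<^sup>2)"
        using f v by (simp add: sq_int_def F_def)
      also have "\<dots> \<le> (2 + 2 * K) * F" using vf by (simp add: F_def algebra_simps)
      finally have "(LINT t|M. (norm (f t - v t))\<^sup>2) \<le> (2 + 2 * K) * F" .
      moreover have "Lp_dom_norm A 2 T u = sqrt (LINT t|M. (norm (f t - v t))\<^sup>2)"
        by (simp add: Lp_dom_norm_def powr_numeral powr_half_sqrt uA norm_scaleC)
      ultimately have 2: "Lp_dom_norm A 2 T u \<le> sqrt ((2 + 2 * K) * F)" by simp
      have "frac_Sobolev_norm \<alpha> 2 T u + Lp_dom_norm A 2 T u \<le> sqrt K * sqrt F + sqrt (2 + 2 * K) * sqrt F"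
        using add_mono[OF 1 2] by (simp only: real_sqrt_mult)
      also have "\<dots> = (sqrt K + sqrt (2 + 2 * K)) * Lp_norm 2 T f"
        by (simp only: Lp_norm_two F_def distrib_right)
      finally show ?thesis .
    qed
    ultimately show ?thesis by blast
  qed
  moreover have "0 < sqrt K + sqrt (2 + 2 * K)" using K by (simp add: add_pos_pos)
  ultimately show ?thesis by blast
qed

end

theorem theorem4p2:
  fixes D :: "'h::{chilbert_space, second_countable_topology} set"
    and A :: "'h \<Rightarrow> 'h"
    and \<phi> :: "nat \<Rightarrow> 'h"
    and lam :: "nat \<Rightarrow> real"
    and \<alpha> T :: real
  assumes "self_adjoint D A"
    and "negative_definite D A"
    and "compact_resolvent D A"
    and "orthonormal_basis \<phi>"
    and "\<And>n. \<phi> n \<in> D"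
    and "\<And>n. A (\<phi> n) = - (lam n *\<^sub>R \<phi> n)"
    and "0 < lam 0"
    and "mono lam"
    and "filterlim lam at_top sequentially"
    and "0 < \<alpha>" and "\<alpha> < 1"
    and "0 < T"
  shows "\<exists>C>0. \<forall>f\<in>Lp 2 T. \<exists>u.
           weak_solution D A \<alpha> 2 T f u \<and>
           (\<forall>u'. weak_solution D A \<alpha> 2 T f u' \<longrightarrow> (AE t in lebesgue_on {0<..<T}. u' t = u t)) \<and>
           u \<in> frac_Sobolev \<alpha> 2 T \<and> u \<in> Lp_dom D A 2 T \<and>
           frac_Sobolev_norm \<alpha> 2 T u + Lp_dom_norm A 2 T u \<le> C * Lp_norm 2 T f"
proof -
  interpret fractional_problem \<phi> D A lam \<alpha> T
    by unfold_locales (fact assms)+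
  show ?thesis by (rule maximal_regularity)
qed

end
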